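(* Let $n\in\mathbb N$ and assume that $(W,S)$ is an affine Weyl group (with $S$ its finite set of Coxeter generators). Then: (1) the set $\Sigma_n$ of $n$-small roots is bipodal; (2) the set $L_n(W)$ of $n$-low elements is a finite Garside shadow in $(W,S)$.
   Context: Here $\mathbb N=\{0,1,2,\dots\}$. Let $\ell$ be the length function of $(W,S)$. For $w=uv$ in $W$ with $\ell(w)=\ell(u)+\ell(v)$, $u$ is called a prefix of $w$ and $v$ a suffix of $w$. The (right) weak order on $W$ is $u\leq_R w$ iff $u$ is a prefix of $w$. A subset $X\subseteq W$ is bounded if there is $g\in W$ with $x\leq_R g$ for all $x\in X$; every bounded $X$ has a least upper bound $\bigvee X$ for $\leq_R$, called its join. A Garside shadow in $(W,S)$ is a subset $A\subseteq W$ containing $S$ such that (i) if $X\subseteq A$ is bounded then $\bigvee X\in A$, and (ii) every suffix of an element of $A$ is in $A$. Geometric representation and roots. Fix a geometric representation of $(W,S)$: a real vector space $V$ with a symmetric bilinear form $B$, and a simple system $\Delta=\{\alpha_s : s\in S\}\subseteq V$ (finite, indexed bijectively by $S$) such that: $\sum_{\alpha\in\Delta}a_\alpha\alpha=0$ with all $a_\alpha\ge 0$ implies all $a_\alpha=0$; $B(\alpha,\beta)\in\,]-\infty,-1]\cup\{-\cos(\pi/k): k\in\mathbb N, k\geq 2\}$ for distinct $\alpha,\beta\in\Delta$; $B(\alpha,\alpha)=1$ for $\alpha\in\Delta$; and $W$ is faithfully represented in the group of linear maps preserving $B$, with $s\in S$ acting by $v\mapsto v-2B(\alpha_s,v)\alpha_s$.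 (So $B(\alpha_s,\alpha_t)=-\cos(\pi/m_{st})$ if the order $m_{st}$ of $st$ is finite, and $B(\alpha_s,\alpha_t)\le -1$ iff $m_{st}=\infty$.) For $A\subseteq V$, $\operatorname{cone}(A)$ is the set of non-negative linear combinations of vectors of $A$. The root system is $\Phi=W(\Delta)$, with positive roots $\Phi^+=\operatorname{cone}(\Delta)\cap\Phi$ and negative roots $\Phi^-=-\Phi^+$; $\Phi=\Phi^+\sqcup\Phi^-$. For $\beta\in\Phi$, $s_\beta\in W$ is the reflection $v\mapsto v-2B(\beta,v)\beta$. Put $\operatorname{cone}_\Phi(A)=\operatorname{cone}(A)\cap\Phi$. The (left) inversion set of $w\in W$ is $N(w)=\Phi^+\cap w(\Phi^-)$. $n$-small roots and $n$-low elements. For $\alpha,\beta\in\Phi^+$, write $\alpha\preceq\beta$ if for all $w\in W$, $\beta\in N(w)$ implies $\alpha\in N(w)$; write $\alpha\prec\beta$ if moreover $\alpha\neq\beta$. The $\infty$-depth of $\beta\in\Phi^+$ is $\operatorname{dp}_\infty(\beta)=|\{\alpha\in\Phi^+ : \alpha\prec\beta\}|$, and $\Sigma_n=\{\beta\in\Phi^+:\operatorname{dp}_\infty(\beta)\le n\}$ is the set of $n$-small roots. An element $w\in W$ is $n$-low if $N(w)=\operatorname{cone}_\Phi(A)$ for some $A\subseteq\Sigma_n$. Reflection subgroups and bipodality. For a reflection subgroup $W'$ of $W$ (a subgroup generated by reflections $s_\beta$, $\beta\in\Phi$), put $\Phi_{W'}=\{\beta\in\Phi: s_\beta\in W'\}$,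 $\Phi_{W'}^+=\Phi_{W'}\cap\Phi^+$, and let $\Delta_{W'}=\{\alpha\in\Phi^+: N(s_\alpha)\cap\Phi_{W'}=\{\alpha\}\}$ be its canonical simple system. A maximal dihedral reflection subgroup is a subgroup $W'$ generated by $\{s_\beta:\beta\in P\cap\Phi\}$, where $P$ is a plane (2-dimensional linear subspace) of $V$ containing at least two positive roots; then $\Phi_{W'}=P\cap\Phi$ and $\Delta_{W'}=\{\alpha,\beta\}$ consists of two positive roots with $\Phi^+_{W'}=\operatorname{cone}(\alpha,\beta)\cap\Phi$. A subset $A\subseteq\Phi^+$ is bipodal if for every maximal dihedral reflection subgroup $W'$ of $W$: $A\cap(\Phi_{W'}^+\setminus\Delta_{W'})\neq\emptyset$ implies $\Delta_{W'}\subseteq A$. *)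

theory Defs
  imports
    "HOL-Analysis.Analysis"
    "HOL-Algebra.Group_Action"
    "HOL-Algebra.Multiplicative_Group"
    "HOL-Algebra.Lattice"
    "HOL-Library.Extended_Nat"
begin

section \<open>Coxeter systems, weak order and Garside shadows\<close>

text \<open>
  One step inserts a relator \<open>(s t)\<^sup>m\<close> into a word, where \<open>m\<close> is the order of \<open>s t\<close>.
  In the library an element of infinite order has \<open>ord = 0\<close>; the inserted word is then
  empty, so that no relation is imposed.
\<close>

inductive coxeter_step :: "('g, 'm) monoid_scheme \<Rightarrow> 'g set \<Rightarrow> 'g list \<Rightarrow> 'g list \<Rightarrow> bool"
  for W S where
  "s \<in> S \<Longrightarrow> t \<in> S \<Longrightarrow>
     coxeter_step W S (xs @ ys)
       (xs @ concat (replicate (group.ord W (s \<otimes>\<^bsub>W\<^esub> t)) [s, t]) @ ys)"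

definition word_value :: "('g, 'm) monoid_scheme \<Rightarrow> 'g list \<Rightarrow> 'g" where
  "word_value W xs = foldr (\<otimes>\<^bsub>W\<^esub>) xs \<one>\<^bsub>W\<^esub>"

text \<open>
  The axiom \<open>presentation\<close> says that the relations \<open>(s t)\<^sup>m = 1\<close>, for \<open>s, t \<in> S\<close> with \<open>s t\<close>
  of finite order \<open>m\<close>, present \<open>W\<close>. As the generators are involutions, words in the letters
  \<open>S\<close>, without formal inverses, suffice.
\<close>

locale coxeter_system = group W for W (structure) +
  fixes S
  assumes finite_gens: "finite S"
    and gens_closed: "S \<subseteq> carrier W"
    and generates: "generate W S = carrier W"
    and involution: "s \<in> S \<Longrightarrow> s \<noteq> \<one> \<and> s \<otimes> s = \<one>"
    and presentation:
      "set xs \<subseteq> S \<Longrightarrow> word_value W xs = \<one> \<Longrightarrow> equivclp (coxeter_step W S) xs []"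
begin

definition len :: "'a \<Rightarrow> nat" where
  "len w = (LEAST n. \<exists>xs. set xs \<subseteq> S \<and> length xs = n \<and> word_value W xs = w)"

definition prefix :: "'a \<Rightarrow> 'a \<Rightarrow> bool" where
  "prefix u w \<longleftrightarrow> u \<in> carrier W \<and> (\<exists>v\<in>carrier W. w = u \<otimes> v \<and> len w = len u + len v)"

definition suffix :: "'a \<Rightarrow> 'a \<Rightarrow> bool" where
  "suffix v w \<longleftrightarrow> v \<in> carrier W \<and> (\<exists>u\<in>carrier W. w = u \<otimes> v \<and> len w = len u + len v)"

definition weak_order :: "'a gorder" where
  "weak_order = \<lparr>carrier = carrier W, eq = (=), le = prefix\<rparr>"

definition bounded_above :: "'a set \<Rightarrow> bool" where
  "bounded_above X \<longleftrightarrow> (\<exists>g\<in>carrier W. \<forall>x\<in>X. prefix x g)"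

definition garside_shadow :: "'a set \<Rightarrow> bool" where
  "garside_shadow A \<longleftrightarrow> A \<subseteq> carrier W \<and> S \<subseteq> A \<and>
     (\<forall>X\<subseteq>A. bounded_above X \<longrightarrow> \<Squnion>\<^bsub>weak_order\<^esub> X \<in> A) \<and>
     (\<forall>w\<in>A. \<forall>v. suffix v w \<longrightarrow> v \<in> A)"

end

section \<open>Geometric representations, small roots and low elements\<close>

definition cone :: "'v::real_vector set \<Rightarrow> 'v set" where
  "cone A = {\<Sum>a\<in>F. c a *\<^sub>R a | F c. finite F \<and> F \<subseteq> A \<and> (\<forall>a\<in>F. 0 \<le> c a)}"

text \<open>
  The vector space \<open>V\<close> is the whole type \<open>'v\<close>, \<open>\<alpha> s\<close> is the simple root of \<open>s\<close>, and
  \<open>\<rho>\<close> is the action of \<open>W\<close> on \<open>V\<close>. The simple roots need not be linearly independent.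
\<close>

locale geometric_representation = coxeter_system W S for W (structure) and S +
  fixes B :: "'v::real_vector \<Rightarrow> 'v \<Rightarrow> real"
    and \<alpha> :: "'a \<Rightarrow> 'v"
    and \<rho> :: "'a \<Rightarrow> 'v \<Rightarrow> 'v"
  assumes form_bilinear: "bilinear B"
    and form_sym: "B x y = B y x"
    and simple_inj: "inj_on \<alpha> S"
    and simple_positively_independent:
      "(\<And>s. s \<in> S \<Longrightarrow> 0 \<le> a s) \<Longrightarrow> (\<Sum>s\<in>S. a s *\<^sub>R \<alpha> s) = 0 \<Longrightarrow> s \<in> S \<Longrightarrow> a s = 0"
    and form_simple:
      "s \<in> S \<Longrightarrow> t \<in> S \<Longrightarrow> s \<noteq> t \<Longrightarrow>
         B (\<alpha> s) (\<alpha> t) \<le> -1 \<or> (\<exists>k::nat. 2 \<le> k \<and> B (\<alpha> s) (\<alpha> t) = - cos (pi / real k))"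
    and form_simple_self: "s \<in> S \<Longrightarrow> B (\<alpha> s) (\<alpha> s) = 1"
    and act_faithful: "faithful_action W UNIV \<rho>"
    and act_linear: "w \<in> carrier W \<Longrightarrow> linear (\<rho> w)"
    and act_form: "w \<in> carrier W \<Longrightarrow> B (\<rho> w x) (\<rho> w y) = B x y"
    and act_simple: "s \<in> S \<Longrightarrow> \<rho> s x = x - (2 * B (\<alpha> s) x) *\<^sub>R \<alpha> s"
begin

definition roots :: "'v set" where
  "roots = {\<rho> w (\<alpha> s) | w s. w \<in> carrier W \<and> s \<in> S}"

definition pos_roots :: "'v set" where
  "pos_roots = cone (\<alpha> ` S) \<inter> roots"

definition neg_roots :: "'v set" where
  "neg_roots = uminus ` pos_roots"

definition root_cone :: "'v set \<Rightarrow> 'v set" where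
  "root_cone A = cone A \<inter> roots"

definition inversion_set :: "'a \<Rightarrow> 'v set" where
  "inversion_set w = pos_roots \<inter> \<rho> w ` neg_roots"

definition dominated :: "'v \<Rightarrow> 'v \<Rightarrow> bool" where
  "dominated \<gamma> \<beta> \<longleftrightarrow> (\<forall>w\<in>carrier W. \<beta> \<in> inversion_set w \<longrightarrow> \<gamma> \<in> inversion_set w)"

definition strictly_dominated :: "'v \<Rightarrow> 'v set" where
  "strictly_dominated \<beta> = {\<gamma> \<in> pos_roots. dominated \<gamma> \<beta> \<and> \<gamma> \<noteq> \<beta>}"

text \<open>
  The depth takes values in the extended naturals because \<open>card\<close> is \<open>0\<close> on infinite sets.
\<close>

definition inf_depth :: "'v \<Rightarrow> enat" where
  "inf_depth \<beta> =
     (if finite (strictly_dominated \<beta>) then enat (card (strictly_dominated \<beta>)) else \<infinity>)"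

definition small_roots :: "nat \<Rightarrow> 'v set" where
  "small_roots n = {\<beta> \<in> pos_roots. inf_depth \<beta> \<le> enat n}"

definition low_elements :: "nat \<Rightarrow> 'a set" where
  "low_elements n = {w \<in> carrier W. \<exists>A\<subseteq>small_roots n. inversion_set w = root_cone A}"

definition reflection :: "'v \<Rightarrow> 'a" where
  "reflection \<beta> = (THE w. w \<in> carrier W \<and> \<rho> w = (\<lambda>x. x - (2 * B \<beta> x) *\<^sub>R \<beta>))"

definition subgroup_roots :: "'a set \<Rightarrow> 'v set" where
  "subgroup_roots H = {\<beta> \<in> roots. reflection \<beta> \<in> H}"

definition subgroup_pos_roots :: "'a set \<Rightarrow> 'v set" where
  "subgroup_pos_roots H = subgroup_roots H \<inter> pos_roots"

definition canonical_simple_system :: "'a set \<Rightarrow> 'v set" where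
  "canonical_simple_system H =
     {\<gamma> \<in> pos_roots. inversion_set (reflection \<gamma>) \<inter> subgroup_roots H = {\<gamma>}}"

definition maximal_dihedral :: "'a set \<Rightarrow> bool" where
  "maximal_dihedral H \<longleftrightarrow>
     (\<exists>P. subspace P \<and> dim P = 2 \<and>
          (\<exists>\<beta>\<in>P \<inter> pos_roots. \<exists>\<gamma>\<in>P \<inter> pos_roots. \<beta> \<noteq> \<gamma>) \<and>
          H = generate W (reflection ` (P \<inter> roots)))"

definition bipodal :: "'v set \<Rightarrow> bool" where
  "bipodal A \<longleftrightarrow> A \<subseteq> pos_roots \<and>
     (\<forall>H. maximal_dihedral H \<longrightarrow>
          A \<inter> (subgroup_pos_roots H - canonical_simple_system H) \<noteq> {} \<longrightarrow>
          canonical_simple_system H \<subseteq> A)"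

end

section \<open>Affine Weyl groups\<close>

text \<open>Reduced, but not necessarily irreducible, crystallographic root systems.\<close>

definition crystallographic_root_system :: "'e::euclidean_space set \<Rightarrow> bool" where
  "crystallographic_root_system R \<longleftrightarrow>
     finite R \<and> 0 \<notin> R \<and> span R = UNIV \<and>
     (\<forall>a\<in>R. \<forall>b\<in>R. b - (2 * (a \<bullet> b) / (a \<bullet> a)) *\<^sub>R a \<in> R) \<and>
     (\<forall>a\<in>R. \<forall>b\<in>R. 2 * (a \<bullet> b) / (a \<bullet> a) \<in> \<int>) \<and>
     (\<forall>a\<in>R. \<forall>c::real. c *\<^sub>R a \<in> R \<longrightarrow> c = 1 \<or> c = -1)"

definition affine_hyperplane :: "'e::euclidean_space \<Rightarrow> int \<Rightarrow> 'e set" where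
  "affine_hyperplane a k = {x. a \<bullet> x = real_of_int k}"

text \<open>The orthogonal reflection in \<open>affine_hyperplane a k\<close>.\<close>

definition affine_reflection :: "'e::euclidean_space \<Rightarrow> int \<Rightarrow> 'e \<Rightarrow> 'e" where
  "affine_reflection a k x = x - (2 * (a \<bullet> x - real_of_int k) / (a \<bullet> a)) *\<^sub>R a"

definition affine_weyl_group :: "'e::euclidean_space set \<Rightarrow> ('e \<Rightarrow> 'e) monoid" where
  "affine_weyl_group R =
     (BijGroup UNIV)
       \<lparr>carrier := generate (BijGroup UNIV) {affine_reflection a k | a k. a \<in> R}\<rparr>"

definition alcoves :: "'e::euclidean_space set \<Rightarrow> 'e set set" where
  "alcoves R = components (- (\<Union>a\<in>R. \<Union>k. affine_hyperplane a k))"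

text \<open>
  A hyperplane of the arrangement is a wall of the alcove \<open>C\<close> if it is the affine span of its
  intersection with the closure of \<open>C\<close>.
\<close>

definition wall_reflections :: "'e::euclidean_space set \<Rightarrow> 'e set \<Rightarrow> ('e \<Rightarrow> 'e) set" where
  "wall_reflections R C =
     {affine_reflection a k | a k. a \<in> R \<and>
        affine hull (affine_hyperplane a k \<inter> closure C) = affine_hyperplane a k}"

text \<open>
  \<open>(W, S)\<close> is the affine Weyl group of \<open>R\<close>, with \<open>S\<close> corresponding to the reflections in the
  walls of an alcove.
\<close>

definition is_affine_weyl_group ::
    "('g, 'm) monoid_scheme \<Rightarrow> 'g set \<Rightarrow> 'e::euclidean_space set \<Rightarrow> bool" where
  "is_affine_weyl_group W S R \<longleftrightarrow> crystallographic_root_system R \<and>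
     (\<exists>C\<in>alcoves R. \<exists>\<phi>\<in>iso W (affine_weyl_group R). \<phi> ` S = wall_reflections R C)"

end

theory Submission
  imports Defs
begin

text \<open>
  Write \<open>N(w)\<close> for the inversion set of \<open>w\<close>.  The proof has one part that holds for every Coxeter
  system and one that uses the affine Weyl group.

  \<^bold>\<open>The general part.\<close>  Everything rests on a criterion for generating an inversion set
  (\<open>descents_generate\<close>): if a set \<open>A\<close> contains the roots \<open>- w \<alpha>\<^sub>t\<close> of the right descents \<open>t\<close> of \<open>w\<close>
  and is bipodal relative to \<open>w\<close>, then \<open>N(w)\<close> lies in the cone of \<open>A \<inter> N(w)\<close>.  Only the extreme
  rays of the cone of \<open>N(w)\<close> matter.  An extreme root \<open>b\<close> that is not a descent root is the end of
  some plane which contains another extreme inversion \<open>x\<close>, further inside, and whose other end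
  is not an inversion (\<open>short_covers\<close>); bipodality then passes membership in \<open>A\<close> from \<open>x\<close> to \<open>b\<close>,
  and the process terminates because \<open>x\<close> is nearer to the non-inversions than \<open>b\<close>.  The pair is
  found by climbing from \<open>w\<close> in the weak order until \<open>b\<close> is a descent root, or meets one at an
  acute angle.

  Three consequences follow.  Applied to \<open>A = \<Union>x\<in>X. N(x)\<close> and to a shortest upper bound \<open>u\<close> of \<open>X\<close>,
  the criterion gives that \<open>N(u)\<close> is contained in the cone of \<open>A\<close>, so \<open>u\<close> is the join of \<open>X\<close>, and
  it is low if all of \<open>X\<close> is.  Applied to the small roots, it gives that suffixes of low elements
  are low: deleting the first letter \<open>s\<close> of \<open>w\<close> turns descent roots into their images under \<open>s\<close>,
  which does not increase the depth (\<open>depth_step\<close>).  So low elements form a Garside shadow as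
  soon as the small roots are bipodal (\<open>bipodal_garside_shadow\<close>), and there are finitely many of
  them as soon as there are finitely many small roots.

  \<^bold>\<open>The affine part.\<close>  Positive roots correspond to the hyperplanes \<open>a \<bullet> x = k\<close>, taken with the sign
  for which the base alcove is on the positive side; \<open>N(w)\<close> corresponds to the hyperplanes
  that separate the base alcove from its image under \<open>w\<close> (\<open>inversion_ev\<close>).  Every nonempty open
  set meets such an image, so linear relations between roots force sign relations between the
  affine functions.  A root dominates exactly the parallel ones between it and the base alcove,
  hence the depth of \<open>(a, k)\<close> is \<open>\<lfloor>a \<bullet> x\<^sub>0\<rfloor> - k\<close>, with \<open>x\<^sub>0\<close> in the base alcove, and there are
  \<open>n + 1\<close> roots of depth at most \<open>n\<close> for each \<open>a\<close>.  For bipodality, a plane of roots either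
  consists of parallel hyperplanes, and then its simple roots have depth \<open>0\<close>, or of finitely
  many hyperplanes with a common point.  In the second case every root of the plane is reached from a
  simple root by adding positive integral multiples of simple roots, because Cartan numbers are
  integers, and such an addition cannot decrease the depth (\<open>depth_monotone\<close>).
\<close>

section \<open>Cones and words\<close>

lemma cone_base: "x \<in> A \<Longrightarrow> x \<in> cone A"
  unfolding cone_def by (rule CollectI, rule exI[of _ "{x}"], rule exI[of _ "\<lambda>_. 1"]) auto

lemma cone_zero: "0 \<in> cone A"
  unfolding cone_def by (rule CollectI, rule exI[of _ "{}"]) auto

lemma coneI: "finite F \<Longrightarrow> F \<subseteq> A \<Longrightarrow> \<forall>a\<in>F. 0 \<le> c a \<Longrightarrow> x = (\<Sum>a\<in>F. c a *\<^sub>R a) \<Longrightarrow> x \<in> cone A"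
  unfolding cone_def by blast

lemma cone_scale:
  assumes "x \<in> cone A" "0 \<le> (c::real)"
  shows "c *\<^sub>R x \<in> cone A"
proof -
  obtain F d where F: "finite F" "F \<subseteq> A" "\<forall>a\<in>F. 0 \<le> d a" "x = (\<Sum>a\<in>F. d a *\<^sub>R a)"
    using assms(1) unfolding cone_def by blast
  then have "c *\<^sub>R x = (\<Sum>a\<in>F. (c * d a) *\<^sub>R a)"
    by (simp add: scaleR_sum_right)
  moreover have "\<forall>a\<in>F. 0 \<le> c * d a" using F assms by simp
  ultimately show ?thesis using F by (intro coneI)
qed

lemma cone_add:
  assumes "x \<in> cone A" "y \<in> cone A"
  shows "x + y \<in> cone A"
proof -
  obtain F d where F: "finite F" "F \<subseteq> A" "\<forall>a\<in>F. 0 \<le> d a" "x = (\<Sum>a\<in>F. d a *\<^sub>R a)"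
    using assms(1) unfolding cone_def by blast
  obtain G e where G: "finite G" "G \<subseteq> A" "\<forall>a\<in>G. 0 \<le> e a" "y = (\<Sum>a\<in>G. e a *\<^sub>R a)"
    using assms(2) unfolding cone_def by blast
  have x: "x = (\<Sum>a\<in>F\<union>G. (if a \<in> F then d a else 0) *\<^sub>R a)"
    unfolding F(4) by (rule sum.mono_neutral_cong_left) (use F G in auto)
  have y: "y = (\<Sum>a\<in>F\<union>G. (if a \<in> G then e a else 0) *\<^sub>R a)"
    unfolding G(4) by (rule sum.mono_neutral_cong_left) (use F G in auto)
  have "x + y = (\<Sum>a\<in>F\<union>G. ((if a \<in> F then d a else 0) + (if a \<in> G then e a else 0)) *\<^sub>R a)"
    unfolding scaleR_left_distrib sum.distrib using x y by simp
  moreover have "\<forall>a\<in>F\<union>G. 0 \<le> (if a \<in> F then d a else 0) + (if a \<in> G then e a else 0)"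
    using F G by auto
  ultimately show ?thesis using F G by (intro coneI[of "F \<union> G"]) auto
qed

lemma cone_sum:
  "(\<And>i. i \<in> I \<Longrightarrow> f i \<in> cone A) \<Longrightarrow> (\<Sum>i\<in>I. f i) \<in> cone A"
  by (induction I rule: infinite_finite_induct) (auto intro: cone_zero cone_add)

lemma cone_minimal:
  assumes "x \<in> cone A" "0 \<in> T" "\<And>a. a \<in> A \<Longrightarrow> a \<in> T"
    and "\<And>y z. y \<in> T \<Longrightarrow> z \<in> T \<Longrightarrow> y + z \<in> T"
    and "\<And>(c::real) y. 0 \<le> c \<Longrightarrow> y \<in> T \<Longrightarrow> c *\<^sub>R y \<in> T"
  shows "x \<in> T"
proof -
  obtain F d where F: "finite F" "F \<subseteq> A" "\<forall>a\<in>F. 0 \<le> d a" "x = (\<Sum>a\<in>F. d a *\<^sub>R a)"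
    using assms(1) unfolding cone_def by blast
  have "(\<Sum>a\<in>F. d a *\<^sub>R a) \<in> T" using F(1-3)
  proof (induction F rule: finite_induct)
    case (insert x F)
    then show ?case by (auto intro: assms(3-5))
  qed (simp add: assms)
  then show ?thesis using F by simp
qed

lemma cone_mono: "A \<subseteq> B \<Longrightarrow> cone A \<subseteq> cone B"
  unfolding cone_def by blast

lemma cone_trans: "x \<in> cone A \<Longrightarrow> A \<subseteq> cone B \<Longrightarrow> x \<in> cone B"
  by (erule cone_minimal) (auto intro: cone_zero cone_add cone_scale)

lemma cone_pair: "x \<in> A \<Longrightarrow> y \<in> A \<Longrightarrow> 0 \<le> p \<Longrightarrow> 0 \<le> q \<Longrightarrow> p *\<^sub>R x + q *\<^sub>R y \<in> cone A"
  by (intro cone_add cone_scale cone_base)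

lemma cone_finite_iff:
  assumes "finite A"
  shows "x \<in> cone A \<longleftrightarrow> (\<exists>c. (\<forall>a\<in>A. 0 \<le> c a) \<and> x = (\<Sum>a\<in>A. c a *\<^sub>R a))"
proof
  assume "x \<in> cone A"
  then obtain F d where F: "finite F" "F \<subseteq> A" "\<forall>a\<in>F. 0 \<le> d a" "x = (\<Sum>a\<in>F. d a *\<^sub>R a)"
    unfolding cone_def by blast
  have "x = (\<Sum>a\<in>A. (if a \<in> F then d a else 0) *\<^sub>R a)"
    unfolding F(4) by (rule sum.mono_neutral_cong_left) (use F assms in auto)
  then show "\<exists>c. (\<forall>a\<in>A. 0 \<le> c a) \<and> x = (\<Sum>a\<in>A. c a *\<^sub>R a)"
    using F by (intro exI[of _ "\<lambda>a. if a \<in> F then d a else 0"]) auto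
qed (use assms in \<open>auto simp: cone_def\<close>)

lemma cone_linear_image:
  assumes "linear f" "x \<in> cone A"
  shows "f x \<in> cone (f ` A)"
proof -
  have "x \<in> {x. f x \<in> cone (f ` A)}"
    using assms(2) by (rule cone_minimal)
      (auto simp: linear_0[OF assms(1)] linear_add[OF assms(1)] linear_scale[OF assms(1)]
         intro: cone_zero cone_add cone_scale cone_base)
  then show ?thesis by simp
qed

lemma word_value_Nil [simp]: "word_value W [] = \<one>\<^bsub>W\<^esub>"
  and word_value_Cons [simp]: "word_value W (x # xs) = x \<otimes>\<^bsub>W\<^esub> word_value W xs"
  by (simp_all add: word_value_def)

context coxeter_system
begin

lemma gen_carrier [simp]: "s \<in> S \<Longrightarrow> s \<in> carrier W"
  using gens_closed by blast

lemma gen_sq [simp]: "s \<in> S \<Longrightarrow> s \<otimes> s = \<one>"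
  using involution by blast

lemma gen_inv [simp]: "s \<in> S \<Longrightarrow> inv s = s"
  by (rule inv_equality) auto

lemma mult_gen_gen [simp]: "s \<in> S \<Longrightarrow> w \<in> carrier W \<Longrightarrow> w \<otimes> s \<otimes> s = w"
  by (simp add: m_assoc)

lemma gen_gen_mult [simp]: "s \<in> S \<Longrightarrow> w \<in> carrier W \<Longrightarrow> s \<otimes> (s \<otimes> w) = w"
  by (simp add: m_assoc[symmetric])

lemma word_closed [simp]: "set xs \<subseteq> S \<Longrightarrow> word_value W xs \<in> carrier W"
  by (induction xs) auto

lemma word_append:
  "set xs \<subseteq> S \<Longrightarrow> set ys \<subseteq> S \<Longrightarrow> word_value W (xs @ ys) = word_value W xs \<otimes> word_value W ys"
  by (induction xs) (auto simp: m_assoc)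

lemma word_rev: "set xs \<subseteq> S \<Longrightarrow> word_value W (rev xs) = inv (word_value W xs)"
  by (induction xs) (auto simp: word_append inv_mult_group)

lemma generate_word:
  assumes "J \<subseteq> S" "w \<in> generate W J"
  shows "\<exists>xs. set xs \<subseteq> J \<and> word_value W xs = w"
  using assms(2)
proof induction
  case one
  then show ?case by (rule exI[of _ "[]"]) simp
next
  case (incl h)
  then show ?case using assms(1) by (intro exI[of _ "[h]"]) auto
next
  case (inv h)
  then show ?case using assms(1) by (intro exI[of _ "[h]"]) auto
next
  case (eng h1 h2)
  then obtain xs ys where "set xs \<subseteq> J" "word_value W xs = h1" "set ys \<subseteq> J" "word_value W ys = h2"
    by auto
  then show ?case using assms(1) by (intro exI[of _ "xs @ ys"]) (auto simp: word_append)
qed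

text \<open>
  Length with respect to a set \<open>J\<close> of generators; the two cases used are \<open>J = S\<close>, which is
  \<open>len\<close>, and a pair of generators.
\<close>

definition jlen :: "'a set \<Rightarrow> 'a \<Rightarrow> nat" where
  "jlen J w = (LEAST n. \<exists>xs. set xs \<subseteq> J \<and> length xs = n \<and> word_value W xs = w)"

definition jwords :: "'a set \<Rightarrow> 'a set" where
  "jwords J = {word_value W xs | xs. set xs \<subseteq> J}"

lemma len_jlen: "len = jlen S"
  by (simp add: fun_eq_iff len_def jlen_def)

lemma jlen_le: "set xs \<subseteq> J \<Longrightarrow> jlen J (word_value W xs) \<le> length xs"
  unfolding jlen_def by (rule Least_le) auto

lemma jlen_word:
  assumes "w \<in> jwords J"
  obtains xs where "set xs \<subseteq> J" "length xs = jlen J w" "word_value W xs = w"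
proof -
  have "\<exists>n xs. set xs \<subseteq> J \<and> length xs = n \<and> word_value W xs = w"
    using assms by (auto simp: jwords_def)
  from LeastI_ex[OF this] show ?thesis
    using that unfolding jlen_def by blast
qed

lemma carrier_jwords: "jwords S = carrier W"
  using generate_word[of S] generates by (auto simp: jwords_def)

lemma jwords_sub: "J \<subseteq> S \<Longrightarrow> jwords J \<subseteq> carrier W"
  by (auto simp: jwords_def intro!: word_closed)

lemma jwords_mult: "J \<subseteq> S \<Longrightarrow> u \<in> jwords J \<Longrightarrow> v \<in> jwords J \<Longrightarrow> u \<otimes> v \<in> jwords J"
  unfolding jwords_def
proof clarify
  fix xs ys assume "J \<subseteq> S" "set xs \<subseteq> J" "set ys \<subseteq> J"
  then show "\<exists>zs. word_value W xs \<otimes> word_value W ys = word_value W zs \<and> set zs \<subseteq> J"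
    by (intro exI[of _ "xs @ ys"]) (subst word_append, auto)
qed

lemma jwords_gen: "J \<subseteq> S \<Longrightarrow> s \<in> J \<Longrightarrow> s \<in> jwords J"
  unfolding jwords_def by (auto intro!: exI[of _ "[s]"])

lemma jlen_mult:
  assumes "J \<subseteq> S" "u \<in> jwords J" "v \<in> jwords J"
  shows "jlen J (u \<otimes> v) \<le> jlen J u + jlen J v"
proof -
  obtain xs where xs: "set xs \<subseteq> J" "length xs = jlen J u" "word_value W xs = u"
    using assms jlen_word by blast
  obtain ys where ys: "set ys \<subseteq> J" "length ys = jlen J v" "word_value W ys = v"
    using assms jlen_word by blast
  have "word_value W (xs @ ys) = u \<otimes> v" using xs ys assms by (subst word_append) auto
  moreover have "jlen J (word_value W (xs @ ys)) \<le> length (xs @ ys)"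
    by (rule jlen_le) (use xs ys in auto)
  ultimately show ?thesis using xs ys by simp
qed

lemma jlen_gen: "J \<subseteq> S \<Longrightarrow> s \<in> J \<Longrightarrow> jlen J s \<le> 1"
  using jlen_le[of "[s]" J] by auto

lemmas len_word = jlen_word[of _ S, folded len_jlen, unfolded carrier_jwords]
lemmas len_le = jlen_le[of _ S, folded len_jlen]
lemmas len_mult = jlen_mult[of S, OF order.refl, folded len_jlen, unfolded carrier_jwords]
lemmas len_gen = jlen_gen[of S, OF order.refl, folded len_jlen]

lemma len_one [simp]: "len \<one> = 0"
  using len_le[of "[]"] by simp

lemma len_zero: "w \<in> carrier W \<Longrightarrow> len w = 0 \<longleftrightarrow> w = \<one>"
proof -
  assume w: "w \<in> carrier W"
  show ?thesis
  proof
    assume "len w = 0"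
    moreover obtain xs where "set xs \<subseteq> S" "length xs = len w" "word_value W xs = w"
      using w len_word by blast
    ultimately show "w = \<one>" by simp
  qed simp
qed

lemma len_inv_le: "w \<in> carrier W \<Longrightarrow> len (inv w) \<le> len w"
proof -
  assume w: "w \<in> carrier W"
  then obtain xs where xs: "set xs \<subseteq> S" "length xs = len w" "word_value W xs = w"
    using len_word by blast
  then have "len (word_value W (rev xs)) \<le> length (rev xs)" by (intro len_le) simp
  then show ?thesis using xs by (simp add: word_rev)
qed

lemma len_inv: "w \<in> carrier W \<Longrightarrow> len (inv w) = len w"
  using len_inv_le[of w] len_inv_le[of "inv w"] by simp

lemma len_le_jlen: "J \<subseteq> S \<Longrightarrow> w \<in> jwords J \<Longrightarrow> len w \<le> jlen J w"
proof -
  assume J: "J \<subseteq> S" "w \<in> jwords J"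
  then obtain xs where xs: "set xs \<subseteq> J" "length xs = jlen J w" "word_value W xs = w"
    using jlen_word by blast
  then show ?thesis using len_le[of xs] J by simp
qed

lemma coxeter_step_parity: "coxeter_step W S xs ys \<Longrightarrow> even (length xs) \<longleftrightarrow> even (length ys)"
  by (induction rule: coxeter_step.induct) (auto simp: length_concat sum_list_replicate)

lemma word_one_even:
  assumes "set xs \<subseteq> S" "word_value W xs = \<one>"
  shows "even (length xs)"
proof -
  have "equivclp (coxeter_step W S) xs []" using presentation assms by blast
  then have "even (length xs) \<longleftrightarrow> even (length ([] :: 'a list))"
    by (induction rule: equivclp_induct) (auto dest: coxeter_step_parity)
  then show ?thesis by simp
qed

lemma word_parity:
  assumes "set xs \<subseteq> S"
  shows "even (length xs) \<longleftrightarrow> even (len (word_value W xs))"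
proof -
  have c: "word_value W xs \<in> carrier W" using assms by simp
  then obtain ys where ys: "set ys \<subseteq> S" "length ys = len (word_value W xs)"
      "word_value W ys = word_value W xs"
    using len_word by blast
  have "word_value W (xs @ rev ys) = \<one>"
    using assms ys c by (simp add: word_append word_rev)
  then have "even (length (xs @ rev ys))"
    using word_one_even[of "xs @ rev ys"] assms ys by simp
  then show ?thesis using ys by simp
qed

lemma len_gen_cases:
  assumes "w \<in> carrier W" "s \<in> S"
  shows "len (w \<otimes> s) = Suc (len w) \<or> len w = Suc (len (w \<otimes> s))"
proof -
  obtain xs where xs: "set xs \<subseteq> S" "length xs = len w" "word_value W xs = w"
    using assms len_word by blast
  have "word_value W (xs @ [s]) = w \<otimes> s" using xs assms by (subst word_append) auto
  then have "even (length (xs @ [s])) \<longleftrightarrow> even (len (w \<otimes> s))"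
    using word_parity[of "xs @ [s]"] xs assms by simp
  then have ne: "len (w \<otimes> s) \<noteq> len w" using xs by auto
  have "len (w \<otimes> s) \<le> len w + 1"
    using len_mult[of w s] len_gen[of s] assms by simp
  moreover have "len w \<le> len (w \<otimes> s) + 1"
    using len_mult[of "w \<otimes> s" s] len_gen[of s] assms by simp
  ultimately show ?thesis using ne by linarith
qed

lemma len_last:
  assumes "w \<in> carrier W" "w \<noteq> \<one>"
  obtains v s where "v \<in> carrier W" "s \<in> S" "w = v \<otimes> s" "len w = Suc (len v)"
proof -
  obtain xs where xs: "set xs \<subseteq> S" "length xs = len w" "word_value W xs = w"
    using assms len_word by blast
  have "xs \<noteq> []" using xs assms by auto
  then obtain ys s where ys: "xs = ys @ [s]" by (metis rev_exhaust)
  define v where "v = word_value W ys"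
  have v: "v \<in> carrier W" "s \<in> S" using xs ys by (auto simp: v_def)
  have w: "w = v \<otimes> s" using xs ys v by (auto simp: v_def word_append)
  have "len v \<le> length ys" unfolding v_def using xs ys by (intro len_le) auto
  then have "len v < len w" using xs ys by simp
  then have "len w = Suc (len v)" using len_gen_cases[of v s] v w by auto
  then show ?thesis using that v w by blast
qed

lemma len_first:
  assumes "w \<in> carrier W" "w \<noteq> \<one>"
  obtains v s where "v \<in> carrier W" "s \<in> S" "w = s \<otimes> v" "len w = Suc (len v)"
proof -
  have "inv w \<in> carrier W" "inv w \<noteq> \<one>" using assms by auto
  then obtain v s where v: "v \<in> carrier W" "s \<in> S" "inv w = v \<otimes> s" "len (inv w) = Suc (len v)"
    using len_last by blast
  then have "w = s \<otimes> inv v" using assms by (metis gen_carrier gen_inv inv_inv inv_mult_group)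
  then show ?thesis using that[of "inv v" s] v len_inv[OF assms(1)] len_inv[OF v(1)] by auto
qed

end

section \<open>Dihedral words\<close>

text \<open>
  These are the values \<open>sin (n x) / sin x\<close> for \<open>c = cos x\<close>.  The recursion also makes sense for \<open>c \<ge> 1\<close>,
  which occurs for pairs of generators whose product has infinite order.
\<close>

fun cheb :: "real \<Rightarrow> nat \<Rightarrow> real" where
  "cheb c 0 = 0"
| "cheb c (Suc 0) = 1"
| "cheb c (Suc (Suc n)) = 2 * c * cheb c (Suc n) - cheb c n"

lemma cheb_cos: "cheb (cos x) n * sin x = sin (real n * x)"
proof (induction n rule: less_induct)
  case (less n)
  show ?case
  proof (cases n rule: cheb.cases[of "(c, n)" for c n, simplified])
    case (3 m)
    have "cheb (cos x) n * sin x = 2 * cos x * (cheb (cos x) (Suc m) * sin x) - cheb (cos x) m * sin x"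
      by (simp add: 3 algebra_simps)
    also have "\<dots> = 2 * cos x * sin (real (Suc m) * x) - sin (real m * x)"
      using less 3 by simp
    also have "\<dots> = sin (real n * x)"
      using sin_add[of "real (Suc m) * x" x] sin_diff[of "real (Suc m) * x" x]
      by (simp add: 3 algebra_simps)
    finally show ?thesis .
  qed auto
qed

lemma cheb_mono: "1 \<le> c \<Longrightarrow> 0 \<le> cheb c n \<and> cheb c n \<le> cheb c (Suc n)"
proof (induction n)
  case (Suc n)
  then have "0 \<le> cheb c n" "cheb c n \<le> cheb c (Suc n)" by auto
  moreover have "1 * cheb c (Suc n) \<le> c * cheb c (Suc n)"
    using Suc calculation by (intro mult_right_mono) auto
  ultimately show ?case by auto
qed auto

text \<open>The alternating word in \<open>s\<close> and \<open>t\<close> of length \<open>k\<close> whose last letter is \<open>t\<close>.\<close>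

fun alt :: "'a \<Rightarrow> 'a \<Rightarrow> nat \<Rightarrow> 'a list" where
  "alt s t 0 = []"
| "alt s t (Suc k) = (if even k then t else s) # alt s t k"

lemma length_alt [simp]: "length (alt s t k) = k"
  by (induction k) auto

lemma set_alt: "set (alt s t k) \<subseteq> {s, t}"
  by (induction k) auto

lemma alt_snoc: "alt t s (Suc k) = alt s t k @ [s]"
  by (induction k) auto

lemma drop_alt: "j \<le> k \<Longrightarrow> drop j (alt s t k) = alt s t (k - j)"
proof (induction k arbitrary: j)
  case (Suc k)
  then show ?case by (cases j) auto
qed auto

lemma alternating_alt:
  assumes "set xs \<subseteq> {s, t}" "s \<noteq> t" "distinct_adj xs" "xs \<noteq> [] \<Longrightarrow> last xs = t"
  shows "xs = alt s t (length xs)"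
  using assms
proof (induction xs)
  case (Cons x xs)
  show ?case
  proof (cases xs)
    case Nil
    then show ?thesis using Cons by simp
  next
    case (Cons y ys)
    have "xs = alt s t (length xs)"
      by (rule Cons.IH) (use Cons.prems Cons in \<open>auto simp: distinct_adj_Cons\<close>)
    moreover have "x \<noteq> y" using Cons.prems Cons by (auto simp: distinct_adj_Cons)
    moreover have "y = (if even (length ys) then t else s)"
      using calculation(1) Cons by simp
    ultimately show ?thesis using Cons Cons.prems by (auto split: if_splits)
  qed
qed simp

lemma not_distinct_adj_split: "\<not> distinct_adj xs \<Longrightarrow> \<exists>as y bs. xs = as @ y # y # bs"
proof (induction xs)
  case (Cons x xs)
  show ?case
  proof (cases "distinct_adj xs")
    case True
    then obtain ys where "xs = x # ys" using Cons.prems by (cases xs) auto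
    then show ?thesis by (intro exI[of _ "[]"]) auto
  next
    case False
    then obtain as y bs where "xs = as @ y # y # bs" using Cons by blast
    then show ?thesis by (intro exI[of _ "x # as"]) auto
  qed
qed simp

context geometric_representation
begin

lemma act_group_action: "group_action W UNIV \<rho>"
  using act_faithful unfolding faithful_action_def by blast

lemma act_mult: "x \<in> carrier W \<Longrightarrow> y \<in> carrier W \<Longrightarrow> \<rho> (x \<otimes> y) v = \<rho> x (\<rho> y v)"
  using group_action.composition_rule[OF act_group_action] by blast

lemma act_one [simp]: "\<rho> \<one> v = v"
  using fun_cong[OF group_action.id_eq_one[OF act_group_action], of v] by simp

lemma act_inv [simp]:
  "x \<in> carrier W \<Longrightarrow> \<rho> (inv x) (\<rho> x v) = v"
  "x \<in> carrier W \<Longrightarrow> \<rho> x (\<rho> (inv x) v) = v"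
  using act_mult[of "inv x" x v] act_mult[of x "inv x" v] by auto

lemma act_eqI:
  assumes "x \<in> carrier W" "y \<in> carrier W" "\<And>v. \<rho> x v = \<rho> y v"
  shows "x = y"
proof -
  have "\<rho> x = \<rho> y" using assms(3) by (rule ext)
  then show ?thesis using inj_onD[OF faithful_action.faithful[OF act_faithful]] assms by blast
qed

lemma act_inj:
  assumes "x \<in> carrier W"
  shows "\<rho> x u = \<rho> x v \<longleftrightarrow> u = v"
proof
  assume "\<rho> x u = \<rho> x v"
  then have "\<rho> (inv x) (\<rho> x u) = \<rho> (inv x) (\<rho> x v)" by (simp only:)
  then show "u = v" using assms by simp
qed simp

lemma act_lin [simp]:
  assumes "x \<in> carrier W"
  shows "\<rho> x 0 = 0" "\<rho> x (u + v) = \<rho> x u + \<rho> x v" "\<rho> x (u - v) = \<rho> x u - \<rho> x v"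
    "\<rho> x (c *\<^sub>R u) = c *\<^sub>R \<rho> x u" "\<rho> x (- u) = - \<rho> x u"
  using act_linear[OF assms]
  by (simp_all add: linear_0 linear_add linear_diff linear_scale linear_neg)

lemma B_lin [simp]:
  "B 0 y = 0" "B (u + v) y = B u y + B v y" "B (u - v) y = B u y - B v y" "B (c *\<^sub>R u) y = c * B u y"
  "B (- u) y = - B u y"
  "B y 0 = 0" "B y (u + v) = B y u + B y v" "B y (u - v) = B y u - B y v" "B y (c *\<^sub>R u) = c * B y u"
  "B y (- u) = - B y u"
  using form_bilinear
  by (simp_all add: bilinear_lzero bilinear_ladd bilinear_lsub bilinear_lmul bilinear_lneg
        bilinear_rzero bilinear_radd bilinear_rsub bilinear_rmul bilinear_rneg)

lemma B_sum: "B y (\<Sum>i\<in>I. f i) = (\<Sum>i\<in>I. B y (f i))"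
  by (induction I rule: infinite_finite_induct) auto

lemma form_simple_nonpos:
  assumes "s \<in> S" "t \<in> S" "s \<noteq> t"
  shows "B (\<alpha> s) (\<alpha> t) \<le> 0"
proof -
  have "0 \<le> cos (pi / real k)" if "2 \<le> k" for k :: nat
  proof (rule cos_ge_zero)
    have "pi / real k \<le> pi / 2" using that by (intro divide_left_mono) auto
    moreover have "0 \<le> pi / real k" by simp
    ultimately show "- (pi / 2) \<le> pi / real k" "pi / real k \<le> pi / 2"
      using pi_gt_zero by linarith+
  qed
  then show ?thesis using form_simple[OF assms] by force
qed

subsection \<open>The dihedral case of positivity\<close>

lemma alt_act:
  assumes "s \<in> S" "t \<in> S" "c = - B (\<alpha> s) (\<alpha> t)"
  shows "\<rho> (word_value W (alt s t k)) (\<alpha> s) =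
    (if even k then cheb c (Suc k) *\<^sub>R \<alpha> s + cheb c k *\<^sub>R \<alpha> t
     else cheb c k *\<^sub>R \<alpha> s + cheb c (Suc k) *\<^sub>R \<alpha> t)"
proof (induction k)
  case (Suc k)
  have cl: "word_value W (alt s t k) \<in> carrier W"
    using set_alt[of s t k] assms by (intro word_closed) auto
  have ss: "B (\<alpha> s) (\<alpha> s) = 1" "B (\<alpha> t) (\<alpha> t) = 1" "B (\<alpha> t) (\<alpha> s) = - c" "B (\<alpha> s) (\<alpha> t) = - c"
    using form_simple_self assms form_sym[of "\<alpha> t" "\<alpha> s"] by simp_all
  show ?case
    using assms(1,2)
    by (cases "even k", simp_all add: act_mult[OF _ cl] Suc act_simple ss algebra_simps,
        simp_all add: scaleR_left_distrib[symmetric])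
qed simp

text \<open>
  The product of the two reflections is a rotation by \<open>2 \<pi> / m\<close> on the plane of the two simple roots.
  This plane is nondegenerate, so every vector is the sum of one in it and one orthogonal to it; hence
  the \<open>m\<close>-th power acts trivially, and the action is faithful.
\<close>

lemma form_braid:
  assumes st: "s \<in> S" "t \<in> S" and m: "2 \<le> m" "B (\<alpha> s) (\<alpha> t) = - cos (pi / real m)"
  shows "word_value W (alt s t (2 * m)) = \<one>"
proof -
  define c where "c = cos (pi / real m)"
  define x where "x = pi / real m"
  have x: "0 < x" "x < pi" using m pi_gt_zero by (auto simp: x_def field_simps)
  have sx: "sin x > 0" using x by (rule sin_gt_zero)
  have mx: "real m * x = pi" using m by (simp add: x_def)
  have ux: "cheb c n = sin (real n * x) / sin x" for n
    using cheb_cos[of x n] sx by (simp add: c_def x_def[symmetric] field_simps)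
  have e0: "real (2 * m) * x = 2 * pi" using mx by simp
  have u0: "cheb c (2 * m) = 0"
    unfolding ux e0 by simp
  have e1: "real (Suc (2 * m)) * x = x + 2 * pi" using mx by (simp add: algebra_simps)
  have e2: "real (2 * m - 1) * x = 2 * pi - x" using mx m by (simp add: algebra_simps of_nat_diff)
  have u1: "cheb c (Suc (2 * m)) = 1"
    unfolding ux e1 using sx by simp
  have u2: "cheb c (2 * m - 1) = - 1"
    unfolding ux e2 using sx by simp
  have cst: "c = - B (\<alpha> s) (\<alpha> t)" "c = - B (\<alpha> t) (\<alpha> s)" using m form_sym[of "\<alpha> t" "\<alpha> s"] by (simp_all add: c_def)
  have ss: "B (\<alpha> s) (\<alpha> s) = 1" "B (\<alpha> t) (\<alpha> t) = 1" "B (\<alpha> t) (\<alpha> s) = - c" "B (\<alpha> s) (\<alpha> t) = - c"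
    using cst form_simple_self st by simp_all
  define z where "z = word_value W (alt s t (2 * m))"
  have z: "z \<in> carrier W" using set_alt[of s t] st by (auto simp: z_def intro!: word_closed)
  have za: "\<rho> z (\<alpha> s) = \<alpha> s"
    using alt_act[OF st cst(1), of "2 * m"] u0 u1 by (simp add: z_def)
  have zb: "\<rho> z (\<alpha> t) = \<alpha> t"
  proof -
    have cl: "word_value W (alt t s (2 * m - 1)) \<in> carrier W"
      using set_alt[of t s] st by (auto intro!: word_closed)
    have "alt s t (2 * m) = alt t s (2 * m - 1) @ [t]"
      using alt_snoc[of s t "2 * m - 1"] m by simp
    then have "z = word_value W (alt t s (2 * m - 1)) \<otimes> t"
    proof -
      have "set (alt t s (2 * m - 1)) \<subseteq> S" using set_alt[of t s "2 * m - 1"] st by blast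
      then show ?thesis using word_append[of "alt t s (2 * m - 1)" "[t]"] st
        by (simp add: z_def \<open>alt s t (2 * m) = alt t s (2 * m - 1) @ [t]\<close> del: alt.simps)
    qed
    then have "\<rho> z (\<alpha> t) = - \<rho> (word_value W (alt t s (2 * m - 1))) (\<alpha> t)"
      using cl st by (simp add: act_mult act_simple ss algebra_simps scaleR_2)
    moreover have "odd (2 * m - 1)" "Suc (2 * m - 1) = 2 * m" using m by auto
    ultimately show ?thesis using alt_act[OF st(2,1) cst(2), of "2 * m - 1"] u0 u2 by simp
  qed
  have "\<rho> z v = v" for v
  proof -
    have d: "1 - c\<^sup>2 \<noteq> 0"
    proof -
      have "1 - c\<^sup>2 = (sin x)\<^sup>2" unfolding c_def x_def[symmetric] by (simp add: sin_squared_eq)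
      then show ?thesis using sx by simp
    qed
    define a where "a = (B (\<alpha> s) v + c * B (\<alpha> t) v) / (1 - c\<^sup>2)"
    define b where "b = (B (\<alpha> t) v + c * B (\<alpha> s) v) / (1 - c\<^sup>2)"
    have ab: "(1 - c\<^sup>2) * a = B (\<alpha> s) v + c * B (\<alpha> t) v" "(1 - c\<^sup>2) * b = B (\<alpha> t) v + c * B (\<alpha> s) v"
      using d by (auto simp: a_def b_def)
    define v' where "v' = v - a *\<^sub>R \<alpha> s - b *\<^sub>R \<alpha> t"
    have "(1 - c\<^sup>2) * (a - c * b) = (1 - c\<^sup>2) * a - c * ((1 - c\<^sup>2) * b)"
      by (simp add: algebra_simps)
    also have "\<dots> = (1 - c\<^sup>2) * B (\<alpha> s) v"
      unfolding ab by (simp add: algebra_simps power2_eq_square)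
    finally have "(1 - c\<^sup>2) * (a - c * b) = (1 - c\<^sup>2) * B (\<alpha> s) v" .
    then have "a - c * b = B (\<alpha> s) v" using d by simp
    then have o1: "B (\<alpha> s) v' = 0" by (simp add: v'_def ss algebra_simps)
    have "(1 - c\<^sup>2) * (b - c * a) = (1 - c\<^sup>2) * b - c * ((1 - c\<^sup>2) * a)"
      by (simp add: algebra_simps)
    also have "\<dots> = (1 - c\<^sup>2) * B (\<alpha> t) v"
      unfolding ab by (simp add: algebra_simps power2_eq_square)
    finally have "(1 - c\<^sup>2) * (b - c * a) = (1 - c\<^sup>2) * B (\<alpha> t) v" .
    then have "b - c * a = B (\<alpha> t) v" using d by simp
    then have o2: "B (\<alpha> t) v' = 0" by (simp add: v'_def ss algebra_simps)
    have "\<rho> (word_value W xs) v' = v'" if "set xs \<subseteq> {s, t}" for xs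
      using that
    proof (induction xs)
      case (Cons y xs)
      then have "word_value W xs \<in> carrier W" using st by (intro word_closed) auto
      then show ?case using Cons st o1 o2 by (auto simp: act_mult act_simple)
    qed simp
    from this[OF set_alt] have "\<rho> z v' = v'" unfolding z_def .
    moreover have "v = v' + a *\<^sub>R \<alpha> s + b *\<^sub>R \<alpha> t" by (simp add: v'_def)
    ultimately show ?thesis using z za zb by simp
  qed
  then show ?thesis using act_eqI[OF z] by (simp add: z_def)
qed

text \<open>
  A reduced word for \<open>v\<close> alternates, and it ends in \<open>t\<close> since \<open>s\<close> is no descent.  If the form takes the
  value \<open>- cos (\<pi> / m)\<close>, the word is shorter than \<open>m\<close>, as one more letter could otherwise be shortened by the
  braid relation; so only values \<open>sin (n \<pi> / m)\<close> with \<open>n \<le> m\<close> occur as coefficients.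
\<close>

lemma dihedral_positive:
  assumes st: "s \<in> S" "t \<in> S" "s \<noteq> t" and v: "v \<in> jwords {s, t}"
    and le: "jlen {s, t} v \<le> jlen {s, t} (v \<otimes> s)"
  obtains a b where "0 \<le> a" "0 \<le> b" "\<rho> v (\<alpha> s) = a *\<^sub>R \<alpha> s + b *\<^sub>R \<alpha> t"
proof -
  let ?J = "{s, t}"
  have J: "?J \<subseteq> S" using st by simp
  obtain xs where xs: "set xs \<subseteq> ?J" "length xs = jlen ?J v" "word_value W xs = v"
    using v jlen_word by blast
  have vc: "v \<in> carrier W" using v J jwords_sub by blast
  have "distinct_adj xs"
  proof (rule ccontr)
    assume "\<not> distinct_adj xs"
    then obtain as y bs where eq: "xs = as @ y # y # bs"
      using not_distinct_adj_split by blast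
    have S: "set as \<subseteq> S" "y \<in> S" "set bs \<subseteq> S" using eq xs J by auto
    then have "word_value W xs = word_value W (as @ bs)"
      by (simp add: eq word_append)
    moreover have "jlen ?J (word_value W (as @ bs)) \<le> length (as @ bs)"
      by (rule jlen_le) (use eq xs in auto)
    ultimately show False using eq xs by simp
  qed
  moreover have "last xs = t" if "xs \<noteq> []"
  proof (rule ccontr)
    assume "last xs \<noteq> t"
    then have l: "xs = butlast xs @ [s]"
    proof -
      have "last xs = s" using xs(1) last_in_set[OF that] \<open>last xs \<noteq> t\<close> by blast
      then show ?thesis using append_butlast_last_id[OF that] by simp
    qed
    have bJ: "set (butlast xs) \<subseteq> ?J" using xs(1) by (auto dest: in_set_butlastD)
    then have b: "set (butlast xs) \<subseteq> S" using J by blast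
    then have "v = word_value W (butlast xs) \<otimes> s"
      using xs(3) word_append[OF b, of "[s]"] st l by simp
    then have "v \<otimes> s = word_value W (butlast xs)" using b st by simp
    moreover have "jlen ?J (word_value W (butlast xs)) \<le> length (butlast xs)"
      by (rule jlen_le[OF bJ])
    ultimately show False using le xs(2) that by (simp add: length_greater_0_conv[symmetric] del: length_greater_0_conv)
  qed
  ultimately have alt: "xs = alt s t (length xs)"
    using alternating_alt[of xs s t] xs st by blast
  define k where "k = length xs"
  define c where "c = - B (\<alpha> s) (\<alpha> t)"
  have act: "\<rho> v (\<alpha> s) =
    (if even k then cheb c (Suc k) *\<^sub>R \<alpha> s + cheb c k *\<^sub>R \<alpha> t
     else cheb c k *\<^sub>R \<alpha> s + cheb c (Suc k) *\<^sub>R \<alpha> t)"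
    using alt_act[OF st(1,2) c_def, of k] alt xs(3) by (simp add: k_def)
  have "0 \<le> cheb c k \<and> 0 \<le> cheb c (Suc k)"
  proof (cases "B (\<alpha> s) (\<alpha> t) \<le> - 1")
    case True
    then show ?thesis using cheb_mono[of c k] by (auto simp: c_def)
  next
    case False
    then obtain m :: nat where m: "2 \<le> m" "B (\<alpha> s) (\<alpha> t) = - cos (pi / real m)"
      using form_simple[OF st] by blast
    have m': "B (\<alpha> t) (\<alpha> s) = - cos (pi / real m)"
      using m form_sym[of "\<alpha> t" "\<alpha> s"] by simp
    have km: "k < m"
    proof (rule ccontr)
      assume "\<not> k < m"
      define ys where "ys = take (m - 1) (alt t s (2 * m))"
      have ys: "set ys \<subseteq> ?J" "length ys = m - 1"
        using set_alt[of t s "2 * m"] set_take_subset[of "m - 1" "alt t s (2 * m)"] m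
        by (auto simp: ys_def simp del: alt.simps)
      have "alt t s (2 * m) = ys @ alt t s (m + 1)"
        using drop_alt[of "m - 1" "2 * m" t s] m append_take_drop_id[of "m - 1" "alt t s (2 * m)"]
        by (simp add: ys_def)
      moreover have "set (alt t s (m + 1)) \<subseteq> S" "set ys \<subseteq> S"
        using set_alt[of t s "m + 1"] ys J by blast+
      ultimately have "word_value W ys \<otimes> word_value W (alt t s (m + 1)) = \<one>"
        using form_braid[OF st(2,1) m(1) m'] word_append[of ys "alt t s (m + 1)"] by simp
      then have i: "word_value W (alt t s (m + 1)) = word_value W (rev ys)"
        using \<open>set ys \<subseteq> S\<close> \<open>set (alt t s (m + 1)) \<subseteq> S\<close>
          inv_equality[of "word_value W ys" "word_value W (alt t s (m + 1))"]
        by (simp add: word_rev del: alt.simps) (metis inv_inv word_closed)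
      define zs where "zs = take (k - m) (alt t s (k + 1))"
      have zs: "set zs \<subseteq> ?J" "length zs = k - m"
        using set_alt[of t s "k + 1"] set_take_subset[of "k - m" "alt t s (k + 1)"]
        by (auto simp: zs_def simp del: alt.simps)
      have "alt t s (k + 1) = zs @ alt t s (m + 1)"
        using drop_alt[of "k - m" "k + 1" t s] \<open>\<not> k < m\<close> append_take_drop_id[of "k - m" "alt t s (k + 1)"]
        by (simp add: zs_def)
      moreover have "set zs \<subseteq> S" using zs J by blast
      ultimately have "word_value W (alt t s (k + 1)) = word_value W (zs @ rev ys)"
        using i \<open>set ys \<subseteq> S\<close> \<open>set (alt t s (m + 1)) \<subseteq> S\<close> by (simp add: word_append del: alt.simps)
      moreover have "word_value W (alt t s (k + 1)) = v \<otimes> s"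
      proof -
        have "alt t s (k + 1) = xs @ [s]" using alt alt_snoc[of t s k] by (simp add: k_def)
        moreover have "set xs \<subseteq> S" using xs J by blast
        ultimately show ?thesis using word_append[of xs "[s]"] xs(3) st by (simp del: alt.simps)
      qed
      moreover have "jlen ?J (word_value W (zs @ rev ys)) \<le> length (zs @ rev ys)"
        by (rule jlen_le) (use zs ys in auto)
      ultimately have "jlen ?J (v \<otimes> s) \<le> k - m + (m - 1)" using zs ys by simp
      then show False using le xs k_def \<open>\<not> k < m\<close> m by simp
    qed
    define x where "x = pi / real m"
    have x: "0 < x" "x < pi" using m pi_gt_zero by (auto simp: x_def field_simps)
    have sx: "sin x > 0" using x by (rule sin_gt_zero)
    have "0 \<le> cheb c n" if "n \<le> m" for n
    proof -
      have "real n * x \<le> real m * x" using that x by (intro mult_right_mono) auto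
      also have "\<dots> = pi" using m by (simp add: x_def)
      finally have "0 \<le> sin (real n * x)" using x by (intro sin_ge_zero) auto
      moreover have "cheb c n = sin (real n * x) / sin x"
        using cheb_cos[of x n] sx m by (simp add: c_def x_def[symmetric] field_simps)
      ultimately show ?thesis using sx by simp
    qed
    then show ?thesis using km by simp
  qed
  then show ?thesis using act that by (cases "even k") auto
qed

lemma dihedral_sign:
  assumes st: "s \<in> S" "t \<in> S" "s \<noteq> t" and v: "v \<in> jwords {s, t}"
  obtains a b where "\<rho> v (\<alpha> s) = a *\<^sub>R \<alpha> s + b *\<^sub>R \<alpha> t" "0 \<le> a \<and> 0 \<le> b \<or> a \<le> 0 \<and> b \<le> 0"
proof (cases "jlen {s, t} v \<le> jlen {s, t} (v \<otimes> s)")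
  case True
  then show ?thesis using dihedral_positive[OF st v] that by metis
next
  case False
  have J: "{s, t} \<subseteq> S" using st by simp
  have vc: "v \<in> carrier W" using v J jwords_sub by blast
  have "v \<otimes> s \<in> jwords {s, t}" using jwords_mult[OF J v] jwords_gen[OF J] by simp
  moreover have "jlen {s, t} (v \<otimes> s) \<le> jlen {s, t} (v \<otimes> s \<otimes> s)" using False vc st by simp
  ultimately obtain a b where ab: "0 \<le> a" "0 \<le> b" "\<rho> (v \<otimes> s) (\<alpha> s) = a *\<^sub>R \<alpha> s + b *\<^sub>R \<alpha> t"
    using dihedral_positive[OF st] by metis
  have "\<rho> (v \<otimes> s) (\<alpha> s) = - \<rho> v (\<alpha> s)"
    using vc st form_simple_self by (simp add: act_mult act_simple algebra_simps scaleR_2)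
  then have "\<rho> v (\<alpha> s) = - (a *\<^sub>R \<alpha> s + b *\<^sub>R \<alpha> t)" using ab by simp
  then have "\<rho> v (\<alpha> s) = (- a) *\<^sub>R \<alpha> s + (- b) *\<^sub>R \<alpha> t" by simp
  then show ?thesis using that[of "- a" "- b"] ab by auto
qed

text \<open>
  By induction on the length.  If \<open>t\<close> is a right descent of \<open>w\<close>, split off from \<open>w\<close> on the right as long an
  element of the dihedral subgroup of \<open>s\<close> and \<open>t\<close> as possible without losing length.  The rest \<open>v\<close> is
  shorter and has neither \<open>s\<close> nor \<open>t\<close> as a descent, so it sends both simple roots to positive
  combinations, and the dihedral case deals with the other factor.
\<close>

theorem simple_positive:
  assumes "w \<in> carrier W" "s \<in> S" "len w < len (w \<otimes> s)"
  shows "\<rho> w (\<alpha> s) \<in> cone (\<alpha> ` S)"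
  using assms
proof (induction "len w" arbitrary: w s rule: less_induct)
  case less
  show ?case
  proof (cases "w = \<one>")
    case True
    then show ?thesis using less by (auto intro: cone_base)
  next
    case False
    then obtain u t where t: "u \<in> carrier W" "t \<in> S" "w = u \<otimes> t" "len w = Suc (len u)"
      using len_last less by blast
    have st: "s \<noteq> t" using less t by auto
    let ?J = "{s, t}"
    have J: "?J \<subseteq> S" using less t by simp
    define A where "A = {v \<in> carrier W. \<exists>x\<in>jwords ?J. w = v \<otimes> x \<and> len v + jlen ?J x \<le> len w}"
    have "u \<in> A" unfolding A_def
      using t jwords_gen[OF J, of t] jlen_gen[OF J, of t] by (auto intro!: bexI[of _ t])
    then obtain v where v: "v \<in> A" "\<And>v'. v' \<in> A \<Longrightarrow> len v \<le> len v'"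
      using ex_has_least_nat[of "\<lambda>v. v \<in> A" u len] by blast
    then obtain x where x: "v \<in> carrier W" "x \<in> jwords ?J" "w = v \<otimes> x" "len v + jlen ?J x \<le> len w"
      by (auto simp: A_def)
    have xc: "x \<in> carrier W" using x J jwords_sub by blast
    have up: "len v < len (v \<otimes> r)" if r: "r \<in> ?J" for r
    proof (rule ccontr)
      assume "\<not> len v < len (v \<otimes> r)"
      then have l: "len v = Suc (len (v \<otimes> r))" using len_gen_cases[of v r] x r J by auto
      have rS: "r \<in> S" using r J by blast
      have rx: "r \<otimes> x \<in> jwords ?J" using jwords_mult[OF J jwords_gen[OF J r] x(2)] .
      have "w = (v \<otimes> r) \<otimes> (r \<otimes> x)" using x xc rS by (simp add: m_assoc)
      moreover have "jlen ?J (r \<otimes> x) \<le> 1 + jlen ?J x"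
        using jlen_mult[OF J jwords_gen[OF J r] x(2)] jlen_gen[OF J r] by simp
      ultimately have "v \<otimes> r \<in> A" using x rS rx l unfolding A_def by auto
      then show False using v(2) l by fastforce
    qed
    have lv: "len v < len w" using v(2)[OF \<open>u \<in> A\<close>] t by simp
    have vs: "\<rho> v (\<alpha> s) \<in> cone (\<alpha> ` S)" "\<rho> v (\<alpha> t) \<in> cone (\<alpha> ` S)"
      using less.hyps[OF lv x(1)] up less t by auto
    have "jlen ?J x \<le> jlen ?J (x \<otimes> s)"
    proof (rule ccontr)
      assume c: "\<not> ?thesis"
      have xs: "x \<otimes> s \<in> jwords ?J" using jwords_mult[OF J x(2)] jwords_gen[OF J] by simp
      have "len (w \<otimes> s) \<le> len v + len (x \<otimes> s)"
        using len_mult[of v "x \<otimes> s"] x xc less by (simp add: m_assoc)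
      also have "\<dots> \<le> len v + jlen ?J (x \<otimes> s)" using len_le_jlen[OF J xs] by simp
      finally show False using c x less by linarith
    qed
    then obtain a b where "0 \<le> a" "0 \<le> b" "\<rho> x (\<alpha> s) = a *\<^sub>R \<alpha> s + b *\<^sub>R \<alpha> t"
      using dihedral_positive[of s t x] less t st x by metis
    then show ?thesis using x xc vs by (auto simp: act_mult intro!: cone_add cone_scale)
  qed
qed


section \<open>Roots and inversion sets\<close>

lemma simple_in_roots: "s \<in> S \<Longrightarrow> \<alpha> s \<in> roots"
  unfolding roots_def by (rule CollectI, rule exI[of _ "\<one>"]) auto

lemma simple_pos: "s \<in> S \<Longrightarrow> \<alpha> s \<in> pos_roots"
  by (simp add: pos_roots_def simple_in_roots cone_base)

lemma act_roots: "w \<in> carrier W \<Longrightarrow> y \<in> roots \<Longrightarrow> \<rho> w y \<in> roots"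
proof -
  assume w: "w \<in> carrier W" and "y \<in> roots"
  then obtain u s where u: "u \<in> carrier W" "s \<in> S" "y = \<rho> u (\<alpha> s)" by (auto simp: roots_def)
  then have "\<rho> w y = \<rho> (w \<otimes> u) (\<alpha> s)" using w by (simp add: act_mult)
  then show ?thesis unfolding roots_def using w u by blast
qed

lemma root_unit: "y \<in> roots \<Longrightarrow> B y y = 1"
  unfolding roots_def using act_form form_simple_self by auto

lemma root_nonzero: "y \<in> roots \<Longrightarrow> y \<noteq> 0"
  using root_unit[of y] by auto

lemma pos_root: "y \<in> pos_roots \<Longrightarrow> y \<in> roots"
  by (simp add: pos_roots_def)

lemma pos_cone: "y \<in> pos_roots \<Longrightarrow> y \<in> cone (\<alpha> ` S)"
  by (simp add: pos_roots_def)

lemma act_gen_simple: "s \<in> S \<Longrightarrow> \<rho> s (\<alpha> s) = - \<alpha> s"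
  by (simp add: act_simple form_simple_self scaleR_2)

lemma simple_act_pos:
  assumes "w \<in> carrier W" "s \<in> S" "len w < len (w \<otimes> s)"
  shows "\<rho> w (\<alpha> s) \<in> pos_roots"
  using simple_positive[OF assms] act_roots simple_in_roots assms by (simp add: pos_roots_def)

lemma simple_act_neg:
  assumes "w \<in> carrier W" "s \<in> S" "len (w \<otimes> s) < len w"
  shows "- \<rho> w (\<alpha> s) \<in> pos_roots"
proof -
  have "\<rho> (w \<otimes> s) (\<alpha> s) \<in> pos_roots" using assms by (intro simple_act_pos) auto
  then show ?thesis using assms by (simp add: act_mult act_gen_simple)
qed

lemma simple_act_cases:
  assumes "w \<in> carrier W" "s \<in> S"
  shows "\<rho> w (\<alpha> s) \<in> pos_roots \<and> len (w \<otimes> s) = Suc (len w) \<or>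
    - \<rho> w (\<alpha> s) \<in> pos_roots \<and> len w = Suc (len (w \<otimes> s))"
  using len_gen_cases[OF assms] simple_act_pos[OF assms] simple_act_neg[OF assms] by auto

lemma root_cases: "y \<in> roots \<Longrightarrow> y \<in> pos_roots \<or> - y \<in> pos_roots"
proof -
  assume "y \<in> roots"
  then obtain u s where u: "u \<in> carrier W" "s \<in> S" "y = \<rho> u (\<alpha> s)" by (auto simp: roots_def)
  then show ?thesis using simple_act_cases[OF u(1,2)] by auto
qed

lemma root_neg: "y \<in> roots \<Longrightarrow> - y \<in> roots"
proof -
  assume "y \<in> roots"
  then obtain w s where "w \<in> carrier W" "s \<in> S" "y = \<rho> w (\<alpha> s)" by (auto simp: roots_def)
  moreover from this have "- y = \<rho> (w \<otimes> s) (\<alpha> s)" by (simp add: act_mult act_gen_simple)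
  ultimately show ?thesis using act_roots[of "w \<otimes> s"] simple_in_roots by simp
qed

lemma simple_cone_iff:
  "x \<in> cone (\<alpha> ` S) \<longleftrightarrow> (\<exists>c. (\<forall>s\<in>S. 0 \<le> c s) \<and> x = (\<Sum>s\<in>S. c s *\<^sub>R \<alpha> s))"
proof
  assume "x \<in> cone (\<alpha> ` S)"
  then obtain c where "\<forall>a\<in>\<alpha> ` S. 0 \<le> c a" "x = (\<Sum>a\<in>\<alpha> ` S. c a *\<^sub>R a)"
    using cone_finite_iff[of "\<alpha> ` S"] finite_gens by blast
  then show "\<exists>c. (\<forall>s\<in>S. 0 \<le> c s) \<and> x = (\<Sum>s\<in>S. c s *\<^sub>R \<alpha> s)"
    by (intro exI[of _ "c \<circ> \<alpha>"]) (auto simp: sum.reindex[OF simple_inj])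
qed (auto intro!: cone_sum cone_scale intro: cone_base)

lemma cone_pointed:
  assumes "x \<in> cone (\<alpha> ` S)" "- x \<in> cone (\<alpha> ` S)"
  shows "x = 0"
proof -
  obtain c where c: "\<forall>s\<in>S. 0 \<le> c s" "x = (\<Sum>s\<in>S. c s *\<^sub>R \<alpha> s)"
    using assms simple_cone_iff by blast
  obtain d where d: "\<forall>s\<in>S. 0 \<le> d s" "- x = (\<Sum>s\<in>S. d s *\<^sub>R \<alpha> s)"
    using assms simple_cone_iff by blast
  have "(\<Sum>s\<in>S. (c s + d s) *\<^sub>R \<alpha> s) = x + - x"
    by (simp only: scaleR_left_distrib sum.distrib c(2)[symmetric] d(2)[symmetric])
  then have z: "(\<Sum>s\<in>S. (c s + d s) *\<^sub>R \<alpha> s) = 0" by simp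
  have "c s = 0" if s: "s \<in> S" for s
  proof -
    have "c s + d s = 0"
      by (rule simple_positively_independent[of "\<lambda>s. c s + d s", OF _ z s]) (simp add: c(1) d(1))
    then show ?thesis using bspec[OF c(1) s] bspec[OF d(1) s] by linarith
  qed
  then show ?thesis unfolding c(2) by simp
qed

text \<open>
  The simple roots may be linearly dependent, but each one still spans an extreme ray of their cone: it
  has nonpositive product with the others and norm one, so it is not a combination of them.
\<close>

lemma simple_extremal:
  assumes s: "s \<in> S" and xy: "x \<in> cone (\<alpha> ` S)" "y \<in> cone (\<alpha> ` S)" "x + y = k *\<^sub>R \<alpha> s"
  shows "\<exists>a\<ge>0. x = a *\<^sub>R \<alpha> s"
proof -
  obtain c where c: "\<forall>s\<in>S. 0 \<le> c s" "x = (\<Sum>s\<in>S. c s *\<^sub>R \<alpha> s)"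
    using assms simple_cone_iff by blast
  obtain d where d: "\<forall>s\<in>S. 0 \<le> d s" "y = (\<Sum>s\<in>S. d s *\<^sub>R \<alpha> s)"
    using assms simple_cone_iff by blast
  define e where "e r = c r + d r" for r
  have e0: "\<forall>r\<in>S. 0 \<le> e r" using c d by (auto simp: e_def)
  have "(\<Sum>r\<in>S. e r *\<^sub>R \<alpha> r) = k *\<^sub>R \<alpha> s"
    using xy(3) by (simp add: e_def scaleR_left_distrib sum.distrib c d)
  then have R: "(\<Sum>r\<in>S - {s}. e r *\<^sub>R \<alpha> r) = (k - e s) *\<^sub>R \<alpha> s"
    using finite_gens s by (simp add: sum.remove[of S s] algebra_simps)
  have "B (\<alpha> s) (\<Sum>r\<in>S - {s}. e r *\<^sub>R \<alpha> r) \<le> 0"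
    unfolding B_sum using e0 s form_simple_nonpos
    by (intro sum_nonpos) (auto simp: mult_nonneg_nonpos)
  then have k: "k - e s \<le> 0" using s by (simp add: R form_simple_self)
  define f where "f r = (if r = s then e s - k else e r)" for r
  have "(\<Sum>r\<in>S. f r *\<^sub>R \<alpha> r) = f s *\<^sub>R \<alpha> s + (\<Sum>r\<in>S - {s}. f r *\<^sub>R \<alpha> r)"
    using finite_gens s by (simp add: sum.remove[of S s])
  also have "(\<Sum>r\<in>S - {s}. f r *\<^sub>R \<alpha> r) = (\<Sum>r\<in>S - {s}. e r *\<^sub>R \<alpha> r)"
    by (rule sum.cong) (auto simp: f_def)
  finally have "(\<Sum>r\<in>S. f r *\<^sub>R \<alpha> r) = 0"
    unfolding R by (simp add: f_def algebra_simps)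
  then have z: "(\<Sum>r\<in>S. f r *\<^sub>R \<alpha> r) = 0" .
  have f0: "0 \<le> f r" if "r \<in> S" for r using e0 k that by (simp add: f_def)
  have "c r = 0" if r: "r \<in> S - {s}" for r
  proof -
    have rS: "r \<in> S" and rs: "r \<noteq> s" using r by auto
    have "f r = 0" by (rule simple_positively_independent[OF f0 z rS])
    then have "c r + d r = 0" using rs by (simp add: f_def e_def)
    then show ?thesis using bspec[OF c(1) rS] bspec[OF d(1) rS] by linarith
  qed
  then have "x = c s *\<^sub>R \<alpha> s"
    unfolding c(2) using finite_gens s by (simp add: sum.remove[of S s])
  then show ?thesis using c s by blast
qed

lemma pos_not_neg: "y \<in> pos_roots \<Longrightarrow> - y \<notin> pos_roots"
  using cone_pointed[of y] pos_cone[of y] pos_cone[of "- y"] root_nonzero[of y] pos_root[of y] by auto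

lemma neg_iff: "y \<in> neg_roots \<longleftrightarrow> - y \<in> pos_roots"
  unfolding neg_roots_def by force

lemma pos_iff: "y \<in> roots \<Longrightarrow> y \<in> pos_roots \<longleftrightarrow> - y \<notin> pos_roots"
  using root_cases[of y] pos_not_neg[of y] by auto

lemma act_pos_cases:
  "w \<in> carrier W \<Longrightarrow> y \<in> roots \<Longrightarrow> \<rho> w y \<in> pos_roots \<or> - \<rho> w y \<in> pos_roots"
  using act_roots root_cases by simp

lemma pos_from_cone: "y \<in> roots \<Longrightarrow> y \<in> cone pos_roots \<Longrightarrow> y \<in> pos_roots"
  using cone_trans[of y pos_roots "\<alpha> ` S"] by (simp add: pos_roots_def)

lemma root_scale:
  assumes "x \<in> pos_roots" "y \<in> pos_roots" "x = c *\<^sub>R y"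
  shows "x = y"
proof -
  have "c * c = 1" using root_unit[of x] root_unit[of y] assms pos_root by simp
  then have "c = 1 \<or> c = - 1" by (simp add: square_eq_1_iff)
  then show ?thesis using assms pos_not_neg[of y] by auto
qed

lemma gen_permutes_pos:
  assumes "s \<in> S" "y \<in> pos_roots" "y \<noteq> \<alpha> s"
  shows "\<rho> s y \<in> pos_roots"
proof (rule ccontr)
  assume "\<rho> s y \<notin> pos_roots"
  then have n: "- \<rho> s y \<in> pos_roots" using act_pos_cases[of s y] assms pos_root by simp
  have "y + - \<rho> s y = (2 * B (\<alpha> s) y) *\<^sub>R \<alpha> s" using assms by (simp add: act_simple)
  then obtain a where "y = a *\<^sub>R \<alpha> s"
    using simple_extremal[OF assms(1) pos_cone[OF assms(2)] pos_cone[OF n]] by blast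
  then show False using root_scale[OF assms(2) simple_pos[OF assms(1)]] assms by blast
qed

lemma gen_gen_act [simp]: "s \<in> S \<Longrightarrow> \<rho> s (\<rho> s y) = y"
  using act_inv(2)[of s y] by simp

subsection \<open>Inversion sets\<close>

lemma inv_iff:
  assumes "w \<in> carrier W"
  shows "y \<in> inversion_set w \<longleftrightarrow> y \<in> pos_roots \<and> - \<rho> (inv w) y \<in> pos_roots"
proof -
  have "y \<in> \<rho> w ` neg_roots \<longleftrightarrow> \<rho> (inv w) y \<in> neg_roots"
  proof
    assume "\<rho> (inv w) y \<in> neg_roots"
    then have "\<rho> w (\<rho> (inv w) y) \<in> \<rho> w ` neg_roots" by (rule imageI)
    then show "y \<in> \<rho> w ` neg_roots" using assms by simp
  qed (use assms in auto)
  then show ?thesis by (auto simp: inversion_set_def neg_iff)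
qed

lemma inv_sub_pos: "inversion_set w \<subseteq> pos_roots"
  by (auto simp: inversion_set_def)

lemma not_inv_iff:
  assumes "w \<in> carrier W" "y \<in> pos_roots"
  shows "y \<notin> inversion_set w \<longleftrightarrow> \<rho> (inv w) y \<in> pos_roots"
  using inv_iff[OF assms(1)] assms pos_iff[of "\<rho> (inv w) y"] act_roots[of "inv w" y] pos_root by auto

lemma inversion_one: "inversion_set \<one> = {}"
  using inv_iff[OF one_closed] pos_not_neg by auto

lemma inversion_left:
  assumes "w \<in> carrier W" "s \<in> S" "y \<in> pos_roots" "y \<noteq> \<alpha> s"
  shows "y \<in> inversion_set (s \<otimes> w) \<longleftrightarrow> \<rho> s y \<in> inversion_set w"
proof -
  have "inv (s \<otimes> w) = inv w \<otimes> s" using assms by (simp add: inv_mult_group)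
  then show ?thesis using assms gen_permutes_pos[OF assms(2-4)]
    by (simp add: inv_iff act_mult)
qed

lemma inversion_left_simple:
  assumes "w \<in> carrier W" "s \<in> S"
  shows "\<alpha> s \<in> inversion_set (s \<otimes> w) \<longleftrightarrow> \<alpha> s \<notin> inversion_set w"
proof -
  have "inv (s \<otimes> w) = inv w \<otimes> s" using assms by (simp add: inv_mult_group)
  then show ?thesis using assms not_inv_iff[of w "\<alpha> s"] simple_pos
    by (simp add: inv_iff act_mult act_gen_simple)
qed

lemma inversion_right:
  assumes w: "w \<in> carrier W" and r: "r \<in> S" and p: "\<rho> w (\<alpha> r) \<in> pos_roots"
  shows "inversion_set (w \<otimes> r) = insert (\<rho> w (\<alpha> r)) (inversion_set w)"
    and "\<rho> w (\<alpha> r) \<notin> inversion_set w"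
proof -
  show "\<rho> w (\<alpha> r) \<notin> inversion_set w" using w r simple_pos not_inv_iff[OF w p] by simp
  have i: "inv (w \<otimes> r) = r \<otimes> inv w" using w r by (simp add: inv_mult_group)
  have "y \<in> inversion_set (w \<otimes> r) \<longleftrightarrow> y = \<rho> w (\<alpha> r) \<or> y \<in> inversion_set w"
    if y: "y \<in> pos_roots" for y
  proof -
    define z where "z = \<rho> (inv w) y"
    have yz: "y = \<rho> w z" using w by (simp add: z_def)
    have z: "z \<in> roots" using act_roots w y pos_root by (simp add: z_def)
    have N: "y \<in> inversion_set (w \<otimes> r) \<longleftrightarrow> - \<rho> r z \<in> pos_roots"
      using w r y by (simp add: inv_iff i act_mult z_def)
    have N': "y \<in> inversion_set w \<longleftrightarrow> - z \<in> pos_roots" using w y by (simp add: inv_iff z_def)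
    have zz: "z = \<alpha> r \<longleftrightarrow> y = \<rho> w (\<alpha> r)" using yz act_inj w by simp
    have "z \<noteq> - \<alpha> r" using pos_not_neg[OF p] y yz w by auto
    consider "z = \<alpha> r" | "z \<noteq> \<alpha> r" "z \<in> pos_roots" | "z \<noteq> \<alpha> r" "- z \<in> pos_roots"
      using root_cases[OF z] by blast
    then show ?thesis
    proof cases
      case 1
      then show ?thesis using N zz r by (simp add: act_gen_simple simple_pos)
    next
      case 2
      then have "\<rho> r z \<in> pos_roots" using gen_permutes_pos r by blast
      then show ?thesis using 2 N N' zz pos_not_neg by blast
    next
      case 3
      have "- z \<noteq> \<alpha> r" using \<open>z \<noteq> - \<alpha> r\<close> by (metis minus_minus)
      then have "\<rho> r (- z) \<in> pos_roots" using gen_permutes_pos r 3 by blast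
      then show ?thesis using 3 N N' zz r by simp
    qed
  qed
  then show "inversion_set (w \<otimes> r) = insert (\<rho> w (\<alpha> r)) (inversion_set w)"
    using inv_sub_pos p by blast
qed

lemma inversion_right_descent:
  assumes w: "w \<in> carrier W" and r: "r \<in> S" and p: "- \<rho> w (\<alpha> r) \<in> pos_roots"
  shows "inversion_set (w \<otimes> r) = inversion_set w - {- \<rho> w (\<alpha> r)}"
    and "- \<rho> w (\<alpha> r) \<in> inversion_set w"
proof -
  have e: "\<rho> (w \<otimes> r) (\<alpha> r) = - \<rho> w (\<alpha> r)" using w r by (simp add: act_mult act_gen_simple)
  have c: "w \<otimes> r \<in> carrier W" using w r by simp
  have "inversion_set w = insert (- \<rho> w (\<alpha> r)) (inversion_set (w \<otimes> r))"
    "- \<rho> w (\<alpha> r) \<notin> inversion_set (w \<otimes> r)"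
    using inversion_right[OF c r] p w r unfolding e by simp_all
  then show "inversion_set (w \<otimes> r) = inversion_set w - {- \<rho> w (\<alpha> r)}"
    "- \<rho> w (\<alpha> r) \<in> inversion_set w" by blast+
qed

lemma inversion_card:
  "w \<in> carrier W \<Longrightarrow> finite (inversion_set w) \<and> card (inversion_set w) = len w"
proof (induction "len w" arbitrary: w rule: less_induct)
  case less
  show ?case
  proof (cases "w = \<one>")
    case False
    then obtain v s where v: "v \<in> carrier W" "s \<in> S" "w = v \<otimes> s" "len w = Suc (len v)"
      using len_last less.prems by blast
    have "\<rho> v (\<alpha> s) \<in> pos_roots" using simple_act_pos v by simp
    then show ?thesis using inversion_right[of v s] less.hyps[of v] v by simp
  qed (simp add: inversion_one)
qed

lemma finite_inversion: "w \<in> carrier W \<Longrightarrow> finite (inversion_set w)"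
  using inversion_card by blast

lemma left_descent:
  assumes "w \<in> carrier W" "s \<in> S"
  shows "\<alpha> s \<in> inversion_set w \<longleftrightarrow> len w = Suc (len (s \<otimes> w))"
    and "\<alpha> s \<notin> inversion_set w \<longleftrightarrow> len (s \<otimes> w) = Suc (len w)"
proof -
  have "len (inv w \<otimes> s) = len (s \<otimes> w)"
    using len_inv[of "s \<otimes> w"] assms by (simp add: inv_mult_group)
  then have c: "\<rho> (inv w) (\<alpha> s) \<in> pos_roots \<and> len (s \<otimes> w) = Suc (len w) \<or>
      - \<rho> (inv w) (\<alpha> s) \<in> pos_roots \<and> len w = Suc (len (s \<otimes> w))"
    using simple_act_cases[of "inv w" s] assms len_inv[of w] by simp
  moreover have "\<alpha> s \<in> inversion_set w \<longleftrightarrow> - \<rho> (inv w) (\<alpha> s) \<in> pos_roots"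
    using inv_iff[OF assms(1)] simple_pos[OF assms(2)] by simp
  ultimately show "\<alpha> s \<in> inversion_set w \<longleftrightarrow> len w = Suc (len (s \<otimes> w))"
    "\<alpha> s \<notin> inversion_set w \<longleftrightarrow> len (s \<otimes> w) = Suc (len w)"
    using pos_not_neg[of "\<rho> (inv w) (\<alpha> s)"] by auto
qed

text \<open>
  Both sides are unaffected when a first letter \<open>s\<close> of \<open>u\<close> is deleted from \<open>u\<close> and \<open>w\<close>: each side
  implies that \<open>s\<close> is a left descent of \<open>w\<close> too.
\<close>

lemma inversion_mono_iff:
  assumes "u \<in> carrier W" "w \<in> carrier W"
  shows "prefix u w \<longleftrightarrow> inversion_set u \<subseteq> inversion_set w"
  using assms
proof (induction "len u" arbitrary: u w)
  case 0
  then have "u = \<one>" using len_zero by simp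
  then show ?case using 0 by (auto simp: inversion_one prefix_def)
next
  case (Suc n)
  then have "u \<noteq> \<one>" by auto
  then obtain v s where v: "v \<in> carrier W" "s \<in> S" "u = s \<otimes> v" "len u = Suc (len v)"
    using len_first Suc.prems by blast
  have sN: "\<alpha> s \<in> inversion_set u"
    using left_descent(1)[of u s] v Suc.prems by simp
  have svs: "s \<otimes> u = v" using v by simp
  define w' where "w' = s \<otimes> w"
  have w': "w' \<in> carrier W" "w = s \<otimes> w'" using Suc.prems v by (auto simp: w'_def)
  have IH: "prefix v w' \<longleftrightarrow> inversion_set v \<subseteq> inversion_set w'"
    using Suc.hyps v w' by simp
  show ?case
  proof
    assume "prefix u w"
    then obtain x where x: "x \<in> carrier W" "w = u \<otimes> x" "len w = len u + len x"
      by (auto simp: prefix_def)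
    have e: "w' = v \<otimes> x" using x v by (simp add: w'_def m_assoc)
    have "len w \<le> 1 + len w'" using len_mult[of s w'] len_gen[of s] v w' by simp
    then have l: "len w = Suc (len w')" "len w' = len v + len x"
      using x v e len_mult[of v x] by simp_all
    then have "inversion_set v \<subseteq> inversion_set w'"
      using IH e x v unfolding prefix_def by blast
    moreover have "\<alpha> s \<in> inversion_set w"
      using left_descent(1)[of w s] l Suc.prems v by (simp add: w'_def)
    ultimately show "inversion_set u \<subseteq> inversion_set w"
      using inversion_left[of v s] inversion_left[of w' s] inv_sub_pos[of u] v w' by blast
  next
    assume sub: "inversion_set u \<subseteq> inversion_set w"
    have "inversion_set v \<subseteq> inversion_set w'"
    proof
      fix y assume y: "y \<in> inversion_set v"
      have "\<alpha> s \<notin> inversion_set v" using inversion_left_simple[of v s] v sN by simp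
      then have ys: "y \<noteq> \<alpha> s" using y by blast
      have yp: "y \<in> pos_roots" using y inv_sub_pos by blast
      have r: "\<rho> s y \<in> pos_roots" using gen_permutes_pos yp ys v by blast
      have rs: "\<rho> s y \<noteq> \<alpha> s"
        using pos_not_neg[OF yp] act_gen_simple[of s] v
        by (metis gen_gen_act minus_minus simple_pos)
      have "\<rho> s y \<in> inversion_set u" using inversion_left[of v s "\<rho> s y"] v r rs y by simp
      then have "\<rho> s y \<in> inversion_set w" using sub by blast
      then show "y \<in> inversion_set w'"
        using inversion_left[of w' s "\<rho> s y"] w' v r rs by simp
    qed
    then obtain x where x: "x \<in> carrier W" "w' = v \<otimes> x" "len w' = len v + len x"
      using IH by (auto simp: prefix_def)
    have "len w = Suc (len w')"
      using left_descent(1)[of w s] sub sN Suc.prems v by (auto simp: w'_def)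
    then show "prefix u w"
      using x v w' Suc.prems by (auto simp: prefix_def m_assoc intro!: bexI[of _ x])
  qed
qed

lemma inversion_inj:
  assumes "u \<in> carrier W" "w \<in> carrier W" "inversion_set u = inversion_set w"
  shows "u = w"
proof -
  obtain x where x: "x \<in> carrier W" "w = u \<otimes> x" "len w = len u + len x"
    using inversion_mono_iff[of u w] assms by (auto simp: prefix_def)
  moreover have "len u = len w" using inversion_card assms by metis
  ultimately show ?thesis using len_zero assms by simp
qed

lemma prefix_last:
  assumes "u \<in> carrier W" "g \<in> carrier W" "inversion_set u \<subseteq> inversion_set g" "u \<noteq> g"
  obtains r where "r \<in> S" "- \<rho> g (\<alpha> r) \<in> pos_roots" "inversion_set u \<subseteq> inversion_set (g \<otimes> r)"
proof -
  obtain x where x: "x \<in> carrier W" "g = u \<otimes> x" "len g = len u + len x"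
    using inversion_mono_iff[of u g] assms by (auto simp: prefix_def)
  have "x \<noteq> \<one>" using x assms by auto
  then obtain v r where v: "v \<in> carrier W" "r \<in> S" "x = v \<otimes> r" "len x = Suc (len v)"
    using len_last x by blast
  have e: "g \<otimes> r = u \<otimes> v" using v x assms by (simp add: m_assoc)
  have "len (u \<otimes> v) \<le> len u + len v" using len_mult v assms by simp
  then have l: "len g = Suc (len (g \<otimes> r))" "len (g \<otimes> r) = len u + len v"
    using len_gen_cases[of g r] v x assms e by auto
  have "prefix u (g \<otimes> r)" unfolding prefix_def using l e v assms by auto
  then have "inversion_set u \<subseteq> inversion_set (g \<otimes> r)"
    using inversion_mono_iff[of u "g \<otimes> r"] v assms by simp
  then show ?thesis using that[of r] simple_act_cases[of g r] l v assms by simp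
qed

subsection \<open>Convexity\<close>

text \<open>
  The inverse of \<open>w\<close> is linear, sends inversions to negative roots and other positive roots to positive
  ones.  This makes \<open>N(w)\<close> and its complement in the positive roots closed under positive combinations.
\<close>

lemma inversion_convex:
  assumes "w \<in> carrier W" "y \<in> roots" "y \<in> cone (inversion_set w)"
  shows "y \<in> inversion_set w"
proof -
  have "y \<in> pos_roots"
    using pos_from_cone assms cone_mono[OF inv_sub_pos] by blast
  moreover have "- \<rho> (inv w) y \<in> cone ((\<lambda>y. - \<rho> (inv w) y) ` inversion_set w)"
    using assms act_linear[of "inv w"]
    by (intro cone_linear_image linear_compose_neg) auto
  then have "- \<rho> (inv w) y \<in> cone pos_roots"
    using cone_mono[of "(\<lambda>y. - \<rho> (inv w) y) ` inversion_set w" pos_roots] inv_iff[of w] assms by blast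
  then have "- \<rho> (inv w) y \<in> pos_roots"
    using pos_from_cone root_neg act_roots assms by simp
  ultimately show ?thesis using inv_iff assms by simp
qed

lemma inversion_convex2:
  assumes "w \<in> carrier W" "x \<in> roots" "x = p *\<^sub>R b + q *\<^sub>R e" "0 \<le> p" "0 \<le> q"
    "b \<in> inversion_set w" "e \<in> inversion_set w"
  shows "x \<in> inversion_set w"
  using inversion_convex[OF assms(1,2)] cone_pair[of b _ e p q] assms by blast

lemma pos_convex2:
  assumes "x \<in> roots" "x = p *\<^sub>R b + q *\<^sub>R e" "0 \<le> p" "0 \<le> q" "b \<in> pos_roots" "e \<in> pos_roots"
  shows "x \<in> pos_roots"
  using pos_from_cone[OF assms(1)] cone_pair[of b _ e p q] assms by blast

lemma inversion_coconvex2: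
  assumes "w \<in> carrier W" "x \<in> inversion_set w" "x = p *\<^sub>R b + q *\<^sub>R e" "0 \<le> p" "0 \<le> q"
    "b \<in> pos_roots" "e \<in> pos_roots" "e \<notin> inversion_set w"
  shows "b \<in> inversion_set w"
proof (rule ccontr)
  assume "b \<notin> inversion_set w"
  then have b: "\<rho> (inv w) b \<in> pos_roots" "\<rho> (inv w) e \<in> pos_roots" using assms not_inv_iff by auto
  have x: "x \<in> pos_roots" using assms inv_sub_pos by blast
  have "\<rho> (inv w) x \<in> pos_roots"
    using pos_convex2[OF _ _ assms(4,5) b] assms act_roots[of "inv w" x] pos_root[OF x] by simp
  then show False using not_inv_iff[OF assms(1) x] assms by blast
qed

section \<open>Reflections\<close>

lemma reflection_ex:
  assumes "y \<in> roots"
  shows "\<exists>w\<in>carrier W. \<forall>x. \<rho> w x = x - (2 * B y x) *\<^sub>R y"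
proof -
  obtain w s where w: "w \<in> carrier W" "s \<in> S" "y = \<rho> w (\<alpha> s)"
    using assms by (auto simp: roots_def)
  have "B (\<alpha> s) (\<rho> (inv w) x) = B y x" for x
    using act_form[of w "\<alpha> s" "\<rho> (inv w) x"] w by simp
  then have "\<rho> (w \<otimes> s \<otimes> inv w) x = x - (2 * B y x) *\<^sub>R y" for x
    using w by (simp add: act_mult act_simple)
  then show ?thesis using w by (intro bexI[of _ "w \<otimes> s \<otimes> inv w"]) auto
qed

lemma reflection:
  assumes "y \<in> roots"
  shows "reflection y \<in> carrier W" "\<rho> (reflection y) x = x - (2 * B y x) *\<^sub>R y"
proof -
  have "\<exists>!w. w \<in> carrier W \<and> \<rho> w = (\<lambda>x. x - (2 * B y x) *\<^sub>R y)"
    using reflection_ex[OF assms] act_eqI by (auto simp: fun_eq_iff)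
  from theI'[OF this] show "reflection y \<in> carrier W" "\<rho> (reflection y) x = x - (2 * B y x) *\<^sub>R y"
    unfolding reflection_def by (simp_all add: fun_eq_iff)
qed

lemma reflection_unique:
  "y \<in> roots \<Longrightarrow> w \<in> carrier W \<Longrightarrow> (\<And>x. \<rho> w x = x - (2 * B y x) *\<^sub>R y) \<Longrightarrow> w = reflection y"
  using act_eqI[of w "reflection y"] reflection by simp

lemma reflection_simple: "s \<in> S \<Longrightarrow> reflection (\<alpha> s) = s"
  using reflection_unique[of "\<alpha> s" s] simple_in_roots act_simple by simp

lemma reflection_conj:
  assumes "w \<in> carrier W" "y \<in> roots"
  shows "reflection (\<rho> w y) = w \<otimes> reflection y \<otimes> inv w"
proof (rule reflection_unique[symmetric])
  fix x
  have "B y (\<rho> (inv w) x) = B (\<rho> w y) x"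
    using act_form[of w y "\<rho> (inv w) x"] assms by simp
  then show "\<rho> (w \<otimes> reflection y \<otimes> inv w) x = x - (2 * B (\<rho> w y) x) *\<^sub>R \<rho> w y"
    using assms reflection by (simp add: act_mult)
qed (use assms reflection act_roots in auto)

lemma reflection_root: "y \<in> roots \<Longrightarrow> x \<in> roots \<Longrightarrow> x - (2 * B y x) *\<^sub>R y \<in> roots"
  using act_roots[of "reflection y" x] reflection by simp

lemma reflection_neg: "y \<in> roots \<Longrightarrow> reflection (- y) = reflection y"
  using reflection_unique[of y "reflection (- y)"] reflection[of "- y"] root_neg by simp

lemma reflection_sq: "y \<in> roots \<Longrightarrow> reflection y \<otimes> reflection y = \<one>"
proof -
  assume y: "y \<in> roots"
  have "\<rho> (reflection y) (\<rho> (reflection y) v) = v" for v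
    unfolding reflection(2)[OF y] by (simp add: root_unit[OF y] algebra_simps)
  then show ?thesis using reflection(1)[OF y] by (intro act_eqI) (simp_all add: act_mult)
qed

lemma reflection_inv: "y \<in> roots \<Longrightarrow> inv (reflection y) = reflection y"
  using reflection_sq reflection by (intro inv_equality) auto

lemma reflection_eq:
  assumes "y \<in> roots" "z \<in> roots" "reflection y = reflection z"
  shows "y = z \<or> y = - z"
proof -
  have "y - (2 * B y y) *\<^sub>R y = y - (2 * B z y) *\<^sub>R z"
    using reflection(2)[of y y] reflection(2)[of z y] assms by simp
  then have "2 *\<^sub>R y = 2 *\<^sub>R (B z y *\<^sub>R z)" using root_unit[OF assms(1)] by simp
  then have e: "y = B z y *\<^sub>R z" by (subst (asm) scaleR_cancel_left) simp
  then have "B y y = B z y * B z y * B z z" by (metis B_lin(4) B_lin(9) mult.assoc)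
  then have "B z y * B z y = 1" using root_unit assms by simp
  then have "B z y = 1 \<or> B z y = - 1" by (simp add: square_eq_1_iff)
  then show ?thesis using e by auto
qed

text \<open>
  The length of the reflection measures how far a root is from being simple; it decreases along the
  climb of \<open>short_covers\<close>.
\<close>

lemma reflection_shorter:
  assumes th: "\<theta> \<in> pos_roots" and r: "r \<in> S" and b: "B \<theta> (\<alpha> r) > 0" and ne: "\<theta> \<noteq> \<alpha> r"
  shows "len (reflection (\<rho> r \<theta>)) < len (reflection \<theta>)"
proof -
  let ?t = "reflection \<theta>"
  have thr: "\<theta> \<in> roots" using th pos_root by simp
  have t: "?t \<in> carrier W" "inv ?t = ?t" using reflection reflection_inv thr by auto
  have ta: "\<rho> ?t (\<alpha> r) = \<alpha> r - (2 * B \<theta> (\<alpha> r)) *\<^sub>R \<theta>" using reflection thr by simp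
  have np: False
    if kx: "\<alpha> r = x + k *\<^sub>R \<theta>" "x \<in> cone (\<alpha> ` S)" "0 < k" for k x
  proof -
    have "k *\<^sub>R \<theta> + x = 1 *\<^sub>R \<alpha> r" using kx by simp
    then obtain a where "k *\<^sub>R \<theta> = a *\<^sub>R \<alpha> r"
      using simple_extremal[OF r cone_scale[OF pos_cone[OF th] less_imp_le[OF kx(3)]] kx(2)] by blast
    then have "\<theta> = (a / k) *\<^sub>R \<alpha> r"
      using kx(3) by (metis divide_inverse_commute less_irrefl scaleR_one scaleR_scaleR left_inverse)
    then show False using root_scale[OF th simple_pos[OF r]] ne by blast
  qed
  have "\<rho> ?t (\<alpha> r) \<notin> pos_roots"
    using np[of "\<rho> ?t (\<alpha> r)" "2 * B \<theta> (\<alpha> r)"] ta b pos_cone by auto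
  then have mu: "- \<rho> ?t (\<alpha> r) \<in> pos_roots"
    using act_pos_cases[OF t(1) simple_in_roots[OF r]] by simp
  then have l1: "len (?t \<otimes> r) < len ?t"
    using simple_act_cases[OF t(1) r] pos_not_neg[of "\<rho> ?t (\<alpha> r)"] by auto
  have "- \<rho> ?t (\<alpha> r) \<noteq> \<alpha> r"
  proof
    assume "- \<rho> ?t (\<alpha> r) = \<alpha> r"
    then have "\<alpha> r + \<alpha> r = (2 * B \<theta> (\<alpha> r)) *\<^sub>R \<theta>" by (simp add: ta algebra_simps)
    then have "2 *\<^sub>R \<alpha> r = 2 *\<^sub>R (B \<theta> (\<alpha> r) *\<^sub>R \<theta>)" by (simp add: scaleR_2)
    then have "\<alpha> r = B \<theta> (\<alpha> r) *\<^sub>R \<theta>" by (subst (asm) scaleR_cancel_left) simp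
    then show False using root_scale[OF simple_pos th] r ne by metis
  qed
  then have "\<rho> r (- \<rho> ?t (\<alpha> r)) \<in> pos_roots" using gen_permutes_pos[OF r mu] by blast
  then have "- \<rho> (r \<otimes> ?t) (\<alpha> r) \<in> pos_roots" using r t by (simp add: act_mult)
  then have "len (r \<otimes> ?t \<otimes> r) < len (r \<otimes> ?t)"
    using simple_act_cases[of "r \<otimes> ?t" r] r t pos_not_neg[of "\<rho> (r \<otimes> ?t) (\<alpha> r)"] by auto
  moreover have "len (r \<otimes> ?t) = len (?t \<otimes> r)"
    using len_inv[of "?t \<otimes> r"] r t by (simp add: inv_mult_group)
  moreover have "reflection (\<rho> r \<theta>) = r \<otimes> ?t \<otimes> r" using reflection_conj[of r \<theta>] r thr by simp
  ultimately show ?thesis using l1 by simp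
qed

end

lemma cone_insertD:
  assumes "v \<in> cone G"
  shows "\<exists>t\<ge>0. \<exists>k\<in>cone (G - {g}). v = t *\<^sub>R g + k"
proof -
  have "v \<in> {v. \<exists>t\<ge>0. \<exists>k\<in>cone (G - {g}). v = t *\<^sub>R g + k}"
    using assms
  proof (rule cone_minimal, goal_cases)
    case 1
    show ?case using cone_zero by force
  next
    case (2 a)
    show ?case
    proof (cases "a = g")
      case True
      then show ?thesis using cone_zero[of "G - {g}"] by (auto intro!: exI[of _ 1] bexI[of _ 0])
    next
      case False
      then have "a \<in> cone (G - {g})" using 2 by (intro cone_base) auto
      then show ?thesis by (auto intro!: exI[of _ 0] bexI[of _ a])
    qed
  next
    case (3 y z)
    then obtain t k u l where "0 \<le> t" "k \<in> cone (G - {g})" "y = t *\<^sub>R g + k"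
      "0 \<le> u" "l \<in> cone (G - {g})" "z = u *\<^sub>R g + l" by blast
    then show ?case
      by (auto intro!: exI[of _ "t + u"] bexI[of _ "k + l"] cone_add simp: algebra_simps)
  next
    case (4 c y)
    then obtain t k where "0 \<le> t" "k \<in> cone (G - {g})" "y = t *\<^sub>R g + k" by blast
    then show ?case using 4
      by (auto intro!: exI[of _ "c * t"] bexI[of _ "c *\<^sub>R k"] cone_scale simp: algebra_simps)
  qed
  then show ?thesis by simp
qed

lemma scaleR_solve2:
  assumes "p *\<^sub>R (v::'v::real_vector) = a *\<^sub>R x + c *\<^sub>R y" "p \<noteq> 0"
  shows "v = (a / p) *\<^sub>R x + (c / p) *\<^sub>R y"
proof -
  have "v = (1 / p) *\<^sub>R (p *\<^sub>R v)" using assms(2) by simp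
  then show ?thesis by (simp add: assms(1) scaleR_right_distrib)
qed

lemma scaleR_solve1:
  assumes "p *\<^sub>R (v::'v::real_vector) = a *\<^sub>R x" "p \<noteq> 0"
  shows "v = (a / p) *\<^sub>R x"
  using scaleR_solve2[of p v a x 0 0] assms by simp

context geometric_representation
begin

section \<open>Short inversions\<close>

lemma pos_sum_positive:
  assumes "y \<in> pos_roots" "z \<in> cone (\<alpha> ` S)" "b \<in> pos_roots" "y + z = k *\<^sub>R b"
  shows "0 < k"
proof (rule ccontr)
  assume "\<not> 0 < k"
  then have "z + (- k) *\<^sub>R b \<in> cone (\<alpha> ` S)"
    using assms pos_cone[of b] by (intro cone_add cone_scale) auto
  moreover have "z + (- k) *\<^sub>R b = - y" using assms(4) by (simp add: algebra_simps)
  ultimately show False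
    using cone_pointed[of y] pos_cone[of y] root_nonzero[of y] pos_root[of y] assms(1) by simp
qed

text \<open>
  The negative of the reflection in \<open>b\<close>.  On a plane through \<open>b\<close> it exchanges the two sides of the ray of \<open>b\<close>,
  and it maps the inversions of the reflection in \<open>b\<close> to each other.
\<close>

definition mirror :: "'v \<Rightarrow> 'v \<Rightarrow> 'v" where
  "mirror b y = (2 * B b y) *\<^sub>R b - y"

lemma mirror_root: "b \<in> roots \<Longrightarrow> y \<in> roots \<Longrightarrow> mirror b y \<in> roots"
  using root_neg[OF reflection_root[of b y]] by (simp add: mirror_def)

lemma mirror_mirror: "b \<in> roots \<Longrightarrow> mirror b (mirror b y) = y"
  by (simp add: mirror_def root_unit algebra_simps)

lemma mirror_form: "b \<in> roots \<Longrightarrow> B b (mirror b y) = B b y"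
  by (simp add: mirror_def root_unit)

lemma mirror_ne:
  assumes "b \<in> pos_roots" "y \<in> pos_roots" "y \<noteq> b"
  shows "mirror b y \<noteq> b"
proof
  assume "mirror b y = b"
  then have "y = (2 * B b y - 1) *\<^sub>R b" by (simp add: mirror_def algebra_simps)
  then show False using root_scale[OF assms(2,1)] assms(3) by blast
qed

text \<open>
  This is the condition \<open>\<ell>(s\<^sub>b w) = \<ell>(w) - 1\<close>, expressed by roots: \<open>mirror b\<close> pairs off the inversions of
  the reflection \<open>s\<^sub>b\<close> other than \<open>b\<close>, at least one root of each pair is an inversion of \<open>w\<close>, and every pair with both
  in \<open>N(w)\<close> makes the length drop by two more.
\<close>

definition short :: "'a \<Rightarrow> 'v \<Rightarrow> bool" where
  "short w b \<longleftrightarrow> b \<in> inversion_set w \<and>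
     (\<forall>y\<in>inversion_set w. y \<noteq> b \<longrightarrow> mirror b y \<notin> inversion_set w)"

text \<open>
  A root and its mirror image add up to a multiple of \<open>b\<close>.
\<close>

lemma extreme_short:
  assumes "b \<in> inversion_set w" "b \<notin> cone (inversion_set w - {b})"
  shows "short w b"
  unfolding short_def
proof (intro conjI ballI impI notI assms(1))
  fix y assume y: "y \<in> inversion_set w" "y \<noteq> b" and m: "mirror b y \<in> inversion_set w"
  have pos: "b \<in> pos_roots" "y \<in> pos_roots" "mirror b y \<in> pos_roots"
    using y m assms inv_sub_pos by auto
  have ne: "mirror b y \<noteq> b" using mirror_ne pos y by blast
  have sum: "y + mirror b y = (2 * B b y) *\<^sub>R b" by (simp add: mirror_def)
  then have k: "0 < 2 * B b y" using pos_sum_positive[OF pos(2) pos_cone[OF pos(3)] pos(1)] by blast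
  have "(1 / (2 * B b y)) *\<^sub>R (y + mirror b y) \<in> cone (inversion_set w - {b})"
    using y m ne k by (intro cone_scale cone_add cone_base) auto
  then show False using assms k by (simp add: sum)
qed

text \<open>
  If \<open>b\<close> lies between the inversions \<open>y\<close> and \<open>x\<close> of a plane, reflect the two sides of \<open>b\<close> onto each other.
  Of \<open>x\<close> and the mirror image of \<open>y\<close>, which are on the same side, one is nearer to \<open>b\<close>; by convexity this
  one or the mirror image of the other is an inversion that contradicts shortness.
\<close>

lemma short_not_between:
  assumes w: "w \<in> carrier W" and sh: "short w b"
    and x: "x \<in> inversion_set w" and y: "y \<in> inversion_set w" "y \<noteq> b"
    and b: "b = p *\<^sub>R y + q *\<^sub>R x" "0 < p" "0 < q"
  shows False
proof -
  have bN: "b \<in> inversion_set w" using sh by (simp add: short_def)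
  note pos = subsetD[OF inv_sub_pos bN] subsetD[OF inv_sub_pos x] subsetD[OF inv_sub_pos y(1)]
  have br: "b \<in> roots" using pos pos_root by blast
  have xb: "x \<noteq> b"
  proof
    assume xb: "x = b"
    have "p *\<^sub>R y = b - q *\<^sub>R b" using b(1) unfolding xb by (simp add: eq_diff_eq)
    then have "p *\<^sub>R y = (1 - q) *\<^sub>R b" by (simp add: scaleR_left_diff_distrib)
    then have "y = ((1 - q) / p) *\<^sub>R b" using scaleR_solve1 b by blast
    then show False using root_scale[OF pos(3,1)] y by blast
  qed
  have m1: "p *\<^sub>R mirror b y = (2 * p * B b y - 1) *\<^sub>R b + q *\<^sub>R x"
    if "b = p *\<^sub>R y + q *\<^sub>R x" for x y p q
  proof -
    have py: "p *\<^sub>R y = b - q *\<^sub>R x" using that by (simp add: eq_diff_eq)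
    have "p *\<^sub>R mirror b y = (2 * p * B b y) *\<^sub>R b - p *\<^sub>R y"
      by (simp add: mirror_def scaleR_diff_right mult.commute mult.left_commute)
    then show ?thesis unfolding py by (simp add: scaleR_left_diff_distrib)
  qed
  have m2: "q *\<^sub>R mirror b x = (1 - 2 * p * B b y) *\<^sub>R b + p *\<^sub>R y"
    if e: "b = p *\<^sub>R y + q *\<^sub>R x" for x y p q
  proof -
    have "b = q *\<^sub>R x + p *\<^sub>R y" using e by (simp add: add.commute)
    then have "q *\<^sub>R mirror b x = (2 * q * B b x - 1) *\<^sub>R b + p *\<^sub>R y" by (rule m1)
    moreover have "B b b = p * B b y + q * B b x" by (subst (2) e) simp
    then have "2 * q * B b x - 1 = 1 - 2 * p * B b y" using root_unit[OF br] by simp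
    ultimately show ?thesis by simp
  qed
  have key: False if yx: "y \<in> inversion_set w" "x \<in> inversion_set w" "y \<noteq> b" "x \<noteq> b"
    and bb: "b = p *\<^sub>R y + q *\<^sub>R x" "0 < p" "0 < q" and mp: "mirror b y \<in> pos_roots" for x y p q
  proof -
    have yr: "y \<in> roots" "x \<in> roots" using yx inv_sub_pos pos_root by blast+
    have my: "mirror b y \<notin> inversion_set w" "mirror b x \<notin> inversion_set w"
      using sh yx by (auto simp: short_def)
    show False
    proof (cases "1 \<le> 2 * p * B b y")
      case True
      have "mirror b y = ((2 * p * B b y - 1) / p) *\<^sub>R b + (q / p) *\<^sub>R x"
        by (rule scaleR_solve2[OF m1]) (use bb in auto)
      then have "mirror b y \<in> inversion_set w"
        using inversion_convex2[OF w mirror_root[OF br yr(1)]] True bb bN yx by force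
      then show False using my by blast
    next
      case False
      have "mirror b x = ((1 - 2 * p * B b y) / q) *\<^sub>R b + (p / q) *\<^sub>R y"
        by (rule scaleR_solve2[OF m2]) (use bb in auto)
      then have "mirror b x \<in> inversion_set w"
        using inversion_convex2[OF w mirror_root[OF br yr(2)]] False bb bN yx by force
      then show False using my by blast
    qed
  qed
  have yr: "y \<in> roots" "x \<in> roots" using pos pos_root by blast+
  have b': "b = q *\<^sub>R x + p *\<^sub>R y" using b by (simp add: add.commute)
  have "mirror b y \<in> pos_roots \<or> mirror b x \<in> pos_roots"
  proof (rule ccontr)
    assume "\<not> ?thesis"
    then have n: "- mirror b y \<in> pos_roots" "- mirror b x \<in> pos_roots"
      using root_cases mirror_root[OF br] yr by blast+
    have "p *\<^sub>R mirror b y + q *\<^sub>R mirror b x = b"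
      unfolding m1[OF b(1)] m2[OF b(1)]
      by (subst (4) b(1)) (simp add: scaleR_left_diff_distrib)
    then have "- b = - (p *\<^sub>R mirror b y + q *\<^sub>R mirror b x)" by (rule arg_cong[OF sym])
    then have e: "- b = p *\<^sub>R (- mirror b y) + q *\<^sub>R (- mirror b x)" by simp
    have "- b \<in> pos_roots"
      by (rule pos_convex2[OF root_neg[OF br] e]) (use n b in auto)
    then show False using pos_not_neg pos by blast
  qed
  then show False
    using key[OF y(1) x y(2) xb b] key[OF x y(1) xb y(2) b' b(3,2)] by blast
qed

text \<open>
  In the plane, \<open>x\<close> and \<open>e\<close> are on the same side of \<open>b\<close>.  If \<open>b\<close> were not an end of the plane, it would lie
  between some \<open>y\<close> and its mirror image.  Exactly one of these is an inversion: if it is on the side of \<open>e\<close>,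
  then \<open>b\<close> lies between two non-inversions, and otherwise between it and \<open>x\<close>.
\<close>

lemma short_plane_simple:
  assumes w: "w \<in> carrier W" and sh: "short w b"
    and x: "x \<in> inversion_set w" "x = p *\<^sub>R b + q *\<^sub>R e" "0 < p" "0 < q"
    and e: "e \<in> pos_roots" "e \<notin> inversion_set w"
    and y: "y \<in> pos_roots" "y = l *\<^sub>R b + m *\<^sub>R e" "y \<noteq> b"
  shows "- mirror b y \<in> pos_roots"
proof (rule ccontr)
  have bN: "b \<in> inversion_set w" using sh by (simp add: short_def)
  have bp: "b \<in> pos_roots" and br: "b \<in> roots" using bN inv_sub_pos pos_root by blast+
  assume "- mirror b y \<notin> pos_roots"
  then have my: "mirror b y \<in> pos_roots"
    using root_cases mirror_root[OF br] y pos_root by blast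
  have key: False if y: "y \<in> inversion_set w" "y = l *\<^sub>R b + m *\<^sub>R e" "y \<noteq> b"
    and my: "mirror b y \<in> pos_roots" for y l m
  proof -
    have yp: "y \<in> pos_roots" using y inv_sub_pos by blast
    have mN: "mirror b y \<notin> inversion_set w" using sh y by (auto simp: short_def)
    consider "m = 0" | "0 < m" | "m < 0" by linarith
    then show False
    proof cases
      case 1
      then have "y = l *\<^sub>R b" using y(2) by simp
      then show False using root_scale[OF yp bp] y(3) by blast
    next
      case 2
      have s: "mirror b y + m *\<^sub>R e = (2 * B b y - l) *\<^sub>R b"
        unfolding mirror_def by (subst (2) y(2)) (simp add: scaleR_left_diff_distrib)
      then have k: "0 < 2 * B b y - l"
        using pos_sum_positive[OF my cone_scale[OF pos_cone[OF e(1)] less_imp_le[OF 2]] bp] by blast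
      have "(2 * B b y - l) *\<^sub>R b = 1 *\<^sub>R mirror b y + m *\<^sub>R e" using s by simp
      then have "b = (1 / (2 * B b y - l)) *\<^sub>R mirror b y + (m / (2 * B b y - l)) *\<^sub>R e"
        by (rule scaleR_solve2) (use k in simp)
      then have "mirror b y \<in> inversion_set w"
        using inversion_coconvex2[OF w bN _ _ _ my e] 2 k by force
      then show False using mN by blast
    next
      case 3
      have qe: "q *\<^sub>R e = x - p *\<^sub>R b" using x(2) by (simp add: eq_diff_eq add.commute)
      have "q *\<^sub>R y = (q * l) *\<^sub>R b + m *\<^sub>R (q *\<^sub>R e)"
        unfolding y(2) by (simp add: scaleR_right_distrib mult.commute)
      then have s: "q *\<^sub>R y + (- m) *\<^sub>R x = (q * l - m * p) *\<^sub>R b"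
        unfolding qe by (simp add: scaleR_right_diff_distrib scaleR_left_diff_distrib)
      have "y + ((- m) / q) *\<^sub>R x = ((q * l - m * p) / q) *\<^sub>R b"
      proof (rule scaleR_solve1)
        show "q *\<^sub>R (y + ((- m) / q) *\<^sub>R x) = (q * l - m * p) *\<^sub>R b"
          unfolding s[symmetric] using x(4) by (simp add: scaleR_right_distrib scaleR_right_diff_distrib)
      qed (use x(4) in simp)
      moreover have "((- m) / q) *\<^sub>R x \<in> cone (\<alpha> ` S)"
        using 3 x(4) pos_cone[OF subsetD[OF inv_sub_pos x(1)]]
        by (intro cone_scale) (simp_all add: divide_nonpos_pos)
      ultimately have "0 < (q * l - m * p) / q" using pos_sum_positive[OF yp _ bp] by blast
      then have k: "0 < q * l - m * p" using x(4) by (simp add: zero_less_divide_iff)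
      have "(q * l - m * p) *\<^sub>R b = q *\<^sub>R y + (- m) *\<^sub>R x" using s by simp
      then have "b = (q / (q * l - m * p)) *\<^sub>R y + ((- m) / (q * l - m * p)) *\<^sub>R x"
        by (rule scaleR_solve2) (use k in simp)
      moreover have "0 < q / (q * l - m * p)" "0 < (- m) / (q * l - m * p)"
        using k 3 x(4) by (intro divide_pos_pos; simp)+
      ultimately show False
        using short_not_between[OF w sh x(1) y(1,3)] by blast
    qed
  qed
  have "y \<in> inversion_set w \<or> mirror b y \<in> inversion_set w"
  proof (rule ccontr)
    assume n: "\<not> ?thesis"
    have s: "y + mirror b y = (2 * B b y) *\<^sub>R b" by (simp add: mirror_def)
    then have k: "0 < 2 * B b y" using pos_sum_positive[OF y(1) pos_cone[OF my] bp] by blast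
    have "(2 * B b y) *\<^sub>R b = 1 *\<^sub>R y + 1 *\<^sub>R mirror b y" using s by simp
    then have "b = (1 / (2 * B b y)) *\<^sub>R y + (1 / (2 * B b y)) *\<^sub>R mirror b y"
      by (rule scaleR_solve2) (use k in simp)
    then show False
      using inversion_coconvex2[OF w bN _ _ _ y(1) my] n k by force
  qed
  moreover have "mirror b y = (2 * B b y - l) *\<^sub>R b + (- m) *\<^sub>R e"
    unfolding mirror_def by (subst (2) y(2)) (simp add: scaleR_left_diff_distrib)
  moreover have "mirror b (mirror b y) \<in> pos_roots" using y mirror_mirror br by simp
  ultimately show False
    using key[OF _ y(2,3) my] key[of "mirror b y"] mirror_ne[OF bp y(1,3)] by blast
qed

section \<open>Climbing in the weak order\<close>

text \<open>
  Without the descent root, \<open>N(g)\<close> is the inversion set of \<open>g t\<close> and thus convex.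
\<close>

lemma descent_extreme:
  assumes g: "g \<in> carrier W" "t \<in> S" "- \<rho> g (\<alpha> t) \<in> pos_roots"
    and sub: "inversion_set w \<subseteq> inversion_set g"
  shows "- \<rho> g (\<alpha> t) \<notin> cone (inversion_set w - {- \<rho> g (\<alpha> t)})"
proof
  let ?x = "- \<rho> g (\<alpha> t)"
  assume "?x \<in> cone (inversion_set w - {?x})"
  then have "?x \<in> cone (inversion_set (g \<otimes> t))"
    using cone_mono[of "inversion_set w - {?x}" "inversion_set (g \<otimes> t)"] sub
      inversion_right_descent(1)[OF g] by blast
  then have "?x \<in> inversion_set (g \<otimes> t)"
    using inversion_convex[of "g \<otimes> t" ?x] pos_root[OF g(3)] g by simp
  then show False using inversion_right_descent(1)[OF g] by simp
qed

lemma jwords_inv: "J \<subseteq> S \<Longrightarrow> u \<in> jwords J \<Longrightarrow> inv u \<in> jwords J"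
  unfolding jwords_def
proof clarify
  fix xs assume J: "J \<subseteq> S" "set xs \<subseteq> J"
  then show "\<exists>ys. inv (word_value W xs) = word_value W ys \<and> set ys \<subseteq> J"
    by (intro exI[of _ "rev xs"]) (auto simp: word_rev)
qed

text \<open>
  The extreme inversion \<open>x\<close> from which \<open>b\<close> inherits membership in a bipodal set: together with a
  non-inversion \<open>e\<close> it shows that \<open>b\<close> is an end of their plane, while \<open>x\<close> is not.
\<close>

definition covers_inversion :: "'a \<Rightarrow> 'v \<Rightarrow> bool" where
  "covers_inversion w b \<longleftrightarrow> (\<exists>x\<in>inversion_set w. x \<notin> cone (inversion_set w - {x}) \<and>
     (\<exists>e\<in>pos_roots - inversion_set w. \<exists>p>0. \<exists>q>0. x = p *\<^sub>R b + q *\<^sub>R e))"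

text \<open>
  Take a shortest \<open>g\<close> above \<open>w\<close> of which \<open>b\<close> is a descent root, for the descent \<open>t\<close>, and another descent \<open>r\<close> of
  \<open>g\<close> that can be removed without leaving the elements above \<open>w\<close>.  Go down from \<open>g\<close> by letters \<open>r\<close> and \<open>t\<close> as far
  as possible while staying above \<open>w\<close>.  At the bottom, some descent root \<open>x\<close> in the plane is an inversion of
  \<open>w\<close>.  It is not \<open>b\<close> by the choice of \<open>g\<close>, so it lies strictly between the ends \<open>b\<close> and \<open>e = - g \<alpha>\<^sub>r\<close>.
\<close>

lemma covers_inversion_above:
  assumes w: "w \<in> carrier W" and b: "b \<in> inversion_set w"
    and nd: "\<And>t. t \<in> S \<Longrightarrow> b \<noteq> - \<rho> w (\<alpha> t)"
    and ex: "g1 \<in> carrier W" "inversion_set w \<subseteq> inversion_set g1" "t1 \<in> S" "b = - \<rho> g1 (\<alpha> t1)"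
  shows "covers_inversion w b"
proof -
  define G where "G = {g \<in> carrier W. inversion_set w \<subseteq> inversion_set g \<and> (\<exists>t\<in>S. b = - \<rho> g (\<alpha> t))}"
  have "g1 \<in> G" using ex by (auto simp: G_def)
  then obtain g where gG: "g \<in> G" and gmin: "\<And>g'. g' \<in> G \<Longrightarrow> len g \<le> len g'"
    using ex_has_least_nat[of "\<lambda>g. g \<in> G" g1 len] by blast
  obtain t where g: "g \<in> carrier W" "inversion_set w \<subseteq> inversion_set g" and t: "t \<in> S" "b = - \<rho> g (\<alpha> t)"
    using gG by (auto simp: G_def)
  have bp: "b \<in> pos_roots" using b inv_sub_pos by blast
  have "w \<noteq> g" using nd t by blast
  then obtain r where r: "r \<in> S" "- \<rho> g (\<alpha> r) \<in> pos_roots" "inversion_set w \<subseteq> inversion_set (g \<otimes> r)"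
    using prefix_last[OF w g] by blast
  define e where "e = - \<rho> g (\<alpha> r)"
  have eN: "e \<in> pos_roots" "e \<notin> inversion_set w"
    using r inversion_right_descent(1)[OF g(1) r(1,2)] by (auto simp: e_def)
  have rt: "r \<noteq> t" using eN b t by (auto simp: e_def)
  let ?J = "{r, t}"
  have J: "?J \<subseteq> S" using r t by simp
  define C where "C = {c \<in> jwords ?J. inversion_set w \<subseteq> inversion_set (g \<otimes> c)}"
  have rC: "r \<in> C" using r jwords_gen[OF J] by (simp add: C_def)
  then obtain c where cC: "c \<in> C" and cmin: "\<And>c'. c' \<in> C \<Longrightarrow> len (g \<otimes> c) \<le> len (g \<otimes> c')"
    using ex_has_least_nat[of "\<lambda>c. c \<in> C" r "\<lambda>c. len (g \<otimes> c)"] by blast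
  have cJ: "c \<in> jwords ?J" and c: "c \<in> carrier W" "inv c \<in> jwords ?J"
    using cC jwords_sub[OF J] jwords_inv[OF J] by (auto simp: C_def)
  define h where "h = g \<otimes> c"
  have h: "h \<in> carrier W" "inversion_set w \<subseteq> inversion_set h"
    using g c cC by (auto simp: h_def C_def)
  have gh: "\<rho> g v = \<rho> h (\<rho> (inv c) v)" for v
    using g c by (simp add: h_def act_mult)
  \<comment> \<open>otherwise \<open>h\<close> sends both simple roots to positive roots, and \<open>b\<close> would not be an inversion of \<open>h\<close>\<close>
  have "\<exists>u\<in>?J. - \<rho> h (\<alpha> u) \<in> pos_roots"
  proof (rule ccontr)
    assume "\<not> ?thesis"
    then have p: "\<rho> h (\<alpha> r) \<in> pos_roots" "\<rho> h (\<alpha> t) \<in> pos_roots"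
      using simple_act_cases[OF h(1)] r t by auto
    have J': "inv c \<in> jwords {t, r}" using c by (simp add: insert_commute)
    obtain a d where ad: "\<rho> (inv c) (\<alpha> t) = a *\<^sub>R \<alpha> t + d *\<^sub>R \<alpha> r"
      "0 \<le> a \<and> 0 \<le> d \<or> a \<le> 0 \<and> d \<le> 0"
      using dihedral_sign[OF t(1) r(1) rt[symmetric] J'] by metis
    have hb: "- b = a *\<^sub>R \<rho> h (\<alpha> t) + d *\<^sub>R \<rho> h (\<alpha> r)"
      using t(2) gh[of "\<alpha> t"] ad(1) h by simp
    show False
      using ad(2)
    proof
      assume "0 \<le> a \<and> 0 \<le> d"
      then have "- b \<in> pos_roots"
        using pos_convex2[OF root_neg[OF pos_root[OF bp]] hb] p by blast
      then show False using pos_not_neg[OF bp] by blast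
    next
      assume "a \<le> 0 \<and> d \<le> 0"
      moreover have "- \<rho> (inv c) (\<alpha> t) = (- a) *\<^sub>R \<alpha> t + (- d) *\<^sub>R \<alpha> r" by (simp add: ad)
      moreover have "- \<rho> (inv c) (\<alpha> t) \<in> roots"
        using root_neg act_roots simple_in_roots c t by simp
      ultimately have n: "- \<rho> (inv c) (\<alpha> t) \<in> pos_roots"
        using pos_convex2[of "- \<rho> (inv c) (\<alpha> t)" "- a" "\<alpha> t" "- d" "\<alpha> r"] simple_pos r t by simp
      have "\<rho> (inv h) b = - \<rho> (inv c) (\<alpha> t)" using t(2) gh[of "\<alpha> t"] h by simp
      moreover have "- \<rho> (inv h) b \<in> pos_roots" using b h inv_iff[OF h(1)] by blast
      ultimately show False using pos_not_neg[OF n] by simp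
    qed
  qed
  then obtain u where u: "u \<in> ?J" "- \<rho> h (\<alpha> u) \<in> pos_roots" by blast
  define x where "x = - \<rho> h (\<alpha> u)"
  have uS: "u \<in> S" using u J by blast
  have lu: "len (h \<otimes> u) < len h"
    using simple_act_cases[OF h(1) uS] u(2) pos_not_neg[of "\<rho> h (\<alpha> u)"] by auto
  have cu: "c \<otimes> u \<in> jwords ?J" using jwords_mult[OF J cJ jwords_gen[OF J u(1)]] .
  have hu: "h \<otimes> u = g \<otimes> (c \<otimes> u)" using g c uS by (simp add: h_def m_assoc)
  have "\<not> inversion_set w \<subseteq> inversion_set (h \<otimes> u)"
  proof
    assume "inversion_set w \<subseteq> inversion_set (h \<otimes> u)"
    then have "c \<otimes> u \<in> C" using cu hu by (simp add: C_def)
    then show False using cmin[of "c \<otimes> u"] lu hu by (simp add: h_def)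
  qed
  then have xN: "x \<in> inversion_set w"
    using inversion_right_descent(1)[OF h(1) uS u(2)] h by (auto simp: x_def)
  have xe: "x \<notin> cone (inversion_set w - {x})"
    using descent_extreme[OF h(1) uS u(2) h(2)] by (simp add: x_def)
  have xp: "x \<in> pos_roots" using u by (simp add: x_def)
  have xb: "x \<noteq> b"
  proof
    assume "x = b"
    then have "h \<in> G" using h uS by (auto simp: G_def x_def)
    then have "len g \<le> len h" by (rule gmin)
    also have "\<dots> \<le> len (g \<otimes> r)" using cmin[OF rC] by (simp add: h_def)
    also have "\<dots> < len g"
      using simple_act_cases[OF g(1) r(1)] r(2) pos_not_neg[of "\<rho> g (\<alpha> r)"] by auto
    finally show False by simp
  qed
  obtain a d where ad: "\<rho> c (\<alpha> u) = a *\<^sub>R \<alpha> r + d *\<^sub>R \<alpha> t" "0 \<le> a \<and> 0 \<le> d \<or> a \<le> 0 \<and> d \<le> 0"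
  proof (cases "u = r")
    case True
    then show ?thesis using dihedral_sign[OF r(1) t(1) rt cJ] that by metis
  next
    case False
    then have ut: "u = t" using u by simp
    have J': "c \<in> jwords {t, r}" using cJ by (simp add: insert_commute)
    obtain a d where "\<rho> c (\<alpha> t) = a *\<^sub>R \<alpha> t + d *\<^sub>R \<alpha> r" "0 \<le> a \<and> 0 \<le> d \<or> a \<le> 0 \<and> d \<le> 0"
      using dihedral_sign[OF t(1) r(1) rt[symmetric] J'] by metis
    then show ?thesis using that[of d a] ut by (auto simp: add.commute)
  qed
  have xeq: "x = d *\<^sub>R b + a *\<^sub>R e"
    using ad(1) g c by (simp add: x_def h_def act_mult t(2) e_def)
  have nn: "0 \<le> a \<and> 0 \<le> d"
  proof (rule ccontr)
    assume "\<not> ?thesis"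
    then have s: "0 \<le> - d" "0 \<le> - a" using ad(2) by auto
    have "- x = (- d) *\<^sub>R b + (- a) *\<^sub>R e" by (simp add: xeq)
    then have "- x \<in> pos_roots"
      using pos_convex2[OF root_neg[OF pos_root[OF xp]] _ s bp eN(1)] by blast
    then show False using pos_not_neg[OF xp] by blast
  qed
  have "d \<noteq> 0" using root_scale[OF xp eN(1), of a] xeq xN eN by auto
  moreover have "a \<noteq> 0" using root_scale[OF xp bp, of d] xeq xb by auto
  ultimately have "0 < a" "0 < d" using nn by auto
  then show ?thesis unfolding covers_inversion_def using xN xe xeq eN by blast
qed

text \<open>
  Put \<open>th = - g\<^sup>-\<^sup>1 b\<close> for \<open>g\<close> above \<open>w\<close>; this is simple if and only if \<open>b\<close> is a descent root of \<open>g\<close>.  Choose a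
  simple root \<open>\<alpha>\<^sub>r\<close> at an acute angle with \<open>th\<close>.  If \<open>r\<close> is not a descent of \<open>g\<close>, then \<open>b\<close> is still short for
  \<open>g r\<close>, with a \<open>th\<close> closer to being simple; so one may climb until \<open>b\<close> is a descent root, or \<open>r\<close> is a
  descent.  In the latter case the descent root \<open>x = - g \<alpha>\<^sub>r\<close> does what is wanted.  It is an inversion
  of \<open>w\<close>, because the inversions gained while climbing are at an obtuse angle with \<open>b\<close>.
\<close>

lemma short_covers:
  assumes w: "w \<in> carrier W" and sh: "short w b"
    and nd: "\<And>t. t \<in> S \<Longrightarrow> b \<noteq> - \<rho> w (\<alpha> t)"
  shows "covers_inversion w b"
proof -
  have bN: "b \<in> inversion_set w" using sh by (simp add: short_def)
  have bp: "b \<in> pos_roots" and br: "b \<in> roots" using bN inv_sub_pos pos_root by blast+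
  define G where "G = {g \<in> carrier W. inversion_set w \<subseteq> inversion_set g \<and> short g b \<and>
    (\<forall>y\<in>inversion_set g - inversion_set w. B b y < 0)}"
  have "w \<in> G" using w sh by (simp add: G_def)
  then obtain g where gG: "g \<in> G"
    and gmin: "\<And>g'. g' \<in> G \<Longrightarrow> len (reflection (\<rho> (inv g) b)) \<le> len (reflection (\<rho> (inv g') b))"
    using ex_has_least_nat[of "\<lambda>g. g \<in> G" w "\<lambda>g. len (reflection (\<rho> (inv g) b))"] by blast
  have g: "g \<in> carrier W" "inversion_set w \<subseteq> inversion_set g" and sg: "short g b"
    and neg: "\<And>y. y \<in> inversion_set g \<Longrightarrow> y \<notin> inversion_set w \<Longrightarrow> B b y < 0"
    using gG by (auto simp: G_def)
  define th where "th = - \<rho> (inv g) b"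
  have thp: "th \<in> pos_roots" using bN g inv_iff[OF g(1)] by (auto simp: th_def)
  have bth: "b = - \<rho> g th" using g by (simp add: th_def)
  show ?thesis
  proof (cases "\<exists>t\<in>S. th = \<alpha> t")
    case True
    then show ?thesis using covers_inversion_above[OF w bN nd g] bth by blast
  next
    case False
    obtain c where c: "\<forall>s\<in>S. 0 \<le> c s" "th = (\<Sum>s\<in>S. c s *\<^sub>R \<alpha> s)"
      using pos_cone[OF thp] simple_cone_iff by blast
    have "\<exists>r\<in>S. 0 < B th (\<alpha> r)"
    proof (rule ccontr)
      assume "\<not> ?thesis"
      then have "(\<Sum>s\<in>S. c s * B th (\<alpha> s)) \<le> 0"
        using c by (intro sum_nonpos mult_nonneg_nonpos) (auto simp: not_less)
      moreover have "B th th = (\<Sum>s\<in>S. c s * B th (\<alpha> s))"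
        by (subst (2) c(2)) (simp add: B_sum)
      ultimately show False using root_unit[OF pos_root[OF thp]] by simp
    qed
    then obtain r where r: "r \<in> S" "0 < B th (\<alpha> r)" by blast
    have thr: "th \<noteq> \<alpha> r" using False r by blast
    have Bx: "B b (- \<rho> g (\<alpha> r)) = B th (\<alpha> r)" using act_form[of g th "\<alpha> r"] g by (simp add: bth)
    show ?thesis
    proof (cases "- \<rho> g (\<alpha> r) \<in> pos_roots")
      case True
      define x where "x = - \<rho> g (\<alpha> r)"
      define k where "k = 2 * B (\<alpha> r) th"
      have k: "0 < k" using r form_sym[of "\<alpha> r" th] by (simp add: k_def)
      have xg: "x \<in> inversion_set g" using inversion_right_descent(2)[OF g(1) r(1) True] by (simp add: x_def)
      have xw: "x \<in> inversion_set w" using neg[OF xg] Bx r(2) by (force simp: x_def)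
      have xb: "x \<noteq> b" using thr act_inj[of g "\<alpha> r" th] g by (auto simp: x_def bth)
      have tp: "\<rho> r th \<in> pos_roots" using gen_permutes_pos[OF r(1) thp thr] .
      define e where "e = \<rho> g (\<rho> r th)"
      have be: "1 *\<^sub>R b + 1 *\<^sub>R e = k *\<^sub>R x"
        using r g by (simp add: e_def bth x_def k_def act_simple)
      have "e \<in> pos_roots"
      proof (rule ccontr)
        assume "e \<notin> pos_roots"
        then have en: "- e \<in> pos_roots"
          using act_pos_cases[OF g(1) pos_root[OF tp]] by (simp add: e_def)
        have eg: "- e \<in> inversion_set g" using en tp g by (simp add: inv_iff e_def)
        have "b = k *\<^sub>R x + 1 *\<^sub>R (- e)" using be by (simp add: eq_diff_eq)
        then show False using short_not_between[OF g(1) sg eg xg xb] k zero_less_one by blast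
      qed
      moreover have "e \<notin> inversion_set g"
        using not_inv_iff[OF g(1) \<open>e \<in> pos_roots\<close>] tp g by (simp add: e_def)
      then have "e \<notin> inversion_set w" using g by blast
      moreover have "x = (1 / k) *\<^sub>R b + (1 / k) *\<^sub>R e"
        by (rule scaleR_solve2) (use be k in auto)
      moreover have "x \<notin> cone (inversion_set w - {x})"
        using descent_extreme[OF g(1) r(1) True g(2)] by (simp add: x_def)
      moreover have "0 < 1 / k" using k by simp
      ultimately show ?thesis unfolding covers_inversion_def using xw by blast
    next
      case False
      define d where "d = \<rho> g (\<alpha> r)"
      have dp: "d \<in> pos_roots" using False simple_act_cases[OF g(1) r(1)] by (auto simp: d_def)
      have Bd: "B b d < 0" using Bx r(2) by (simp add: d_def)
      have N: "inversion_set (g \<otimes> r) = insert d (inversion_set g)"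
        using inversion_right(1)[OF g(1) r(1)] dp by (simp add: d_def)
      have "short (g \<otimes> r) b"
        unfolding short_def
      proof (intro conjI ballI impI notI)
        show "b \<in> inversion_set (g \<otimes> r)" using N sg by (simp add: short_def)
        fix y assume y: "y \<in> inversion_set (g \<otimes> r)" "y \<noteq> b" "mirror b y \<in> inversion_set (g \<otimes> r)"
        have yp: "y \<in> pos_roots" "mirror b y \<in> pos_roots" using y inv_sub_pos by blast+
        have "y = d \<or> mirror b y = d" using y N sg by (auto simp: short_def)
        then have "B b y < 0" using Bd mirror_form[OF br, of y] by auto
        moreover have "y + mirror b y = (2 * B b y) *\<^sub>R b" by (simp add: mirror_def)
        then have "0 < 2 * B b y" using pos_sum_positive[OF yp(1) pos_cone[OF yp(2)] bp] by blast
        ultimately show False by simp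
      qed
      then have "g \<otimes> r \<in> G" using g r N neg Bd by (auto simp: G_def)
      from gmin[OF this] have "len (reflection (- th)) \<le> len (reflection (\<rho> (inv (g \<otimes> r)) b))"
        by (simp add: th_def)
      moreover have "\<rho> (inv (g \<otimes> r)) b = - \<rho> r th"
        using g r by (simp add: inv_mult_group act_mult th_def)
      ultimately show ?thesis
        using reflection_shorter[OF thp r thr] reflection_neg[of th] reflection_neg[of "\<rho> r th"]
          act_roots[of r th] pos_root[OF thp] r by simp
    qed
  qed
qed


section \<open>Inversion sets generated by a bipodal set\<close>

text \<open>
  A generating subset of least cardinality consists of extreme roots.  The set to which \<open>cone_minimal\<close> is
  applied records that a combination of roots other than \<open>g\<close> is never a nonzero multiple of \<open>g\<close> alone.
\<close>

lemma extremes_generate: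
  assumes N: "finite N" "N \<subseteq> pos_roots"
  shows "N \<subseteq> cone {x \<in> N. x \<notin> cone (N - {x})}"
proof -
  define GG where "GG = {G. G \<subseteq> N \<and> N \<subseteq> cone G}"
  have "N \<in> GG" by (auto simp: GG_def intro: cone_base)
  then obtain G where G: "G \<in> GG" and Gmin: "\<And>G'. G' \<in> GG \<Longrightarrow> card G \<le> card G'"
    using ex_has_least_nat[of "\<lambda>G. G \<in> GG" N card] by blast
  have GN: "G \<subseteq> N" "N \<subseteq> cone G" using G by (auto simp: GG_def)
  have fG: "finite G" using GN N finite_subset by blast
  have sc: "cone (G - {g}) \<subseteq> cone (\<alpha> ` S)" for g
    using cone_trans[of _ "G - {g}" "\<alpha> ` S"] GN N pos_cone by blast
  have "g \<notin> cone (N - {g})" if g: "g \<in> G" for g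
  proof
    have gp: "g \<in> pos_roots" using g GN N by blast
    assume "g \<in> cone (N - {g})"
    then have "g \<in> {v. \<exists>t\<ge>0. \<exists>k\<in>cone (G - {g}). v = t *\<^sub>R g + k \<and> (k = 0 \<longrightarrow> v = 0)}"
    proof (rule cone_minimal, goal_cases)
      case 1
      show ?case using cone_zero by force
    next
      case (2 y)
      then have yp: "y \<in> pos_roots" "y \<in> cone G" "y \<noteq> g" using GN N by auto
      then obtain t k where tk: "0 \<le> t" "k \<in> cone (G - {g})" "y = t *\<^sub>R g + k"
        using cone_insertD by blast
      have "k \<noteq> 0"
      proof
        assume "k = 0"
        then have "y = t *\<^sub>R g" using tk by simp
        then show False using root_scale[OF yp(1) gp] yp by blast
      qed
      then show ?case using tk by blast
    next
      case (3 y z)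
      then obtain t k u l where e: "0 \<le> t" "k \<in> cone (G - {g})" "y = t *\<^sub>R g + k" "k = 0 \<longrightarrow> y = 0"
        "0 \<le> u" "l \<in> cone (G - {g})" "z = u *\<^sub>R g + l" "l = 0 \<longrightarrow> z = 0" by blast
      have "k + l = 0 \<longrightarrow> y + z = 0"
      proof
        assume kl: "k + l = 0"
        then have "- k = l" by (rule minus_unique)
        then have "k = 0" using cone_pointed[of k] e sc by blast
        then show "y + z = 0" using e kl by simp
      qed
      then show ?case using e
        by (auto intro!: exI[of _ "t + u"] bexI[of _ "k + l"] cone_add simp: algebra_simps)
    next
      case (4 c y)
      then obtain t k where e: "0 \<le> t" "k \<in> cone (G - {g})" "y = t *\<^sub>R g + k" "k = 0 \<longrightarrow> y = 0" by blast
      then show ?case using 4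
        by (auto intro!: exI[of _ "c * t"] bexI[of _ "c *\<^sub>R k"] cone_scale simp: algebra_simps)
    qed
    then obtain t k where tk: "0 \<le> t" "k \<in> cone (G - {g})" "g = t *\<^sub>R g + k" "k = 0 \<longrightarrow> g = 0" by blast
    have k0: "k \<noteq> 0" using tk root_nonzero pos_root gp by blast
    have ke: "(1 - t) *\<^sub>R g = k" using tk(3) by (simp add: algebra_simps)
    show False
    proof (cases "t < 1")
      case True
      then have "g = (1 / (1 - t)) *\<^sub>R k" using ke by auto
      then have gc: "g \<in> cone (G - {g})" using cone_scale[OF tk(2), of "1 / (1 - t)"] True by simp
      have "G \<subseteq> cone (G - {g})" using gc cone_base[of _ "G - {g}"] by blast
      then have "N \<subseteq> cone (G - {g})" using GN cone_trans by blast
      then have "card G \<le> card (G - {g})" using Gmin[of "G - {g}"] GN by (auto simp: GG_def)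
      then show False using card_Diff1_less[OF fG g] by simp
    next
      case False
      have "(t - 1) *\<^sub>R g \<in> cone (\<alpha> ` S)" using False pos_cone[OF gp] by (intro cone_scale) auto
      moreover have "(t - 1) *\<^sub>R g = - k" by (simp add: ke[symmetric] algebra_simps)
      ultimately have "k = 0" using cone_pointed[of k] sc tk(2) by auto
      then show False using k0 by blast
    qed
  qed
  then show ?thesis using GN cone_mono[of G "{x \<in> N. x \<notin> cone (N - {x})}"] by blast
qed

text \<open>
  It suffices that the extreme inversions are in \<open>A\<close>.  By \<open>short_covers\<close> each one is a descent root or
  is covered by another extreme inversion \<open>x\<close>, and then it inherits membership from \<open>x\<close>.  Passing from \<open>b\<close> to
  \<open>x\<close> adds non-inversions to a multiple of \<open>b\<close>.  This cannot lead back to \<open>b\<close>: otherwise a multiple of \<open>b\<close> would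
  be a positive combination of non-inversions.
\<close>

theorem descents_generate:
  assumes w: "w \<in> carrier W"
    and desc: "\<And>t. t \<in> S \<Longrightarrow> - \<rho> w (\<alpha> t) \<in> pos_roots \<Longrightarrow> - \<rho> w (\<alpha> t) \<in> A"
    and bip: "\<And>x b e p q. x \<in> A \<Longrightarrow> x \<in> inversion_set w \<Longrightarrow> short w b \<Longrightarrow> e \<in> pos_roots \<Longrightarrow>
      e \<notin> inversion_set w \<Longrightarrow> x = p *\<^sub>R b + q *\<^sub>R e \<Longrightarrow> 0 < p \<Longrightarrow> 0 < q \<Longrightarrow> b \<in> A"
  shows "inversion_set w \<subseteq> cone (A \<inter> inversion_set w)"
proof -
  let ?N = "inversion_set w"
  define E where "E = {x \<in> ?N. x \<notin> cone (?N - {x})}"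
  define R where "R b x \<longleftrightarrow> (\<exists>p>0. \<exists>k\<in>cone (pos_roots - ?N). k \<noteq> 0 \<and> x = p *\<^sub>R b + k)" for b x
  have sc: "cone (pos_roots - ?N) \<subseteq> cone (\<alpha> ` S)"
    using cone_trans[of _ "pos_roots - ?N" "\<alpha> ` S"] pos_cone by blast
  have irr: "\<not> R x x" if x: "x \<in> ?N" for x
  proof
    assume "R x x"
    then obtain p k where pk: "0 < p" "k \<in> cone (pos_roots - ?N)" "k \<noteq> 0" "x = p *\<^sub>R x + k"
      by (auto simp: R_def)
    have xp: "x \<in> pos_roots" using x inv_sub_pos by blast
    have ke: "(1 - p) *\<^sub>R x = k" using pk(4) by (simp add: algebra_simps)
    have "p < 1"
    proof (rule ccontr)
      assume "\<not> p < 1"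
      then have "(p - 1) *\<^sub>R x \<in> cone (\<alpha> ` S)" using pos_cone[OF xp] by (intro cone_scale) auto
      moreover have "(p - 1) *\<^sub>R x = - k" by (simp add: ke[symmetric] algebra_simps)
      ultimately show False using cone_pointed[of k] sc pk by auto
    qed
    then have "x = (1 / (1 - p)) *\<^sub>R k" using ke by auto
    then have "x \<in> cone (pos_roots - ?N)" using cone_scale[OF pk(2), of "1 / (1 - p)"] \<open>p < 1\<close> by simp
    then have "\<rho> (inv w) x \<in> cone (\<rho> (inv w) ` (pos_roots - ?N))"
      using act_linear[of "inv w"] w by (intro cone_linear_image) auto
    moreover have "\<rho> (inv w) ` (pos_roots - ?N) \<subseteq> pos_roots" using not_inv_iff[OF w] by blast
    ultimately have "\<rho> (inv w) x \<in> pos_roots"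
      using pos_from_cone act_roots[of "inv w" x] w pos_root[OF xp] cone_mono by blast
    then show False using not_inv_iff[OF w xp] x by blast
  qed
  have tr: "R x z" if xyz: "R x y" "R y z" for x y z
  proof -
    obtain p k where pk: "0 < p" "k \<in> cone (pos_roots - ?N)" "k \<noteq> 0" "y = p *\<^sub>R x + k"
      using xyz by (auto simp: R_def)
    obtain q l where ql: "0 < q" "l \<in> cone (pos_roots - ?N)" "l \<noteq> 0" "z = q *\<^sub>R y + l"
      using xyz by (auto simp: R_def)
    have c: "q *\<^sub>R k \<in> cone (pos_roots - ?N)" using pk ql by (intro cone_scale) auto
    have "q *\<^sub>R k + l \<noteq> 0"
    proof
      assume "q *\<^sub>R k + l = 0"
      then have "- (q *\<^sub>R k) = l" by (rule minus_unique)
      then have "q *\<^sub>R k = 0" using cone_pointed[of "q *\<^sub>R k"] c ql sc by blast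
      then show False using pk ql by simp
    qed
    moreover have "z = (q * p) *\<^sub>R x + (q *\<^sub>R k + l)" using pk ql by (simp add: algebra_simps)
    moreover have "0 < q * p" using pk ql by simp
    ultimately show ?thesis unfolding R_def using cone_add[OF c ql(2)] by blast
  qed
  have "E \<subseteq> A"
  proof (rule ccontr)
    assume "\<not> E \<subseteq> A"
    then have ne: "E - A \<noteq> {}" by blast
    have fin: "finite (E - A)" using finite_inversion[OF w] by (simp add: E_def)
    have "asymp_on (E - A) R"
      using irr tr unfolding asymp_on_def E_def by blast
    moreover have "transp_on (E - A) R" using tr by (auto simp: transp_on_def)
    ultimately obtain b where b: "b \<in> E - A" "\<And>x. x \<in> E - A \<Longrightarrow> x \<noteq> b \<Longrightarrow> \<not> R b x"
      using Finite_Set.bex_max_element[OF fin _ _ ne] by metis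
    have sh: "short w b" using b extreme_short by (auto simp: E_def)
    have bp: "b \<in> pos_roots" using b inv_sub_pos by (auto simp: E_def)
    have nd: "b \<noteq> - \<rho> w (\<alpha> t)" if "t \<in> S" for t
      using desc[OF that] b bp by auto
    obtain x e p q where x: "x \<in> ?N" "x \<notin> cone (?N - {x})" "e \<in> pos_roots" "e \<notin> ?N" "0 < p" "0 < q"
      "x = p *\<^sub>R b + q *\<^sub>R e"
      using short_covers[OF w sh nd] by (auto simp: covers_inversion_def)
    have "q *\<^sub>R e \<noteq> 0" using x root_nonzero pos_root by simp
    moreover have "q *\<^sub>R e \<in> cone (pos_roots - ?N)" using x by (intro cone_scale cone_base) auto
    ultimately have Rbx: "R b x" unfolding R_def using x by blast
    have xE: "x \<in> E" using x by (simp add: E_def)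
    have "x \<noteq> b" using irr[of b] Rbx b by (auto simp: E_def)
    then have "x \<in> A" using b(2)[of x] xE Rbx by blast
    then have "b \<in> A" using bip[OF _ x(1) sh x(3,4,7,5,6)] by blast
    then show False using b by blast
  qed
  then have "E \<subseteq> A \<inter> ?N" by (auto simp: E_def)
  moreover have "?N \<subseteq> cone E"
    using extremes_generate[OF finite_inversion[OF w] inv_sub_pos] by (simp add: E_def)
  ultimately show ?thesis using cone_mono by blast
qed

section \<open>Joins\<close>

text \<open>
  A shortest upper bound \<open>u\<close> has its descent roots in the union of the inversion sets, since otherwise a
  descent could be removed.  Relative bipodality of the union follows from the convexity of the
  complement of each inversion set.
\<close>

lemma join_exists:
  assumes X: "X \<subseteq> carrier W" "bounded_above X"
  obtains u where "u \<in> carrier W" "\<And>x. x \<in> X \<Longrightarrow> inversion_set x \<subseteq> inversion_set u"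
    "inversion_set u \<subseteq> cone (\<Union>x\<in>X. inversion_set x)"
proof -
  define U where "U = {u \<in> carrier W. \<forall>x\<in>X. inversion_set x \<subseteq> inversion_set u}"
  obtain g where g: "g \<in> carrier W" "\<forall>x\<in>X. prefix x g" using X by (auto simp: bounded_above_def)
  then have "g \<in> U" using inversion_mono_iff X by (auto simp: U_def)
  then obtain u where uU: "u \<in> U" and umin: "\<And>v. v \<in> U \<Longrightarrow> len u \<le> len v"
    using ex_has_least_nat[of "\<lambda>u. u \<in> U" g len] by blast
  have u: "u \<in> carrier W" "\<And>x. x \<in> X \<Longrightarrow> inversion_set x \<subseteq> inversion_set u"
    using uU by (auto simp: U_def)
  let ?A = "\<Union>x\<in>X. inversion_set x"
  have "inversion_set u \<subseteq> cone (?A \<inter> inversion_set u)"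
  proof (rule descents_generate[OF u(1)])
    fix t assume t: "t \<in> S" "- \<rho> u (\<alpha> t) \<in> pos_roots"
    show "- \<rho> u (\<alpha> t) \<in> ?A"
    proof (rule ccontr)
      assume "- \<rho> u (\<alpha> t) \<notin> ?A"
      then have "u \<otimes> t \<in> U"
        using u t inversion_right_descent(1)[OF u(1) t] by (auto simp: U_def)
      then have "len u \<le> len (u \<otimes> t)" by (rule umin)
      then show False using simple_act_cases[OF u(1) t(1)] t(2) pos_not_neg[of "\<rho> u (\<alpha> t)"] by auto
    qed
  next
    fix x b e p q
    assume x: "x \<in> ?A" and b: "short u b" and e: "e \<in> pos_roots" "e \<notin> inversion_set u"
      and xe: "x = p *\<^sub>R b + q *\<^sub>R e" "0 < p" "0 < q"
    then obtain y where y: "y \<in> X" "x \<in> inversion_set y" by blast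
    then have "e \<notin> inversion_set y" using u e by blast
    moreover have "b \<in> pos_roots" using b inv_sub_pos by (auto simp: short_def)
    ultimately have "b \<in> inversion_set y"
      using inversion_coconvex2[of y x p b q e] y X xe e by auto
    then show "b \<in> ?A" using y by blast
  qed
  then show ?thesis using that[OF u] cone_mono[of "?A \<inter> inversion_set u" ?A] by blast
qed

lemma weak_join:
  assumes X: "X \<subseteq> carrier W" "bounded_above X"
  shows "\<Squnion>\<^bsub>weak_order\<^esub> X \<in> carrier W"
    and "\<And>x. x \<in> X \<Longrightarrow> inversion_set x \<subseteq> inversion_set (\<Squnion>\<^bsub>weak_order\<^esub> X)"
    and "inversion_set (\<Squnion>\<^bsub>weak_order\<^esub> X) \<subseteq> cone (\<Union>x\<in>X. inversion_set x)"
proof -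
  obtain u where u: "u \<in> carrier W" "\<And>x. x \<in> X \<Longrightarrow> inversion_set x \<subseteq> inversion_set u"
    "inversion_set u \<subseteq> cone (\<Union>x\<in>X. inversion_set x)"
    using join_exists[OF X] by metis
  have up: "v \<in> Upper weak_order X \<longleftrightarrow> v \<in> carrier W \<and> (\<forall>x\<in>X. inversion_set x \<subseteq> inversion_set v)" for v
    using inversion_mono_iff X by (auto simp: Upper_def weak_order_def)
  have "inversion_set u \<subseteq> inversion_set v"
    if v: "v \<in> carrier W" "\<forall>x\<in>X. inversion_set x \<subseteq> inversion_set v" for v
  proof
    fix y assume y: "y \<in> inversion_set u"
    then have "y \<in> cone (inversion_set v)"
      using u(3) cone_mono[of "\<Union>x\<in>X. inversion_set x" "inversion_set v"] v by blast
    then show "y \<in> inversion_set v"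
      using inversion_convex[OF v(1)] y inv_sub_pos pos_root by blast
  qed
  then have L: "least weak_order u (Upper weak_order X)"
    unfolding least_def using up u inversion_mono_iff[OF u(1)]
    by (auto simp: weak_order_def)
  have "\<Squnion>\<^bsub>weak_order\<^esub> X = u"
    unfolding Lattice.sup_def
  proof (rule some_equality[of "\<lambda>x. least weak_order x (Upper weak_order X)", OF L])
    fix v assume v: "least weak_order v (Upper weak_order X)"
    then have "v \<in> carrier W" "prefix v u" "prefix u v"
      using L up by (auto simp: least_def weak_order_def)
    then show "v = u" using inversion_inj[of v u] inversion_mono_iff u by blast
  qed
  then show "\<Squnion>\<^bsub>weak_order\<^esub> X \<in> carrier W"
    "\<And>x. x \<in> X \<Longrightarrow> inversion_set x \<subseteq> inversion_set (\<Squnion>\<^bsub>weak_order\<^esub> X)"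
    "inversion_set (\<Squnion>\<^bsub>weak_order\<^esub> X) \<subseteq> cone (\<Union>x\<in>X. inversion_set x)"
    using u by simp_all
qed

section \<open>Maximal dihedral subgroups\<close>

text \<open>
  Each element of the subgroup moves every vector by a vector of \<open>P\<close>.  A reflection moves its root by
  twice that root, so no root outside \<open>P\<close> belongs to the subgroup.
\<close>

lemma generated_moves:
  assumes P: "subspace P" and h: "h \<in> generate W (reflection ` (P \<inter> roots))"
  shows "h \<in> carrier W \<and> (\<forall>v. \<rho> h v - v \<in> P)"
  using h
proof induction
  case one
  then show ?case using P by (simp add: subspace_0)
next
  case (incl h)
  then obtain y where "y \<in> P" "y \<in> roots" "h = reflection y" by blast
  then show ?case using reflection[of y] P by (simp add: subspace_neg subspace_scale)
next
  case (inv h)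
  then obtain y where "y \<in> P" "y \<in> roots" "h = reflection y" by blast
  then show ?case using reflection[of y] P by (simp add: subspace_neg subspace_scale reflection_inv)
next
  case (eng h1 h2)
  have "\<rho> (h1 \<otimes> h2) v - v \<in> P" for v
  proof -
    have "(\<rho> h1 (\<rho> h2 v) - \<rho> h2 v) + (\<rho> h2 v - v) \<in> P"
      using eng P by (intro subspace_add) auto
    then show ?thesis using eng by (simp add: act_mult)
  qed
  then show ?case using eng by simp
qed

lemma plane_subgroup_roots:
  assumes P: "subspace P"
  shows "subgroup_roots (generate W (reflection ` (P \<inter> roots))) = P \<inter> roots"
proof (intro equalityI subsetI)
  fix y assume "y \<in> subgroup_roots (generate W (reflection ` (P \<inter> roots)))"
  then have y: "y \<in> roots" "reflection y \<in> generate W (reflection ` (P \<inter> roots))"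
    by (auto simp: subgroup_roots_def)
  then have "\<rho> (reflection y) y - y \<in> P" using generated_moves[OF P] by blast
  moreover have "\<rho> (reflection y) y - y = (- 2) *\<^sub>R y"
    using y reflection(2)[of y y] root_unit by simp
  ultimately have "(- 1 / 2) *\<^sub>R ((- 2) *\<^sub>R y) \<in> P" using subspace_scale[OF P] by metis
  then show "y \<in> P \<inter> roots" using y by simp
next
  fix y assume "y \<in> P \<inter> roots"
  then show "y \<in> subgroup_roots (generate W (reflection ` (P \<inter> roots)))"
    by (auto simp: subgroup_roots_def intro: generate.incl)
qed

lemma inversion_reflection:
  "g \<in> roots \<Longrightarrow> y \<in> inversion_set (reflection g) \<longleftrightarrow> y \<in> pos_roots \<and> mirror g y \<in> pos_roots"
  using inv_iff[of "reflection g" y] reflection[of g] by (simp add: reflection_inv mirror_def)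

lemma canonical_simple_iff:
  assumes P: "subspace P"
  shows "g \<in> canonical_simple_system (generate W (reflection ` (P \<inter> roots))) \<longleftrightarrow>
    g \<in> pos_roots \<and> g \<in> P \<and> (\<forall>y\<in>pos_roots \<inter> P. y \<noteq> g \<longrightarrow> - mirror g y \<in> pos_roots)"
    (is "?L \<longleftrightarrow> ?R")
proof
  assume ?L
  then have g: "g \<in> pos_roots" "inversion_set (reflection g) \<inter> (P \<inter> roots) = {g}"
    by (auto simp: canonical_simple_system_def plane_subgroup_roots[OF P])
  have gr: "g \<in> roots" using g pos_root by blast
  have "- mirror g y \<in> pos_roots" if "y \<in> pos_roots \<inter> P" "y \<noteq> g" for y
  proof -
    have "y \<notin> inversion_set (reflection g)" using that g pos_root by blast
    then show ?thesis
      using inversion_reflection[OF gr] that root_cases[OF mirror_root[OF gr]] pos_root by blast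
  qed
  then show ?R using g by blast
next
  assume g: ?R
  then have gr: "g \<in> roots" using pos_root by blast
  have "mirror g g = g" using root_unit[OF gr] by (simp add: mirror_def scaleR_2)
  then have "g \<in> inversion_set (reflection g)" using inversion_reflection[OF gr] g by simp
  moreover have "y = g" if y: "y \<in> inversion_set (reflection g)" "y \<in> P" for y
  proof (rule ccontr)
    assume "y \<noteq> g"
    then have "- mirror g y \<in> pos_roots" using g y inv_sub_pos by blast
    then show False using y inversion_reflection[OF gr] pos_not_neg by blast
  qed
  ultimately show ?L
    using g gr by (auto simp: canonical_simple_system_def plane_subgroup_roots[OF P])
qed

text \<open>
  The form of bipodality needed for \<open>descents_generate\<close>: \<open>x\<close> lies strictly between \<open>b\<close> and \<open>e\<close>, hence is not
  simple in their plane.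
\<close>

lemma bipodalD:
  assumes A: "bipodal A" and x: "x \<in> A" "x = p *\<^sub>R b + q *\<^sub>R e" "0 < p" "0 < q"
    and be: "b \<in> pos_roots" "e \<in> pos_roots" "b \<noteq> e"
    and simple: "\<And>y l m. y \<in> pos_roots \<Longrightarrow> y = l *\<^sub>R b + m *\<^sub>R e \<Longrightarrow> y \<noteq> b \<Longrightarrow> - mirror b y \<in> pos_roots"
  shows "b \<in> A"
proof -
  define P where "P = span {b, e}"
  have P: "subspace P" "b \<in> P" "e \<in> P" by (simp_all add: P_def span_base)
  have Pform: "\<exists>l m. y = l *\<^sub>R b + m *\<^sub>R e" if "y \<in> P" for y
    using that unfolding P_def by (auto simp: span_insert algebra_simps)
  have xp: "x \<in> pos_roots" using A x by (auto simp: bipodal_def)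
  have "independent {b, e}"
  proof (rule independent_insertI)
    show "b \<notin> span {e}"
      using root_scale[OF be(1,2)] be(3) by (auto simp: span_singleton)
    show "independent {e}" using root_nonzero pos_root be by simp
  qed
  then have "dim P = 2" unfolding P_def using be(3) by (simp add: dim_eq_card_independent)
  then have md: "maximal_dihedral (generate W (reflection ` (P \<inter> roots)))"
    unfolding maximal_dihedral_def using P be by blast
  let ?H = "generate W (reflection ` (P \<inter> roots))"
  have xP: "x \<in> P" using x P by (simp add: subspace_add subspace_scale)
  have bb: "x \<noteq> b"
  proof
    assume "x = b"
    then have "q *\<^sub>R e = (1 - p) *\<^sub>R b" using x(2) by (simp add: algebra_simps)
    then have "e = ((1 - p) / q) *\<^sub>R b" using scaleR_solve1 x by blast
    from root_scale[OF be(2,1) this] show False using be(3) by simp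
  qed
  have ee: "x \<noteq> e"
  proof
    assume "x = e"
    then have "p *\<^sub>R b = (1 - q) *\<^sub>R e" using x(2) by (simp add: algebra_simps)
    then have "b = ((1 - q) / p) *\<^sub>R e" using scaleR_solve1 x by blast
    from root_scale[OF be(1,2) this] show False using be(3) by simp
  qed
  have "x \<notin> canonical_simple_system ?H"
  proof
    assume "x \<in> canonical_simple_system ?H"
    then have "\<forall>y\<in>pos_roots \<inter> P. y \<noteq> x \<longrightarrow> - mirror x y \<in> pos_roots"
      by (simp add: canonical_simple_iff[OF P(1)])
    then have n: "- mirror x b \<in> pos_roots" "- mirror x e \<in> pos_roots"
      using be(1,2) P(2,3) bb ee by auto
    have xr: "x \<in> roots" using xp pos_root by blast
    have k: "B x x = p * B x b + q * B x e" by (subst (2) x(2)) simp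
    have "- x = p *\<^sub>R b + q *\<^sub>R e - (2 * (p * B x b + q * B x e)) *\<^sub>R x"
      unfolding k[symmetric] x(2)[symmetric] root_unit[OF xr] by (simp add: scaleR_2)
    also have "\<dots> = p *\<^sub>R (- mirror x b) + q *\<^sub>R (- mirror x e)"
      by (simp add: mirror_def algebra_simps)
    finally have "- x \<in> pos_roots"
      by (rule pos_convex2[OF root_neg[OF xr] _ _ _ n]) (use x in auto)
    then show False using pos_not_neg xp by blast
  qed
  then have "A \<inter> (subgroup_pos_roots ?H - canonical_simple_system ?H) \<noteq> {}"
    using x xP xp pos_root by (auto simp: subgroup_pos_roots_def plane_subgroup_roots[OF P(1)])
  then have "canonical_simple_system ?H \<subseteq> A" using A md by (simp add: bipodal_def)
  moreover have "b \<in> canonical_simple_system ?H"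
    unfolding canonical_simple_iff[OF P(1)]
  proof (intro conjI ballI impI)
    fix y assume y: "y \<in> pos_roots \<inter> P" "y \<noteq> b"
    then obtain l m where "y = l *\<^sub>R b + m *\<^sub>R e" using Pform by blast
    then show "- mirror b y \<in> pos_roots" using simple[of y l m] y by simp
  qed (use be P in simp_all)
  ultimately show ?thesis by blast
qed

section \<open>Low elements form a Garside shadow\<close>

text \<open>
  If \<open>s b\<close> dominates \<open>g\<close>, then \<open>b\<close> dominates \<open>s g\<close>, provided that \<open>s g\<close> is positive.  The only possible
  exception \<open>g = \<alpha>\<^sub>s\<close> does not occur: \<open>w\<close> has the inversions \<open>b\<close> and \<open>\<alpha>\<^sub>s\<close>, so \<open>s w\<close> has \<open>s b\<close> but not \<open>\<alpha>\<^sub>s\<close> as an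
  inversion.
\<close>

lemma depth_step:
  assumes w: "w \<in> carrier W" and s: "s \<in> S" "\<alpha> s \<in> inversion_set w"
    and b: "b \<in> inversion_set w" "b \<noteq> \<alpha> s"
  shows "inf_depth (\<rho> s b) \<le> inf_depth b"
proof -
  have bp: "b \<in> pos_roots" using b inv_sub_pos by blast
  have sb: "\<rho> s b \<in> pos_roots" using gen_permutes_pos[OF s(1) bp b(2)] .
  have ne: "\<rho> s y \<noteq> \<alpha> s" if "y \<in> pos_roots" for y
  proof
    assume "\<rho> s y = \<alpha> s"
    then have "y = - \<alpha> s" using gen_gen_act[OF s(1), of y] act_gen_simple[OF s(1)] by simp
    then show False using pos_not_neg[OF simple_pos[OF s(1)]] that by simp
  qed
  have im: "\<rho> s ` strictly_dominated (\<rho> s b) \<subseteq> strictly_dominated b"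
  proof clarify
    fix g assume "g \<in> strictly_dominated (\<rho> s b)"
    then have g: "g \<in> pos_roots" "dominated g (\<rho> s b)" "g \<noteq> \<rho> s b"
      by (auto simp: strictly_dominated_def)
    have lift: "g \<in> inversion_set (s \<otimes> v)" if v: "v \<in> carrier W" "b \<in> inversion_set v" for v
    proof -
      have "\<rho> s b \<in> inversion_set (s \<otimes> v)"
        using inversion_left[OF v(1) s(1) sb ne[OF bp]] v s by simp
      then show ?thesis using g v s by (simp add: dominated_def)
    qed
    have gs: "g \<noteq> \<alpha> s"
      using lift[OF w b(1)] inversion_left_simple[OF w s(1)] s by blast
    have "\<rho> s g \<in> pos_roots" using gen_permutes_pos[OF s(1) g(1) gs] .
    moreover have "dominated (\<rho> s g) b"
      unfolding dominated_def using lift inversion_left[OF _ s(1) g(1) gs] by blast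
    moreover have "\<rho> s g \<noteq> b" using g(3) gen_gen_act[OF s(1), of g] by auto
    ultimately show "\<rho> s g \<in> strictly_dominated b" by (simp add: strictly_dominated_def)
  qed
  have inj: "inj_on (\<rho> s) (strictly_dominated (\<rho> s b))"
    using act_inj s by (auto simp: inj_on_def)
  show ?thesis
  proof (cases "finite (strictly_dominated b)")
    case True
    then have "finite (\<rho> s ` strictly_dominated (\<rho> s b))" using im finite_subset by blast
    then have "finite (strictly_dominated (\<rho> s b))" using inj finite_imageD by blast
    then show ?thesis using card_inj_on_le[OF inj im True] True by (simp add: inf_depth_def)
  qed (simp add: inf_depth_def)
qed

lemma low_iff:
  assumes "w \<in> carrier W"
  shows "w \<in> low_elements n \<longleftrightarrow> inversion_set w \<subseteq> cone (small_roots n \<inter> inversion_set w)"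
proof
  assume "w \<in> low_elements n"
  then obtain A where A: "A \<subseteq> small_roots n" "inversion_set w = root_cone A"
    by (auto simp: low_elements_def)
  have "A \<subseteq> inversion_set w"
    using A pos_root by (auto simp: root_cone_def small_roots_def intro: cone_base)
  then show "inversion_set w \<subseteq> cone (small_roots n \<inter> inversion_set w)"
    using A cone_mono[of A "small_roots n \<inter> inversion_set w"] by (auto simp: root_cone_def)
next
  assume "inversion_set w \<subseteq> cone (small_roots n \<inter> inversion_set w)"
  then have "inversion_set w = root_cone (small_roots n \<inter> inversion_set w)"
    using inversion_convex[OF assms] cone_mono[of "small_roots n \<inter> inversion_set w" "inversion_set w"]
      inv_sub_pos[of w] pos_root unfolding root_cone_def by blast
  then show "w \<in> low_elements n"
    using assms unfolding low_elements_def by blast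
qed

text \<open>
  The descent roots of \<open>s w\<close> are images under \<open>s\<close> of descent roots of \<open>w\<close>.  The latter are extreme, hence
  small because \<open>w\<close> is low, and \<open>s\<close> does not increase their depth.
\<close>

lemma low_suffix_step:
  assumes bip: "bipodal (small_roots n)" and w: "w \<in> carrier W" "w \<in> low_elements n"
    and s: "s \<in> S" "\<alpha> s \<in> inversion_set w"
  shows "s \<otimes> w \<in> low_elements n"
proof -
  define v where "v = s \<otimes> w"
  have v: "v \<in> carrier W" "w = s \<otimes> v" using w s by (auto simp: v_def)
  have sv: "\<alpha> s \<notin> inversion_set v" using inversion_left_simple[OF v(1) s(1)] v s by simp
  have low: "inversion_set w \<subseteq> cone (small_roots n \<inter> inversion_set w)" using w low_iff by blast
  have "inversion_set v \<subseteq> cone (small_roots n \<inter> inversion_set v)"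
  proof (rule descents_generate[OF v(1)])
    fix t assume t: "t \<in> S" "- \<rho> v (\<alpha> t) \<in> pos_roots"
    define b where "b = - \<rho> v (\<alpha> t)"
    have bv: "b \<in> inversion_set v" using inversion_right_descent(2)[OF v(1) t] by (simp add: b_def)
    have bp: "b \<in> pos_roots" "b \<noteq> \<alpha> s" using t sv bv by (auto simp: b_def)
    have sbp: "\<rho> s b \<in> pos_roots" using gen_permutes_pos[OF s(1) bp] .
    have sb: "\<rho> s b = - \<rho> w (\<alpha> t)" using v s t by (simp add: b_def act_mult)
    have sbw: "\<rho> s b \<in> inversion_set w"
      using inversion_right_descent(2)[OF w(1) t(1)] sbp sb by simp
    have "\<rho> s b \<notin> cone (inversion_set w - {\<rho> s b})"
      using descent_extreme[OF w(1) t(1) _ order.refl] sbp sb by simp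
    moreover have "\<rho> s b \<in> cone (small_roots n \<inter> inversion_set w)" using low sbw by blast
    ultimately have "\<rho> s b \<in> small_roots n"
      using cone_mono[of "small_roots n \<inter> inversion_set w" "inversion_set w - {\<rho> s b}"] by blast
    moreover have "\<rho> s b \<noteq> \<alpha> s"
    proof
      assume "\<rho> s b = \<alpha> s"
      then have "b = - \<alpha> s" using gen_gen_act[OF s(1), of b] act_gen_simple[OF s(1)] by simp
      then show False using pos_not_neg[OF simple_pos[OF s(1)]] bp by simp
    qed
    then have "inf_depth b \<le> inf_depth (\<rho> s b)"
      using depth_step[OF w(1) s sbw] s by simp
    ultimately show "- \<rho> v (\<alpha> t) \<in> small_roots n"
      using bp order.trans by (auto simp: small_roots_def b_def[symmetric])
  next
    fix x b e p q
    assume x: "x \<in> small_roots n" "x \<in> inversion_set v" "short v b" "e \<in> pos_roots"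
      "e \<notin> inversion_set v" "x = p *\<^sub>R b + q *\<^sub>R e" "0 < p" "0 < q"
    have b: "b \<in> pos_roots" "b \<noteq> e" using x inv_sub_pos by (auto simp: short_def)
    show "b \<in> small_roots n"
      using bipodalD[OF bip x(1,6-8) b(1) x(4) b(2)]
        short_plane_simple[OF v(1) x(3,2,6-8) x(4,5)] by blast
  qed
  then show ?thesis using low_iff[OF v(1)] by (simp add: v_def)
qed

theorem bipodal_garside_shadow:
  assumes bip: "bipodal (small_roots n)"
  shows "garside_shadow (low_elements n)"
  unfolding garside_shadow_def
proof (intro conjI allI impI ballI)
  show "low_elements n \<subseteq> carrier W" by (auto simp: low_elements_def)
  show "S \<subseteq> low_elements n"
  proof
    fix s assume s: "s \<in> S"
    have N: "inversion_set s = {\<alpha> s}"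
      using inversion_right(1)[of \<one> s] s simple_pos by (simp add: inversion_one)
    have "strictly_dominated (\<alpha> s) = {}"
      using s N by (force simp: strictly_dominated_def dominated_def)
    then have "\<alpha> s \<in> small_roots n"
      using simple_pos[OF s] by (simp add: small_roots_def inf_depth_def)
    then show "s \<in> low_elements n" using low_iff[of s n] s N by (auto intro: cone_base)
  qed
next
  fix X assume X: "X \<subseteq> low_elements n" "bounded_above X"
  have XW: "X \<subseteq> carrier W" using X by (auto simp: low_elements_def)
  let ?u = "\<Squnion>\<^bsub>weak_order\<^esub> X"
  note u = weak_join[OF XW X(2)]
  have "(\<Union>x\<in>X. inversion_set x) \<subseteq> cone (small_roots n \<inter> inversion_set ?u)"
  proof clarify
    fix x y assume x: "x \<in> X" "y \<in> inversion_set x"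
    then have "y \<in> cone (small_roots n \<inter> inversion_set x)" using low_iff X XW by blast
    then show "y \<in> cone (small_roots n \<inter> inversion_set ?u)"
      using cone_mono[of "small_roots n \<inter> inversion_set x" "small_roots n \<inter> inversion_set ?u"] u(2)[OF x(1)]
      by blast
  qed
  then show "?u \<in> low_elements n"
    using low_iff[OF u(1)] u(3) cone_trans by blast
next
  have step: "v \<in> low_elements n"
    if "u \<in> carrier W" "v \<in> carrier W" "u \<otimes> v \<in> low_elements n" "len (u \<otimes> v) = len u + len v" for u v
    using that
  proof (induction "len u" arbitrary: u)
    case 0
    then show ?case using len_zero by simp
  next
    case (Suc m)
    then have "u \<noteq> \<one>" by auto
    then obtain x s where x: "x \<in> carrier W" "s \<in> S" "u = s \<otimes> x" "len u = Suc (len x)"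
      using len_first Suc.prems by blast
    have e: "s \<otimes> (u \<otimes> v) = x \<otimes> v" using x Suc.prems by (simp add: m_assoc)
    have xv: "len (x \<otimes> v) \<le> len x + len v" using len_mult x Suc.prems by simp
    have c: "u \<otimes> v \<in> carrier W" using Suc.prems by simp
    have s: "\<alpha> s \<in> inversion_set (u \<otimes> v)"
    proof (rule ccontr)
      assume "\<alpha> s \<notin> inversion_set (u \<otimes> v)"
      then have "len (x \<otimes> v) = Suc (len (u \<otimes> v))"
        using left_descent(2)[OF c x(2)] unfolding e by blast
      then show False using xv x(4) Suc.prems(4) by simp
    qed
    then have "len (x \<otimes> v) = len x + len v" using left_descent(1)[OF c x(2)] Suc.prems x e by simp
    moreover have "x \<otimes> v \<in> low_elements n"
      using low_suffix_step[OF bip c Suc.prems(3) x(2) s] e by simp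
    ultimately show ?case using Suc.hyps x Suc.prems by simp
  qed
  fix w v assume "w \<in> low_elements n" "suffix v w"
  then show "v \<in> low_elements n" using step by (auto simp: suffix_def)
qed

lemma finite_low:
  assumes "finite (small_roots n)"
  shows "finite (low_elements n)"
proof (rule finite_imageD)
  show "inj_on inversion_set (low_elements n)"
    using inversion_inj by (auto simp: inj_on_def low_elements_def)
  have "inversion_set ` low_elements n \<subseteq> root_cone ` Pow (small_roots n)"
    by (auto simp: low_elements_def)
  then show "finite (inversion_set ` low_elements n)" using assms finite_subset by blast
qed

end

section \<open>Affine hyperplane arrangements\<close>

locale affine_arrangement =
  fixes R :: "'e::euclidean_space set" and C :: "'e set" and x0 :: 'e
  assumes crystallographic: "crystallographic_root_system R"
    and alcove: "C \<in> alcoves R"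
    and base_point: "x0 \<in> C"
begin

text \<open>
  Up to sign, the pair \<open>(a, k)\<close> stands for both a hyperplane and an affine function vanishing on it.
\<close>

definition ev :: "'e \<Rightarrow> int \<Rightarrow> 'e \<Rightarrow> real" where
  "ev a k x = a \<bullet> x - real_of_int k"

definition generic :: "'e \<Rightarrow> bool" where
  "generic x \<longleftrightarrow> (\<forall>a\<in>R. \<forall>k. ev a k x \<noteq> 0)"

definition same_side :: "'e \<Rightarrow> 'e \<Rightarrow> bool" where
  "same_side x y \<longleftrightarrow> (\<forall>a\<in>R. \<forall>k. ev a k x * ev a k y > 0)"

definition wall :: "'e \<Rightarrow> int \<Rightarrow> bool" where
  "wall a k \<longleftrightarrow> affine hull (affine_hyperplane a k \<inter> closure C) = affine_hyperplane a k"

lemma finite_R: "finite R" and zero_R: "0 \<notin> R"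
  using crystallographic by (auto simp: crystallographic_root_system_def)

lemma nonzero_R: "a \<in> R \<Longrightarrow> a \<noteq> 0"
  using zero_R by blast

lemma refl_R: "a \<in> R \<Longrightarrow> b \<in> R \<Longrightarrow> b - (2 * (a \<bullet> b) / (a \<bullet> a)) *\<^sub>R a \<in> R"
  using crystallographic unfolding crystallographic_root_system_def by blast

lemma neg_R: "a \<in> R \<Longrightarrow> - a \<in> R"
  using refl_R[of a a] nonzero_R[of a] by (simp add: scaleR_2)

lemma reduced_R: "a \<in> R \<Longrightarrow> c *\<^sub>R a \<in> R \<Longrightarrow> c = 1 \<or> c = -1"
  using crystallographic unfolding crystallographic_root_system_def by blast

lemma cartan_int:
  assumes "a \<in> R" "b \<in> R"
  obtains n :: int where "2 * (a \<bullet> b) / (a \<bullet> a) = real_of_int n"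
  using crystallographic assms unfolding crystallographic_root_system_def Ints_def by blast

definition cartan :: "'e \<Rightarrow> 'e \<Rightarrow> int" where
  "cartan a b = \<lfloor>2 * (a \<bullet> b) / (a \<bullet> a)\<rfloor>"

lemma cartan: "a \<in> R \<Longrightarrow> b \<in> R \<Longrightarrow> real_of_int (cartan a b) = 2 * (a \<bullet> b) / (a \<bullet> a)"
  using cartan_int[of a b] by (metis cartan_def floor_of_int)

lemma cartan_R: "a \<in> R \<Longrightarrow> b \<in> R \<Longrightarrow> b - real_of_int (cartan a b) *\<^sub>R a \<in> R"
  using refl_R[of a b] by (simp add: cartan)

lemma ev_neg: "ev (- a) (- k) x = - ev a k x"
  by (simp add: ev_def)

lemma refl_neg: "affine_reflection (- a) (- k) = affine_reflection a k"
proof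
  fix x
  have "2 * (- (a \<bullet> x) - - real_of_int k) / (a \<bullet> a) = - (2 * (a \<bullet> x - real_of_int k) / (a \<bullet> a))"
    by (simp add: divide_simps)
  then show "affine_reflection (- a) (- k) x = affine_reflection a k x"
    by (simp add: affine_reflection_def)
qed

lemma ev_refl:
  assumes "b \<in> R" "a \<in> R"
  shows "ev a k (affine_reflection b l x) = ev (a - real_of_int (cartan b a) *\<^sub>R b) (k - cartan b a * l) x"
proof -
  have "a \<bullet> affine_reflection b l x = a \<bullet> x - (2 * (b \<bullet> a) / (b \<bullet> b)) * (b \<bullet> x - real_of_int l)"
    by (simp add: affine_reflection_def inner_diff_right inner_commute[of a b])
  then show ?thesis
    unfolding ev_def cartan[OF assms, symmetric] by (simp add: inner_diff_left algebra_simps)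
qed

lemma ev_refl_self: "a \<in> R \<Longrightarrow> ev a k (affine_reflection a k x) = - ev a k x"
  using nonzero_R[of a] by (simp add: ev_def affine_reflection_def inner_diff_right)

lemma refl_fix: "ev a k x = 0 \<Longrightarrow> affine_reflection a k x = x"
  by (simp add: ev_def affine_reflection_def)

lemma refl_refl: "a \<in> R \<Longrightarrow> affine_reflection a k (affine_reflection a k x) = x"
  using nonzero_R[of a] by (simp add: affine_reflection_def inner_diff_right algebra_simps diff_divide_distrib)

lemma refl_conj:
  assumes "b \<in> R" "a \<in> R"
  shows "affine_reflection a k (affine_reflection b l x) =
    affine_reflection b l (affine_reflection (a - real_of_int (cartan b a) *\<^sub>R b) (k - cartan b a * l) x)"
proof -
  define a' where "a' = a - real_of_int (cartan b a) *\<^sub>R b"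
  have nb: "b \<bullet> b \<noteq> 0" using nonzero_R assms by auto
  have lin: "affine_reflection b l (y - t *\<^sub>R a') = affine_reflection b l y - t *\<^sub>R a" for y t
  proof -
    have "b \<bullet> a' = - (b \<bullet> a)"
      using nb by (simp add: a'_def cartan[OF assms] inner_diff_right)
    then have "affine_reflection b l (y - t *\<^sub>R a') =
        affine_reflection b l y - t *\<^sub>R a' - (t * (2 * (b \<bullet> a) / (b \<bullet> b))) *\<^sub>R b"
      by (simp add: affine_reflection_def inner_diff_right algebra_simps diff_divide_distrib add_divide_distrib)
    then show ?thesis
      by (simp add: a'_def cartan[OF assms] algebra_simps)
  qed
  have "a' \<bullet> a' = a \<bullet> a"
    using nb by (simp add: a'_def cartan[OF assms] inner_diff_right inner_diff_left inner_commute[of a b] field_simps)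
  then have "affine_reflection a' (k - cartan b a * l) x =
      x - (2 * ev a k (affine_reflection b l x) / (a \<bullet> a)) *\<^sub>R a'"
    unfolding ev_refl[OF assms] by (simp add: affine_reflection_def ev_def a'_def)
  then show ?thesis
    by (simp add: a'_def[symmetric] lin) (simp add: affine_reflection_def[of a] ev_def)
qed

lemma generic_refl:
  assumes "b \<in> R" "generic x"
  shows "generic (affine_reflection b l x)"
  using assms cartan_R[of b] by (auto simp: generic_def ev_refl)

text \<open>
  Since \<open>R\<close> is reduced, the pair \<open>(a, k)\<close> is determined by the hyperplane up to sign.
\<close>

lemma refl_eq:
  assumes ab: "a \<in> R" "b \<in> R" and eq: "affine_reflection a k = affine_reflection b l"
  shows "b = a \<and> l = k \<or> b = - a \<and> l = - k"
proof -
  have na: "a \<noteq> 0" "b \<noteq> 0" using ab nonzero_R by auto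
  define x where "x = ((real_of_int l + 1) / (b \<bullet> b)) *\<^sub>R b"
  have bx: "b \<bullet> x - real_of_int l = 1" using na by (simp add: x_def)
  have "x - (2 * (a \<bullet> x - real_of_int k) / (a \<bullet> a)) *\<^sub>R a = x - (2 / (b \<bullet> b)) *\<^sub>R b"
    using fun_cong[OF eq, of x] bx by (simp add: affine_reflection_def)
  then have "(2 / (b \<bullet> b)) *\<^sub>R b = (2 * (a \<bullet> x - real_of_int k) / (a \<bullet> a)) *\<^sub>R a" by simp
  then have "b = ((2 * (a \<bullet> x - real_of_int k) / (a \<bullet> a)) / (2 / (b \<bullet> b))) *\<^sub>R a"
    by (rule scaleR_solve1) (use na in simp)
  then have "b = a \<or> b = - a" using reduced_R[OF ab(1)] ab(2) by (metis scaleR_minus1_left scaleR_one)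
  moreover
  define y where "y = (real_of_int k / (a \<bullet> a)) *\<^sub>R a"
  have ay: "a \<bullet> y = real_of_int k" using na by (simp add: y_def)
  have "affine_reflection b l y = y" using fun_cong[OF eq, of y] ay by (simp add: affine_reflection_def)
  then have "b \<bullet> y = real_of_int l" using na by (simp add: affine_reflection_def)
  ultimately show ?thesis using ay by auto
qed

lemma hyperplane_subset:
  assumes "a \<in> R" "b \<in> R" "affine_hyperplane a k \<subseteq> affine_hyperplane b l"
  shows "b = a \<and> l = k \<or> b = - a \<and> l = - k"
proof -
  have na: "a \<noteq> 0" "b \<noteq> 0" using assms nonzero_R by auto
  define y where "y = (real_of_int k / (a \<bullet> a)) *\<^sub>R a"
  have ay: "a \<bullet> y = real_of_int k" using na by (simp add: y_def)
  then have byl: "b \<bullet> y = real_of_int l" using assms(3) by (auto simp: affine_hyperplane_def)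
  define v where "v = b - ((a \<bullet> b) / (a \<bullet> a)) *\<^sub>R a"
  have av: "a \<bullet> v = 0" using na by (simp add: v_def inner_diff_right)
  then have "y + v \<in> affine_hyperplane a k" using ay by (simp add: affine_hyperplane_def inner_add_right)
  then have "y + v \<in> affine_hyperplane b l" using assms(3) by blast
  then have "b \<bullet> (y + v) = real_of_int l" by (simp add: affine_hyperplane_def)
  then have "b \<bullet> v = 0" using byl by (simp add: inner_add_right)
  then have "v \<bullet> v = 0" using av by (simp add: v_def inner_diff_left)
  then have "b = ((a \<bullet> b) / (a \<bullet> a)) *\<^sub>R a" by (simp add: v_def)
  then have "b = a \<or> b = - a" using reduced_R[OF assms(1)] assms(2) by (metis scaleR_minus1_left scaleR_one)
  then show ?thesis using ay byl by auto
qed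

lemma ev_zero_iff: "ev a k x = 0 \<longleftrightarrow> x \<in> affine_hyperplane a k"
  by (simp add: ev_def affine_hyperplane_def)

subsection \<open>The base alcove\<close>

definition base :: "'e \<Rightarrow> int" where
  "base a = \<lfloor>a \<bullet> x0\<rfloor>"

lemma C_component: "C = connected_component_set (- (\<Union>a\<in>R. \<Union>k. affine_hyperplane a k)) x0"
  using alcove base_point unfolding alcoves_def components_def
  by (metis (no_types, lifting) connected_component_eq imageE)

lemma generic_base: "generic x0"
proof -
  have "C \<subseteq> - (\<Union>a\<in>R. \<Union>k. affine_hyperplane a k)"
    unfolding C_component by (rule connected_component_subset)
  then show ?thesis using base_point by (auto simp: generic_def ev_zero_iff)
qed

lemma base_less: "a \<in> R \<Longrightarrow> real_of_int (base a) < a \<bullet> x0"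
proof -
  assume "a \<in> R"
  then have "ev a (base a) x0 \<noteq> 0" using generic_base by (simp add: generic_def)
  moreover have "real_of_int (base a) \<le> a \<bullet> x0" unfolding base_def by (rule of_int_floor_le)
  ultimately show ?thesis unfolding ev_def by linarith
qed

lemma base_neg: "a \<in> R \<Longrightarrow> base (- a) = - base a - 1"
  using base_less[of a] base_less[of "- a"] neg_R[of a] floor_correct[of "a \<bullet> x0"]
  by (simp add: base_def floor_minus ceiling_altdef)

lemma same_side_base_iff: "same_side x0 x \<longleftrightarrow> (\<forall>a\<in>R. real_of_int (base a) < a \<bullet> x)"
proof
  assume s: "same_side x0 x"
  show "\<forall>a\<in>R. real_of_int (base a) < a \<bullet> x"
  proof
    fix a assume a: "a \<in> R"
    then have "0 < ev a (base a) x0 * ev a (base a) x" using s by (simp add: same_side_def)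
    then show "real_of_int (base a) < a \<bullet> x"
      using base_less[OF a] by (simp add: ev_def zero_less_mult_iff)
  qed
next
  assume s: "\<forall>a\<in>R. real_of_int (base a) < a \<bullet> x"
  show "same_side x0 x"
    unfolding same_side_def
  proof (intro ballI allI)
    fix a k assume a: "a \<in> R"
    show "0 < ev a k x0 * ev a k x"
    proof (cases "k \<le> base a")
      case True
      then have "real_of_int k \<le> real_of_int (base a)" by simp
      then have "0 < ev a k x0" "0 < ev a k x" using base_less[OF a] bspec[OF s a] by (auto simp: ev_def)
      then show ?thesis by simp
    next
      case False
      then have "- k \<le> base (- a)" using base_neg[OF a] by simp
      then have "real_of_int (- k) \<le> real_of_int (base (- a))" by (simp only: of_int_le_iff)
      then have "0 < ev (- a) (- k) x0" "0 < ev (- a) (- k) x"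
        using base_less[OF neg_R[OF a]] bspec[OF s neg_R[OF a]] by (auto simp: ev_def)
      then show ?thesis unfolding ev_neg by (simp add: zero_less_mult_iff)
    qed
  qed
qed

text \<open>
  All integral translates of a hyperplane are in the arrangement and \<open>R = - R\<close>, so the walls that can bound
  \<open>C\<close> have the form \<open>a \<bullet> x = base a\<close>.
\<close>

lemma alcove_eq: "C = {x. \<forall>a\<in>R. real_of_int (base a) < a \<bullet> x}" (is "_ = ?D")
proof
  have cv: "convex ?D"
  proof -
    have "?D = (\<Inter>a\<in>R. {x. real_of_int (base a) < a \<bullet> x})" by blast
    then show ?thesis by (simp add: convex_halfspace_gt convex_INT)
  qed
  have "?D \<subseteq> - (\<Union>a\<in>R. \<Union>k. affine_hyperplane a k)"
  proof
    fix x assume "x \<in> ?D"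
    then have "same_side x0 x" by (simp add: same_side_base_iff)
    then have "ev a k x \<noteq> 0" if "a \<in> R" for a k
      using that unfolding same_side_def by (metis less_irrefl mult_zero_right)
    then show "x \<in> - (\<Union>a\<in>R. \<Union>k. affine_hyperplane a k)" by (simp add: ev_zero_iff)
  qed
  then show "?D \<subseteq> C"
    unfolding C_component using base_less by (intro connected_component_maximal convex_connected cv) auto
  show "C \<subseteq> ?D"
  proof clarify
    fix x a assume x: "x \<in> C" and a: "a \<in> R"
    have cc: "connected C" unfolding C_component by simp
    have sub: "C \<subseteq> - (\<Union>a\<in>R. \<Union>k. affine_hyperplane a k)"
      unfolding C_component by (rule connected_component_subset)
    show "real_of_int (base a) < a \<bullet> x"
    proof (rule ccontr)
      assume "\<not> ?thesis"
      then obtain z where "z \<in> C" "a \<bullet> z = real_of_int (base a)"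
        using connected_ivt_hyperplane[OF cc x base_point, of a "real_of_int (base a)"] base_less[OF a] by auto
      then show False using sub a by (auto simp: affine_hyperplane_def)
    qed
  qed
qed

lemma closure_alcove: "x \<in> closure C \<Longrightarrow> a \<in> R \<Longrightarrow> real_of_int (base a) \<le> a \<bullet> x"
proof -
  assume x: "x \<in> closure C" and a: "a \<in> R"
  have "closure C \<subseteq> {x. real_of_int (base a) \<le> a \<bullet> x}"
    using a by (intro closure_minimal closed_halfspace_ge) (auto simp: alcove_eq intro: less_imp_le)
  then show ?thesis using x by blast
qed

subsection \<open>Walls\<close>

text \<open>
  No other hyperplane contains the part of \<open>closure C\<close> on the wall.  Averaging points off the finitely many
  relevant hyperplanes gives one that is off all of them.
\<close>

lemma wall_point:
  assumes a: "a \<in> R" and w: "wall a k"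
  obtains z where "ev a k z = 0"
    "\<And>b. b \<in> R \<Longrightarrow> affine_hyperplane b (base b) \<noteq> affine_hyperplane a k \<Longrightarrow> real_of_int (base b) < b \<bullet> z"
    "z \<in> closure C"
proof -
  let ?H = "affine_hyperplane a k"
  let ?K = "?H \<inter> closure C"
  have cK: "convex ?K"
    unfolding affine_hyperplane_def alcove_eq
  proof (intro convex_Int convex_closure)
    have "{x. \<forall>a\<in>R. real_of_int (base a) < a \<bullet> x} = (\<Inter>a\<in>R. {x. real_of_int (base a) < a \<bullet> x})" by blast
    then show "convex {x. \<forall>a\<in>R. real_of_int (base a) < a \<bullet> x}"
      by (simp add: convex_halfspace_gt convex_INT)
  qed (rule convex_hyperplane)
  have hull: "affine hull ?K = ?H" using w by (simp add: wall_def)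
  have "(real_of_int k / (a \<bullet> a)) *\<^sub>R a \<in> ?H" using nonzero_R[OF a] by (simp add: affine_hyperplane_def)
  then have ne: "?K \<noteq> {}" using hull by force
  \<comment> \<open>the hyperplanes other than the wall that can touch the closure of the alcove\<close>
  define Q where "Q = {b \<in> R. affine_hyperplane b (base b) \<noteq> ?H}"
  have "\<exists>z\<in>?K. \<forall>b\<in>Q'. real_of_int (base b) < b \<bullet> z" if "finite Q'" "Q' \<subseteq> Q" for Q'
    using that
  proof (induction Q' rule: finite_induct)
    case empty
    then show ?case using ne by blast
  next
    case (insert b Q')
    then obtain z where z: "z \<in> ?K" "\<forall>b\<in>Q'. real_of_int (base b) < b \<bullet> z" by auto
    have b: "b \<in> R" "affine_hyperplane b (base b) \<noteq> ?H" using insert by (auto simp: Q_def)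
    have "\<not> ?K \<subseteq> affine_hyperplane b (base b)"
    proof
      assume "?K \<subseteq> affine_hyperplane b (base b)"
      then have "?H \<subseteq> affine_hyperplane b (base b)"
        using hull_minimal[of ?K "affine_hyperplane b (base b)" affine] hull
        by (simp add: affine_hyperplane_def Affine.affine_hyperplane)
      then have "b = a \<and> base b = k \<or> b = - a \<and> base b = - k" by (rule hyperplane_subset[OF a b(1)])
      then show False using b(2) by (auto simp: affine_hyperplane_def)
    qed
    then obtain y where y: "y \<in> ?K" "b \<bullet> y \<noteq> real_of_int (base b)" by (auto simp: affine_hyperplane_def)
    define m where "m = (1 / 2) *\<^sub>R z + (1 / 2) *\<^sub>R y"
    have mK: "m \<in> ?K" unfolding m_def using convexD[OF cK z(1) y(1), of "1/2" "1/2"] by simp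
    have bm: "c \<bullet> m = (c \<bullet> z + c \<bullet> y) / 2" for c by (simp add: m_def inner_add_right)
    have ge: "real_of_int (base c) \<le> c \<bullet> z" "real_of_int (base c) \<le> c \<bullet> y" if "c \<in> R" for c
      using closure_alcove that z(1) y(1) by auto
    have "real_of_int (base c) < c \<bullet> m" if c: "c \<in> insert b Q'" for c
    proof -
      have cR: "c \<in> R" using c insert b by (auto simp: Q_def)
      have "real_of_int (base c) < c \<bullet> z \<or> real_of_int (base c) < c \<bullet> y"
        using c z(2) y(2) ge[OF b(1)] by auto
      then show ?thesis unfolding bm using ge[OF cR] by argo
    qed
    then show ?case using mK by blast
  qed
  from this[of Q] obtain z where z: "z \<in> ?K" "\<forall>b\<in>Q. real_of_int (base b) < b \<bullet> z"
    using finite_R by (auto simp: Q_def)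
  show ?thesis
  proof (rule that[of z])
    show "ev a k z = 0" using z by (simp add: ev_zero_iff)
    show "z \<in> closure C" using z by blast
    show "real_of_int (base b) < b \<bullet> z"
      if "b \<in> R" "affine_hyperplane b (base b) \<noteq> affine_hyperplane a k" for b
      using z that by (simp add: Q_def)
  qed
qed

text \<open>
  Near the point \<open>z\<close> of the wall, the alcove and its mirror image are separated by the wall alone; so the
  signs at both base points agree with those at \<open>z\<close>, for every other hyperplane.
\<close>

lemma wall_separates_only:
  assumes a: "a \<in> R" "wall a k" and b: "b \<in> R" "affine_hyperplane b l \<noteq> affine_hyperplane a k"
  shows "0 < ev b l x0 * ev b l (affine_reflection a k x0)"
proof -
  obtain z where z: "ev a k z = 0" "z \<in> closure C"
    "\<And>b. b \<in> R \<Longrightarrow> affine_hyperplane b (base b) \<noteq> affine_hyperplane a k \<Longrightarrow> real_of_int (base b) < b \<bullet> z"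
    using wall_point[OF a] by metis
  have pos: "0 < ev c m x0 \<and> 0 < ev c m z"
    if c: "c \<in> R" "affine_hyperplane c m \<noteq> affine_hyperplane a k" "m \<le> base c" for c m
  proof -
    have "real_of_int m \<le> real_of_int (base c)" using c by simp
    moreover have "real_of_int m < c \<bullet> z"
    proof (cases "m = base c")
      case True
      then show ?thesis using z(3) c by simp
    next
      case False
      then have "real_of_int m < real_of_int (base c)" using c by simp
      then show ?thesis using closure_alcove[OF z(2) c(1)] by simp
    qed
    ultimately show ?thesis using base_less[OF c(1)] by (simp add: ev_def)
  qed
  have same: "0 < ev c m x0 * ev c m z"
    if c: "c \<in> R" "affine_hyperplane c m \<noteq> affine_hyperplane a k" for c m
  proof (cases "m \<le> base c")
    case True
    then show ?thesis using pos c by simp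
  next
    case False
    then have le: "- m \<le> base (- c)" using base_neg[OF c(1)] by simp
    have "affine_hyperplane (- c) (- m) = affine_hyperplane c m" by (simp add: affine_hyperplane_def)
    then have "0 < ev (- c) (- m) x0 \<and> 0 < ev (- c) (- m) z" using pos[OF neg_R[OF c(1)] _ le] c by simp
    then show ?thesis unfolding ev_neg by (simp add: zero_less_mult_iff)
  qed
  define b' where "b' = b - real_of_int (cartan a b) *\<^sub>R a"
  define l' where "l' = l - cartan a b * k"
  have ev': "ev b l (affine_reflection a k x) = ev b' l' x" for x
    unfolding b'_def l'_def by (rule ev_refl[OF a(1) b(1)])
  have b'R: "b' \<in> R" unfolding b'_def by (rule cartan_R[OF a(1) b(1)])
  have "affine_hyperplane b' l' \<noteq> affine_hyperplane a k"
  proof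
    assume e: "affine_hyperplane b' l' = affine_hyperplane a k"
    have "affine_hyperplane a k \<subseteq> affine_hyperplane b l"
    proof
      fix x assume x: "x \<in> affine_hyperplane a k"
      then have "affine_reflection a k x = x" using refl_fix by (simp add: ev_zero_iff)
      moreover have "ev b' l' x = 0" unfolding ev_zero_iff e by (rule x)
      ultimately show "x \<in> affine_hyperplane b l" using ev'[of x] by (simp add: ev_zero_iff[symmetric])
    qed
    then have "b = a \<and> l = k \<or> b = - a \<and> l = - k" using hyperplane_subset a b by blast
    then show False using b(2) by (auto simp: affine_hyperplane_def)
  qed
  then have "0 < ev b' l' x0 * ev b' l' z" using same b'R by blast
  moreover have "ev b' l' z = ev b l z" using ev'[of z] refl_fix z(1) by simp
  ultimately show ?thesis using same[OF b] by (auto simp: ev' zero_less_mult_iff)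
qed

text \<open>
  Describe \<open>C\<close> by as few of the inequalities \<open>base a < a \<bullet> x\<close> as possible.  Each of them is then
  indispensable, so its hyperplane contains a relatively open piece of the boundary and is a wall; and
  \<open>x\<close> violates one of them.
\<close>

lemma separating_wall:
  assumes x: "generic x" "\<not> same_side x0 x"
  obtains a k where "a \<in> R" "wall a k" "0 < ev a k x0" "ev a k x < 0"
proof -
  define QQ where "QQ = {Q. Q \<subseteq> R \<and> {y. \<forall>a\<in>Q. real_of_int (base a) < a \<bullet> y} = C}"
  have "R \<in> QQ" using alcove_eq by (simp add: QQ_def)
  then obtain Q where QQ: "Q \<in> QQ" and Qmin: "\<And>Q'. Q' \<in> QQ \<Longrightarrow> card Q \<le> card Q'"
    using ex_has_least_nat[of "\<lambda>Q. Q \<in> QQ" R card] by blast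
  have Q: "Q \<subseteq> R" "{y. \<forall>a\<in>Q. real_of_int (base a) < a \<bullet> y} = C" using QQ by (auto simp: QQ_def)
  have fQ: "finite Q" using Q finite_R finite_subset by blast
  have "x \<notin> C" using x(2) by (simp add: same_side_base_iff alcove_eq)
  then obtain a where a: "a \<in> Q" "\<not> real_of_int (base a) < a \<bullet> x" using Q by blast
  have aR: "a \<in> R" using a Q by blast
  let ?H = "affine_hyperplane a (base a)"
  define T where "T = {y. \<forall>b\<in>Q - {a}. real_of_int (base b) < b \<bullet> y}"
  have "T \<noteq> C"
  proof
    assume "T = C"
    then have "Q - {a} \<in> QQ" using Q by (auto simp: QQ_def T_def)
    then show False using Qmin[of "Q - {a}"] card_Diff1_less[OF fQ a(1)] by simp
  qed
  moreover have "C \<subseteq> T" using Q by (auto simp: T_def)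
  ultimately obtain y where y: "y \<in> T" "y \<notin> C" by blast
  have ay: "a \<bullet> y \<le> real_of_int (base a)"
  proof (rule ccontr)
    assume "\<not> ?thesis"
    then have "\<forall>b\<in>Q. real_of_int (base b) < b \<bullet> y" using y by (auto simp: T_def)
    then show False using Q y by blast
  qed
  have oT: "x0 \<in> T" using base_less Q by (auto simp: T_def)
  have mixT: "(1 - t) *\<^sub>R u + t *\<^sub>R v \<in> T" if "u \<in> T" "v \<in> T" "0 \<le> t" "t \<le> 1" for u v t
  proof -
    have "T = (\<Inter>b\<in>Q - {a}. {y. real_of_int (base b) < b \<bullet> y})" by (auto simp: T_def)
    then have "convex T" by (simp add: convex_halfspace_gt convex_INT)
    then show ?thesis using that by (intro convexD) auto
  qed
  have ao: "real_of_int (base a) < a \<bullet> x0" using base_less aR by blast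
  define t where "t = (a \<bullet> x0 - real_of_int (base a)) / (a \<bullet> x0 - a \<bullet> y)"
  have t: "0 \<le> t" "t \<le> 1" using ao ay by (auto simp: t_def divide_simps)
  define z where "z = (1 - t) *\<^sub>R x0 + t *\<^sub>R y"
  have zT: "z \<in> T" unfolding z_def using mixT oT y t by blast
  have "t * (a \<bullet> x0 - a \<bullet> y) = a \<bullet> x0 - real_of_int (base a)" using ao ay by (simp add: t_def)
  then have zH: "z \<in> ?H" by (simp add: z_def affine_hyperplane_def inner_add_right algebra_simps)
  have opT: "open T"
  proof -
    have "T = (\<Inter>b\<in>Q - {a}. {y. real_of_int (base b) < b \<bullet> y})" by (auto simp: T_def)
    then show ?thesis using fQ by (auto intro!: open_INT open_halfspace_gt)
  qed
  have HT: "?H \<inter> T \<subseteq> closure C"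
  proof
    fix v assume v: "v \<in> ?H \<inter> T"
    show "v \<in> closure C"
      unfolding closure_approachable
    proof (intro allI impI)
      fix e :: real assume e: "0 < e"
      define d where "d = min 1 (e / (2 * (norm (x0 - v) + 1)))"
      have nn: "0 < norm (x0 - v) + 1" using norm_ge_zero[of "x0 - v"] by linarith
      have d: "0 < d" "d \<le> 1" using e nn by (auto simp: d_def)
      define u where "u = (1 - d) *\<^sub>R v + d *\<^sub>R x0"
      have "u \<in> T" unfolding u_def using mixT v oT d by auto
      moreover have "a \<bullet> u = real_of_int (base a) + d * (a \<bullet> x0 - real_of_int (base a))"
        using v by (simp add: u_def affine_hyperplane_def inner_add_right algebra_simps)
      then have "real_of_int (base a) < a \<bullet> u" using d ao by simp
      ultimately have "u \<in> C" using Q(2) by (auto simp: T_def)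
      moreover have "dist u v < e"
      proof -
        have "u - v = d *\<^sub>R (x0 - v)" by (simp add: u_def algebra_simps)
        then have "dist u v = d * norm (x0 - v)" using d by (simp add: dist_norm)
        also have "\<dots> \<le> (e / (2 * (norm (x0 - v) + 1))) * norm (x0 - v)"
          by (intro mult_right_mono) (auto simp: d_def)
        also have "\<dots> = e * (norm (x0 - v) / (2 * (norm (x0 - v) + 1)))" by simp
        also have "\<dots> < e * 1"
        proof (rule mult_strict_left_mono[OF _ e])
          have "norm (x0 - v) < 2 * (norm (x0 - v) + 1)" using norm_ge_zero[of "x0 - v"] by argo
          then show "norm (x0 - v) / (2 * (norm (x0 - v) + 1)) < 1" using nn by (simp add: divide_less_eq)
        qed
        also have "\<dots> = e" by simp
        finally show ?thesis .
      qed
      ultimately show "\<exists>y\<in>C. dist y v < e" by blast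
    qed
  qed
  have aff: "affine ?H" by (simp add: affine_hyperplane_def Affine.affine_hyperplane)
  have "?H \<inter> T \<noteq> {}" using zT zH by auto
  then have "affine hull (?H \<inter> T) = ?H" using affine_hull_affine_Int_open[OF aff opT] aff by (simp add: affine_hull_eq)
  moreover have "affine hull (?H \<inter> T) \<subseteq> affine hull (?H \<inter> closure C)"
    by (rule hull_mono) (use HT in simp)
  moreover have "affine hull (?H \<inter> closure C) \<subseteq> ?H"
    using aff by (intro hull_minimal) auto
  ultimately have "wall a (base a)" by (simp add: wall_def)
  moreover have "ev a (base a) x \<noteq> 0" using x(1) aR by (simp add: generic_def)
  then have "ev a (base a) x < 0" using a(2) unfolding ev_def by argo
  moreover have "0 < ev a (base a) x0" using ao by (simp add: ev_def)
  ultimately show ?thesis using that aR by blast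
qed

lemma generic_dense:
  assumes "open U" "U \<noteq> {}"
  obtains x where "x \<in> U" "generic x"
proof -
  let ?Z = "\<Union>a\<in>R. \<Union>k::int. {x. a \<bullet> x = real_of_int k}"
  have "negligible ?Z"
  proof (rule negligible_Union[of "(\<lambda>a. \<Union>k::int. {x. a \<bullet> x = real_of_int k}) ` R", simplified])
    show "finite ((\<lambda>a. \<Union>k::int. {x. a \<bullet> x = real_of_int k}) ` R)" using finite_R by simp
    fix T assume "T \<in> (\<lambda>a. \<Union>k::int. {x. a \<bullet> x = real_of_int k}) ` R"
    then obtain a where a: "a \<in> R" "T = (\<Union>k::int. {x. a \<bullet> x = real_of_int k})" by blast
    show "negligible T" unfolding a(2)
      by (rule negligible_countable_Union) (use nonzero_R[OF a(1)] in \<open>auto simp: negligible_hyperplane\<close>)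
  qed
  then have "\<not> U \<subseteq> ?Z" using assms open_not_negligible negligible_subset by blast
  then obtain x where "x \<in> U" "x \<notin> ?Z" by blast
  then show ?thesis using that[of x] by (auto simp: generic_def ev_def)
qed

subsection \<open>Separating hyperplanes\<close>

definition sep :: "'e \<Rightarrow> ('e \<times> int) set" where
  "sep x = {(a, k). a \<in> R \<and> 0 < ev a k x0 \<and> ev a k x < 0}"

lemma finite_sep: "finite (sep x)"
proof (rule finite_subset)
  show "sep x \<subseteq> (SIGMA a:R. {\<lfloor>a \<bullet> x\<rfloor>..\<lceil>a \<bullet> x0\<rceil>})"
    by (auto simp: sep_def ev_def) linarith+
qed (use finite_R in auto)

text \<open>
  Reflecting in a separating wall permutes the other hyperplanes and keeps the side on which the base
  alcove lies, so the wall itself is all that is lost.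
\<close>

lemma sep_wall_reflection:
  assumes a: "a \<in> R" "wall a k" "0 < ev a k x0" "ev a k x < 0"
  shows "card (sep (affine_reflection a k x)) < card (sep x)"
proof -
  define f where "f = (\<lambda>(b, l). (b - real_of_int (cartan a b) *\<^sub>R a, l - cartan a b * k))"
  have im: "f ` sep (affine_reflection a k x) \<subseteq> sep x - {(a, k)}"
  proof (rule image_subsetI)
    fix c assume c: "c \<in> sep (affine_reflection a k x)"
    obtain b l where bl: "c = (b, l)" by (cases c)
    have b: "b \<in> R" "0 < ev b l x0" "ev b l (affine_reflection a k x) < 0"
      using c bl by (auto simp: sep_def)
    have ne: "affine_hyperplane b l \<noteq> affine_hyperplane a k"
    proof
      assume "affine_hyperplane b l = affine_hyperplane a k"
      then have "b = a \<and> l = k \<or> b = - a \<and> l = - k" using hyperplane_subset[OF a(1) b(1)] by blast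
      then show False using b a ev_refl_self[OF a(1), of k x] ev_neg[of a k] by auto
    qed
    have "0 < ev b l (affine_reflection a k x0)"
      using wall_separates_only[OF a(1,2) b(1) ne] b(2) by (simp add: zero_less_mult_iff)
    then have "f (b, l) \<in> sep x"
      using b cartan_R[OF a(1) b(1)] by (simp add: f_def sep_def ev_refl[OF a(1) b(1)])
    moreover have "f (b, l) \<noteq> (a, k)"
    proof
      assume e: "f (b, l) = (a, k)"
      have "ev b l (affine_reflection a k y) = ev a k y" for y
        using e by (simp add: f_def ev_refl[OF a(1) b(1)])
      from this[of "affine_reflection a k x0"] have "ev b l x0 = - ev a k x0"
        by (simp add: refl_refl[OF a(1)] ev_refl_self[OF a(1)])
      then show False using b a by simp
    qed
    ultimately show "f c \<in> sep x - {(a, k)}" using bl by blast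
  qed
  have inj: "inj_on f (sep (affine_reflection a k x))"
  proof (rule inj_onI, clarify)
    fix b l c m
    assume bc: "(b, l) \<in> sep (affine_reflection a k x)" "(c, m) \<in> sep (affine_reflection a k x)"
      and e: "f (b, l) = f (c, m)"
    then have R: "b \<in> R" "c \<in> R" by (auto simp: sep_def)
    have "ev b l y = ev c m y" for y
    proof -
      have "ev b l (affine_reflection a k z) = ev c m (affine_reflection a k z)" for z
        using e by (simp add: f_def ev_refl[OF a(1)] R)
      from this[of "affine_reflection a k y"] show ?thesis by (simp add: refl_refl[OF a(1)])
    qed
    note eq = this
    have "l = m" using eq[of 0] by (simp add: ev_def)
    moreover have "b = c"
    proof -
      have "(b - c) \<bullet> (b - c) = 0"
        using eq[of "b - c"] eq[of 0] by (simp add: ev_def inner_diff_left)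
      then show ?thesis by simp
    qed
    ultimately show "b = c \<and> l = m" by blast
  qed
  have "card (sep (affine_reflection a k x)) \<le> card (sep x - {(a, k)})"
    using card_inj_on_le[OF inj im] finite_sep by simp
  also have "\<dots> < card (sep x)"
    using a finite_sep by (intro card_Diff1_less) (auto simp: sep_def)
  finally show ?thesis .
qed

end

section \<open>Roots as affine hyperplanes\<close>

locale affine_representation =
  geometric_representation W S B \<alpha> \<rho> + affine_arrangement R C x0
  for W :: "('g, 'm) monoid_scheme" (structure) and S B
    and \<alpha> :: "'g \<Rightarrow> 'v::real_vector" and \<rho> and R :: "'e::euclidean_space set" and C x0 +
  fixes \<phi> :: "'g \<Rightarrow> 'e \<Rightarrow> 'e"
  assumes phi_iso: "\<phi> \<in> iso W (affine_weyl_group R)"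
    and phi_walls: "\<phi> ` S = wall_reflections R C"
begin

lemma affine_reflection_Bij: "a \<in> R \<Longrightarrow> affine_reflection a k \<in> Bij UNIV"
  unfolding Bij_def by (auto simp: extensional_def intro!: o_bij[of "affine_reflection a k"] refl_refl)

lemma affine_group_Bij:
  assumes "g \<in> carrier (affine_weyl_group R)"
  shows "g \<in> Bij UNIV"
proof -
  have "{affine_reflection a k | a k. a \<in> R} \<subseteq> carrier (BijGroup UNIV)"
    using affine_reflection_Bij by (auto simp: BijGroup_def)
  then have "g \<in> carrier (BijGroup UNIV)"
    using group.generate_in_carrier[OF group_BijGroup] assms by (auto simp: affine_weyl_group_def)
  then show ?thesis by (simp add: BijGroup_def)
qed

lemma phi_hom: "\<phi> \<in> hom W (affine_weyl_group R)" and phi_bij: "bij_betw \<phi> (carrier W) (carrier (affine_weyl_group R))"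
  using phi_iso by (auto simp: iso_def)

lemma phi_Bij: "w \<in> carrier W \<Longrightarrow> \<phi> w \<in> Bij UNIV"
  using affine_group_Bij hom_in_carrier[OF phi_hom] by blast

lemma phi_mult:
  assumes "u \<in> carrier W" "v \<in> carrier W"
  shows "\<phi> (u \<otimes> v) x = \<phi> u (\<phi> v x)"
proof -
  have "\<phi> (u \<otimes> v) = \<phi> u \<otimes>\<^bsub>BijGroup UNIV\<^esub> \<phi> v"
    using hom_mult[OF phi_hom assms] by (simp add: affine_weyl_group_def)
  then show ?thesis using phi_Bij assms by (simp add: BijGroup_def compose_def)
qed

lemma phi_one: "\<phi> \<one> x = x"
proof -
  have "\<phi> \<one> (\<phi> \<one> x) = \<phi> \<one> x" using phi_mult[of \<one> \<one> x] by simp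
  moreover have "inj (\<phi> \<one>)" using phi_Bij[OF one_closed] by (simp add: Bij_def bij_betw_def)
  ultimately show ?thesis by (simp add: inj_eq)
qed

lemma phi_inv:
  assumes "w \<in> carrier W"
  shows "\<phi> w (\<phi> (inv w) x) = x" "\<phi> (inv w) (\<phi> w x) = x"
  using phi_mult[of w "inv w" x] phi_mult[of "inv w" w x] assms phi_one by simp_all

lemma phi_inj: "u \<in> carrier W \<Longrightarrow> v \<in> carrier W \<Longrightarrow> (\<And>x. \<phi> u x = \<phi> v x) \<Longrightarrow> u = v"
  using phi_bij by (auto simp: bij_betw_def inj_on_def fun_eq_iff)

lemma phi_gen:
  assumes "s \<in> S"
  obtains a k where "a \<in> R" "wall a k" "\<phi> s = affine_reflection a k"
proof -
  have "\<phi> s \<in> wall_reflections R C" using phi_walls assms by blast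
  then show ?thesis using that by (auto simp: wall_reflections_def wall_def)
qed

lemma wall_gen:
  assumes "a \<in> R" "wall a k"
  obtains s where "s \<in> S" "\<phi> s = affine_reflection a k"
proof -
  have "affine_reflection a k \<in> \<phi> ` S"
    unfolding phi_walls wall_reflections_def using assms by (auto simp: wall_def)
  then show ?thesis using that by auto
qed

lemma phi_reflection_surj:
  assumes "a \<in> R"
  obtains t where "t \<in> carrier W" "\<phi> t = affine_reflection a k"
proof -
  have "affine_reflection a k \<in> carrier (affine_weyl_group R)"
    using assms by (auto simp: affine_weyl_group_def intro: generate.incl)
  then have "affine_reflection a k \<in> \<phi> ` carrier W" using phi_bij by (simp add: bij_betw_def)
  then show ?thesis using that by auto
qed

lemma carrier_word: "w \<in> carrier W \<Longrightarrow> \<exists>xs. set xs \<subseteq> S \<and> word_value W xs = w"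
  using len_word[of w] by metis

text \<open>
  The group permutes the affine functions of the arrangement, compatibly with the reflections.
\<close>

lemma pullback:
  assumes w: "w \<in> carrier W" and a: "a \<in> R"
  obtains a' k' where "a' \<in> R" "\<And>x. ev a k (\<phi> w x) = ev a' k' x"
    "\<And>x. affine_reflection a k (\<phi> w x) = \<phi> w (affine_reflection a' k' x)"
proof -
  obtain xs where xs: "set xs \<subseteq> S" "word_value W xs = w" using carrier_word[OF w] by blast
  have "\<exists>a'\<in>R. \<exists>k'. (\<forall>x. ev a k (\<phi> (word_value W xs) x) = ev a' k' x) \<and>
    (\<forall>x. affine_reflection a k (\<phi> (word_value W xs) x) = \<phi> (word_value W xs) (affine_reflection a' k' x))"
    using xs(1) a
  proof (induction xs arbitrary: a k)
    case Nil
    then show ?case by (intro bexI[of _ a] exI[of _ k]) (auto simp: phi_one)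
  next
    case (Cons s xs)
    have sS: "s \<in> S" using Cons.prems by simp
    obtain b l where b: "b \<in> R" "\<phi> s = affine_reflection b l" using phi_gen[OF sS] by metis
    let ?v = "word_value W xs"
    have v: "?v \<in> carrier W" using Cons.prems by simp
    let ?a = "a - real_of_int (cartan b a) *\<^sub>R b"
    let ?k = "k - cartan b a * l"
    have "?a \<in> R" using cartan_R b Cons.prems by blast
    then obtain a' k' where "a' \<in> R" "\<forall>x. ev ?a ?k (\<phi> ?v x) = ev a' k' x"
      "\<forall>x. affine_reflection ?a ?k (\<phi> ?v x) = \<phi> ?v (affine_reflection a' k' x)"
      using Cons.IH[of ?a ?k] Cons.prems by auto
    then show ?case
      using b v Cons.prems
      by (intro bexI[of _ a'] exI[of _ k']) (auto simp: phi_mult ev_refl refl_conj)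
  qed
  then show ?thesis using that xs(2) by blast
qed

text \<open>
  The hyperplane of the reflection in the positive root \<open>y\<close>, oriented so that the base alcove is
  on its positive side.  Below, \<open>F(y)\<close> stands for the affine function \<open>\<lambda>x. a \<bullet> x - k\<close> when \<open>hyp y a k\<close>.
\<close>

definition hyp :: "'v \<Rightarrow> 'e \<Rightarrow> int \<Rightarrow> bool" where
  "hyp y a k \<longleftrightarrow> y \<in> pos_roots \<and> a \<in> R \<and> \<phi> (reflection y) = affine_reflection a k \<and> 0 < ev a k x0"

lemma hypD:
  assumes "hyp y a k"
  shows "y \<in> pos_roots" "a \<in> R" "\<phi> (reflection y) = affine_reflection a k" "0 < ev a k x0"
    "y \<in> roots"
  using assms pos_root by (auto simp: hyp_def)

lemma hyp_of_reflection:
  assumes "y \<in> pos_roots" "a \<in> R" "\<phi> (reflection y) = affine_reflection a k"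
  shows "hyp y a k \<or> hyp y (- a) (- k)"
proof -
  have "ev a k x0 \<noteq> 0" using generic_base assms by (simp add: generic_def)
  then show ?thesis using assms neg_R[OF assms(2)] by (auto simp: hyp_def ev_neg refl_neg)
qed

lemma hyp_ex:
  assumes "y \<in> pos_roots"
  obtains a k where "hyp y a k"
proof -
  obtain u s where u: "u \<in> carrier W" "s \<in> S" "y = \<rho> u (\<alpha> s)"
    using pos_root[OF assms] by (auto simp: roots_def)
  have r: "reflection y = u \<otimes> s \<otimes> inv u"
    using u by (simp add: reflection_conj simple_in_roots reflection_simple)
  obtain b l where b: "b \<in> R" "\<phi> s = affine_reflection b l" using phi_gen[OF u(2)] by metis
  obtain a k where a: "a \<in> R"
    "\<And>x. affine_reflection b l (\<phi> (inv u) x) = \<phi> (inv u) (affine_reflection a k x)"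
    using pullback[OF inv_closed[OF u(1)] b(1), of l] by metis
  have "\<phi> (reflection y) = affine_reflection a k"
  proof
    fix x
    have "\<phi> (reflection y) x = \<phi> u (\<phi> s (\<phi> (inv u) x))" unfolding r using u(1,2) by (simp add: phi_mult)
    then show "\<phi> (reflection y) x = affine_reflection a k x" using u(1) by (simp add: b a(2) phi_inv)
  qed
  then show ?thesis using hyp_of_reflection[OF assms a(1)] that by blast
qed

lemma hyp_unique: "hyp y a k \<Longrightarrow> hyp y b l \<Longrightarrow> b = a \<and> l = k"
  using refl_eq[of a b k l] ev_neg[of a k x0] hypD[of y a k] hypD[of y b l] by auto

lemma hyp_inj:
  assumes "hyp y a k" "hyp z a k"
  shows "y = z"
proof -
  note y = hypD[OF assms(1)] and z = hypD[OF assms(2)]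
  have "reflection y = reflection z"
    using y z reflection(1) by (intro phi_inj) auto
  then have "y = z \<or> y = - z" using reflection_eq y z by blast
  then show ?thesis using y z pos_not_neg[of z] by auto
qed

lemma hyp_simple:
  assumes "s \<in> S"
  obtains b l where "hyp (\<alpha> s) b l" "wall b l" "\<phi> s = affine_reflection b l"
proof -
  obtain b l where b: "b \<in> R" "wall b l" "\<phi> s = affine_reflection b l" using phi_gen[OF assms] by metis
  have "affine_hyperplane (- b) (- l) = affine_hyperplane b l" by (simp add: affine_hyperplane_def)
  then have "wall (- b) (- l)" using b by (simp add: wall_def)
  moreover have "\<phi> s = affine_reflection (- b) (- l)" using b by (simp add: refl_neg)
  moreover have "hyp (\<alpha> s) b l \<or> hyp (\<alpha> s) (- b) (- l)"
    using hyp_of_reflection[OF simple_pos[OF assms] b(1)] b assms by (simp add: reflection_simple)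
  ultimately show ?thesis using that b by blast
qed

lemma hyp_hyperplane_eq:
  assumes "hyp y a k" "hyp z b l" "affine_hyperplane a k = affine_hyperplane b l"
  shows "y = z"
proof -
  have "b = a \<and> l = k \<or> b = - a \<and> l = - k"
    using hyperplane_subset assms hypD by blast
  then have "hyp z a k" using assms hypD[OF assms(1)] hypD[OF assms(2)] ev_neg[of a k x0] by auto
  then show ?thesis using hyp_inj assms by blast
qed

lemma hyp_act_simple:
  assumes y: "hyp y a k" and s: "s \<in> S" "hyp (\<alpha> s) b l" "wall b l" "\<phi> s = affine_reflection b l" and ne: "y \<noteq> \<alpha> s"
  shows "hyp (\<rho> s y) (a - real_of_int (cartan b a) *\<^sub>R b) (k - cartan b a * l)"
  unfolding hyp_def
proof (intro conjI)
  note yy = hypD[OF y] and ss = hypD[OF s(2)]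
  show "\<rho> s y \<in> pos_roots" using gen_permutes_pos[OF s(1) yy(1) ne] .
  show "a - real_of_int (cartan b a) *\<^sub>R b \<in> R" using cartan_R ss yy by blast
  show "\<phi> (reflection (\<rho> s y)) = affine_reflection (a - real_of_int (cartan b a) *\<^sub>R b) (k - cartan b a * l)"
  proof
    fix x
    let ?a = "a - real_of_int (cartan b a) *\<^sub>R b" and ?k = "k - cartan b a * l"
    have "\<phi> (reflection (\<rho> s y)) x = affine_reflection b l (affine_reflection a k (affine_reflection b l x))"
      using s yy reflection(1)[of y] by (simp add: reflection_conj phi_mult)
    also have "\<dots> = affine_reflection b l (affine_reflection b l (affine_reflection ?a ?k x))"
      by (simp only: refl_conj[OF ss(2) yy(2)])
    finally show "\<phi> (reflection (\<rho> s y)) x = affine_reflection ?a ?k x" by (simp only: refl_refl[OF ss(2)])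
  qed
  have "affine_hyperplane a k \<noteq> affine_hyperplane b l" using hyp_hyperplane_eq[OF y s(2)] ne by blast
  then have "0 < ev a k x0 * ev a k (affine_reflection b l x0)"
    using wall_separates_only ss s yy by blast
  then show "0 < ev (a - real_of_int (cartan b a) *\<^sub>R b) (k - cartan b a * l) x0"
    using yy by (simp add: ev_refl[OF ss(2) yy(2), symmetric] zero_less_mult_iff)
qed

lemma generic_orbit: "w \<in> carrier W \<Longrightarrow> generic (\<phi> w x0)"
proof -
  assume w: "w \<in> carrier W"
  show ?thesis
    unfolding generic_def
  proof (intro ballI allI)
    fix a k assume "a \<in> R"
    then obtain a' k' where "a' \<in> R" "\<And>x. ev a k (\<phi> w x) = ev a' k' x"
      using pullback[OF w] by metis
    then show "ev a k (\<phi> w x0) \<noteq> 0" using generic_base by (simp add: generic_def)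
  qed
qed

text \<open>
  Inversion sets and sets of separating hyperplanes change in the same way when a simple reflection is
  prepended, because a simple reflection separates the base alcove from its image by one hyperplane only.
\<close>

theorem inversion_ev:
  assumes w: "w \<in> carrier W" and y: "hyp y a k"
  shows "y \<in> inversion_set w \<longleftrightarrow> ev a k (\<phi> w x0) < 0"
proof -
  obtain xs where xs: "set xs \<subseteq> S" "word_value W xs = w" using carrier_word[OF w] by blast
  have "y \<in> inversion_set (word_value W xs) \<longleftrightarrow> ev a k (\<phi> (word_value W xs) x0) < 0"
    using xs(1) y
  proof (induction xs arbitrary: y a k)
    case Nil
    then show ?case using hypD(4)[of y a k] by (simp add: inversion_one phi_one)
  next
    case (Cons s xs)
    let ?v = "word_value W xs"
    have s: "s \<in> S" and v: "?v \<in> carrier W" using Cons.prems by auto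
    obtain b l where b: "hyp (\<alpha> s) b l" "wall b l" "\<phi> s = affine_reflection b l"
      using hyp_simple[OF s] by metis
    have bR: "b \<in> R" using hypD b by blast
    have aR: "a \<in> R" using hypD Cons.prems by blast
    have e: "\<phi> (s \<otimes> ?v) x0 = affine_reflection b l (\<phi> ?v x0)" using s v b by (simp add: phi_mult)
    show ?case
    proof (cases "y = \<alpha> s")
      case True
      then have bl: "b = a" "l = k" using hyp_unique Cons.prems b by blast+
      have "\<alpha> s \<in> inversion_set ?v \<longleftrightarrow> ev b l (\<phi> ?v x0) < 0" using Cons.IH[OF _ b(1)] Cons.prems by auto
      moreover have "ev b l (\<phi> ?v x0) \<noteq> 0" using generic_orbit[OF v] bR by (simp add: generic_def)
      ultimately have "\<alpha> s \<notin> inversion_set ?v \<longleftrightarrow> 0 < ev b l (\<phi> ?v x0)" by auto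
      then show ?thesis
        using inversion_left_simple[OF v s] True bl by (simp add: e ev_refl_self[OF bR, unfolded bl])
    next
      case False
      have h: "hyp (\<rho> s y) (a - real_of_int (cartan b a) *\<^sub>R b) (k - cartan b a * l)"
        using hyp_act_simple[OF _ s b False] Cons.prems by blast
      then show ?thesis
        using Cons.IH[OF _ h] Cons.prems inversion_left[OF v s _ False] hypD(1)[of y a k]
        by (simp add: e ev_refl[OF bR aR])
    qed
  qed
  then show ?thesis using xs by simp
qed

text \<open>
  The affine reflection is the image of some \<open>t \<in> W\<close>.  Along a word for \<open>t\<close>, the successive images of the base
  alcove pass to the other side of the hyperplane at some letter, and at that letter the hyperplane
  is the image of a wall.
\<close>

lemma hyp_onto:
  assumes a: "a \<in> R" and pos: "0 < ev a k x0"
  obtains y where "hyp y a k"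
proof (rule ccontr)
  assume no: "\<not> thesis"
  note found = that
  have nr: "\<phi> (reflection y) \<noteq> affine_reflection a k" if y: "y \<in> roots" for y
  proof
    assume e: "\<phi> (reflection y) = affine_reflection a k"
    consider "y \<in> pos_roots" | "- y \<in> pos_roots" using root_cases[OF y] by blast
    then show False
    proof cases
      case 1
      then have "hyp y a k" using e a pos by (simp add: hyp_def)
      then show False using no found by blast
    next
      case 2
      then have "hyp (- y) a k" using e a pos reflection_neg[OF y] by (simp add: hyp_def)
      then show False using no found by blast
    qed
  qed
  have all: "0 < ev a k (\<phi> (word_value W xs) x0)" if "set xs \<subseteq> S" for xs
    using that
  proof (induction xs rule: rev_induct)
    case Nil
    then show ?case using pos by (simp add: phi_one)
  next
    case (snoc s xs)
    let ?u = "word_value W xs"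
    have s: "s \<in> S" and xs: "set xs \<subseteq> S" using snoc.prems by auto
    have u: "?u \<in> carrier W" using xs by simp
    obtain b l where b: "b \<in> R" "wall b l" "\<phi> s = affine_reflection b l" using phi_gen[OF s] by metis
    obtain a' k' where a': "a' \<in> R" "\<And>x. ev a k (\<phi> ?u x) = ev a' k' x"
      "\<And>x. affine_reflection a k (\<phi> ?u x) = \<phi> ?u (affine_reflection a' k' x)"
      using pullback[OF u a] by metis
    have "affine_hyperplane a' k' \<noteq> affine_hyperplane b l"
    proof
      assume "affine_hyperplane a' k' = affine_hyperplane b l"
      then have "b = a' \<and> l = k' \<or> b = - a' \<and> l = - k'" using hyperplane_subset a' b by blast
      then have "affine_reflection a' k' = \<phi> s" using b by (auto simp: refl_neg)
      then have "affine_reflection a k x = \<phi> (?u \<otimes> s \<otimes> inv ?u) x" for x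
        using a'(3)[of "\<phi> (inv ?u) x"] u s by (simp add: phi_mult phi_inv)
      then have "\<phi> (reflection (\<rho> ?u (\<alpha> s))) = affine_reflection a k"
        using u s by (auto simp: fun_eq_iff reflection_conj simple_in_roots reflection_simple)
      then show False using nr act_roots[OF u simple_in_roots[OF s]] by blast
    qed
    then have "0 < ev a' k' x0 * ev a' k' (affine_reflection b l x0)"
      using wall_separates_only b a' by blast
    moreover have "0 < ev a' k' x0" using snoc.IH xs a'(2)[of x0] by simp
    ultimately have "0 < ev a k (\<phi> ?u (\<phi> s x0))" using a'(2) b by (simp add: zero_less_mult_iff)
    moreover have "word_value W (xs @ [s]) = ?u \<otimes> s" using word_append[OF xs, of "[s]"] s by simp
    ultimately show ?case using u s by (simp add: phi_mult)
  qed
  obtain t where t: "t \<in> carrier W" "\<phi> t = affine_reflection a k" using phi_reflection_surj[OF a] by metis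
  then obtain xs where "set xs \<subseteq> S" "word_value W xs = t" using carrier_word by blast
  then have "0 < ev a k (affine_reflection a k x0)" using all[of xs] t by simp
  then show False using pos ev_refl_self[OF a, of k x0] by simp
qed

text \<open>
  Reflect in separating walls until no hyperplane separates.
\<close>

lemma generic_transitive:
  assumes "generic x"
  shows "\<exists>v\<in>carrier W. same_side x0 (\<phi> v x)"
  using assms
proof (induction "card (sep x)" arbitrary: x rule: less_induct)
  case less
  show ?case
  proof (cases "same_side x0 x")
    case True
    then show ?thesis by (intro bexI[of _ \<one>]) (auto simp: phi_one)
  next
    case False
    then obtain a k where a: "a \<in> R" "wall a k" "0 < ev a k x0" "ev a k x < 0"
      using separating_wall less.prems by metis
    obtain s where s: "s \<in> S" "\<phi> s = affine_reflection a k" using wall_gen[OF a(1,2)] by metis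
    obtain v where "v \<in> carrier W" "same_side x0 (\<phi> v (\<phi> s x))"
      using less.hyps[of "\<phi> s x"] sep_wall_reflection[OF a] generic_refl[OF a(1) less.prems] s by auto
    then show ?thesis using s by (intro bexI[of _ "v \<otimes> s"]) (auto simp: phi_mult)
  qed
qed

text \<open>
  This is how geometry enters the rest of the proof: the signs of the affine functions at any generic point
  are those of an inversion set.
\<close>

lemma open_chamber:
  assumes "open U" "U \<noteq> {}"
  obtains w x where "w \<in> carrier W" "x \<in> U"
    "\<forall>y a k. hyp y a k \<longrightarrow> (y \<in> inversion_set w \<longleftrightarrow> ev a k x < 0)"
proof -
  obtain x where x: "x \<in> U" "generic x" using generic_dense assms by metis
  obtain v where v: "v \<in> carrier W" "same_side x0 (\<phi> v x)" using generic_transitive x by blast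
  have "y \<in> inversion_set (inv v) \<longleftrightarrow> ev a k x < 0" if y: "hyp y a k" for y a k
  proof -
    obtain a' k' where a': "a' \<in> R" "\<And>x. ev a k (\<phi> (inv v) x) = ev a' k' x"
      using pullback[OF inv_closed[OF v(1)] hypD(2)[OF y], of k] by metis
    have "0 < ev a' k' x0 * ev a' k' (\<phi> v x)" using v a' by (simp add: same_side_def)
    moreover have "ev a' k' (\<phi> v x) = ev a k x" using a'(2)[of "\<phi> v x"] v by (simp add: phi_inv)
    ultimately show ?thesis
      using inversion_ev[of "inv v" y a k] v y a'(2)[of x0] by (auto simp: zero_less_mult_iff)
  qed
  then show ?thesis using that[of "inv v" x] v x by auto
qed

lemma le_base_iff: "a \<in> R \<Longrightarrow> 0 < ev a k x0 \<longleftrightarrow> k \<le> base a"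
proof -
  assume a: "a \<in> R"
  show ?thesis
  proof
    assume "0 < ev a k x0"
    then show "k \<le> base a" unfolding ev_def base_def by (simp add: le_floor_iff)
  next
    assume "k \<le> base a"
    then have "real_of_int k \<le> real_of_int (base a)" by simp
    then show "0 < ev a k x0" using base_less[OF a] by (simp add: ev_def)
  qed
qed

lemma independent_values:
  assumes "a \<in> R" "b \<in> R" "b \<noteq> a" "b \<noteq> - a"
  obtains x where "a \<bullet> x = s" "b \<bullet> x = t"
proof -
  have na: "a \<bullet> a \<noteq> 0" using nonzero_R assms by simp
  define v where "v = b - ((a \<bullet> b) / (a \<bullet> a)) *\<^sub>R a"
  have av: "a \<bullet> v = 0" using na by (simp add: v_def inner_diff_right)
  have "v \<noteq> 0"
  proof
    assume "v = 0"
    then have "b = ((a \<bullet> b) / (a \<bullet> a)) *\<^sub>R a" by (simp add: v_def)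
    then show False using reduced_R[OF assms(1)] assms by (metis scaleR_minus1_left scaleR_one)
  qed
  then have bv: "b \<bullet> v \<noteq> 0"
  proof -
    have "b \<bullet> v = v \<bullet> v" using av by (simp add: v_def inner_diff_left)
    then show ?thesis using \<open>v \<noteq> 0\<close> by simp
  qed
  define x where "x = (s / (a \<bullet> a)) *\<^sub>R a + ((t - s * (b \<bullet> a) / (a \<bullet> a)) / (b \<bullet> v)) *\<^sub>R v"
  have "a \<bullet> x = s" "b \<bullet> x = t" using na av bv by (simp_all add: x_def inner_add_right)
  then show ?thesis using that by blast
qed

lemma independent_ev:
  assumes "a \<in> R" "b \<in> R" "b \<noteq> a" "b \<noteq> - a"
  obtains x where "ev a k x = s" "ev b l x = t"
  using independent_values[OF assms, of "s + real_of_int k" "t + real_of_int l"]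
  by (metis add_diff_cancel_right' ev_def)

lemma open_ev:
  "open {x. ev a k x < c}" "open {x. c < ev a k x}" "open {x. p * ev a k x < c}" "open {x. c < p * ev a k x}"
  unfolding ev_def by (intro open_Collect_less continuous_intros)+

text \<open>
  The excluded sign patterns are open conditions on \<open>z\<close>, so they would hold for some inversion set \<open>N(w)\<close>.
  Applying the inverse of \<open>w\<close> to the relation would then write a positive root as a negative combination
  of positive roots, or vice versa.
\<close>

lemma sign_relation:
  assumes y: "hyp y c m" and u: "hyp u a k" and v: "hyp v b l" and rel: "y = p *\<^sub>R u + q *\<^sub>R v"
  shows "p = 0 \<or> p * ev a k z < 0 \<Longrightarrow> q = 0 \<or> q * ev b l z < 0 \<Longrightarrow> 0 < ev c m z \<Longrightarrow> False"
    and "p = 0 \<or> 0 < p * ev a k z \<Longrightarrow> q = 0 \<or> 0 < q * ev b l z \<Longrightarrow> ev c m z < 0 \<Longrightarrow> False"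
proof -
  \<comment> \<open>the two claims differ by the sign \<open>e\<close> only\<close>
  have key: False
    if e: "e = 1 \<or> e = -1" and z: "p = 0 \<or> e * p * ev a k z < 0" "q = 0 \<or> e * q * ev b l z < 0" "0 < e * ev c m z"
    for e :: real
  proof -
    let ?U = "{x. (p = 0 \<or> e * p * ev a k x < 0) \<and> (q = 0 \<or> e * q * ev b l x < 0) \<and> 0 < e * ev c m x}"
    have U: "open ?U" by (intro open_Collect_conj open_Collect_disj open_ev open_Collect_const)
    have "z \<in> ?U" using z by simp
    then have "?U \<noteq> {}" by (metis empty_iff)
    with U obtain w x where w: "w \<in> carrier W" "x \<in> ?U"
      "\<forall>y a k. hyp y a k \<longrightarrow> (y \<in> inversion_set w \<longleftrightarrow> ev a k x < 0)"
      by (rule open_chamber)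
    let ?r = "\<rho> (inv w)"
    have side: "- ((e * p) *\<^sub>R ?r u) \<in> cone (\<alpha> ` S)"
      if u: "hyp u a k" and p: "p = 0 \<or> e * p * ev a k x < 0" for u a k p
    proof -
      have up: "u \<in> pos_roots" using u hypD by blast
      consider "p = 0" | "e * p < 0" "0 < ev a k x" | "0 < e * p" "ev a k x < 0"
        using p by (auto simp: mult_less_0_iff)
      then show ?thesis
      proof cases
        case 1
        then show ?thesis by (simp add: cone_zero)
      next
        case 2
        then have "?r u \<in> pos_roots" using w(3)[rule_format, OF u] not_inv_iff[OF w(1) up] by simp
        then have "(- (e * p)) *\<^sub>R ?r u \<in> cone (\<alpha> ` S)" using 2 pos_cone by (intro cone_scale) auto
        then show ?thesis by simp
      next
        case 3
        then have "- ?r u \<in> pos_roots" using w(3)[rule_format, OF u] inv_iff[OF w(1)] by blast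
        then have "(e * p) *\<^sub>R (- ?r u) \<in> cone (\<alpha> ` S)" using 3 pos_cone by (intro cone_scale) auto
        then show ?thesis by simp
      qed
    qed
    have yr: "e *\<^sub>R ?r y = (e * p) *\<^sub>R ?r u + (e * q) *\<^sub>R ?r v"
      using w(1) by (simp add: rel scaleR_right_distrib)
    have "- (e *\<^sub>R ?r y) = - ((e * p) *\<^sub>R ?r u) + - ((e * q) *\<^sub>R ?r v)" by (simp add: yr)
    then have neg: "- (e *\<^sub>R ?r y) \<in> cone (\<alpha> ` S)"
      using cone_add[OF side[OF u] side[OF v]] w(2) by auto
    have yp: "y \<in> pos_roots" using y hypD by blast
    have "e *\<^sub>R ?r y \<in> pos_roots"
      using e
    proof
      assume "e = 1"
      then show ?thesis using w(2) w(3)[rule_format, OF y] not_inv_iff[OF w(1) yp] by auto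
    next
      assume "e = -1"
      then show ?thesis using w(2) w(3)[rule_format, OF y] inv_iff[OF w(1)] by auto
    qed
    then show False
      using cone_pointed[OF pos_cone neg] root_nonzero pos_root by blast
  qed
  show "p = 0 \<or> p * ev a k z < 0 \<Longrightarrow> q = 0 \<or> q * ev b l z < 0 \<Longrightarrow> 0 < ev c m z \<Longrightarrow> False"
    using key[of 1] by simp
  show "p = 0 \<or> 0 < p * ev a k z \<Longrightarrow> q = 0 \<or> 0 < q * ev b l z \<Longrightarrow> ev c m z < 0 \<Longrightarrow> False"
    using key[of "-1"] by simp
qed

section \<open>Dominance and depth\<close>

text \<open>
  Domination says that the negative side of one hyperplane is contained in that of the other, which forces
  the hyperplanes to be parallel.
\<close>

lemma dominated_iff:
  assumes b: "hyp \<beta> b l" and c: "hyp \<gamma> c m"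
  shows "dominated \<gamma> \<beta> \<longleftrightarrow> c = b \<and> l \<le> m"
proof
  assume "c = b \<and> l \<le> m"
  then have "ev c m x \<le> ev b l x" for x by (simp add: ev_def)
  then show "dominated \<gamma> \<beta>"
    unfolding dominated_def using inversion_ev[OF _ b] inversion_ev[OF _ c] by (meson le_less_trans)
next
  assume d: "dominated \<gamma> \<beta>"
  have bR: "b \<in> R" and cR: "c \<in> R" using b c hypD by auto
  have no: False if z: "ev b l z < 0" "0 < ev c m z" for z
  proof -
    let ?U = "{x. ev b l x < 0} \<inter> {x. 0 < ev c m x}"
    have U: "open ?U" by (intro open_Int open_ev)
    have "z \<in> ?U" using z by simp
    then have "?U \<noteq> {}" by (metis empty_iff)
    with U obtain w x where w: "w \<in> carrier W" "x \<in> ?U"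
      "\<forall>y a k. hyp y a k \<longrightarrow> (y \<in> inversion_set w \<longleftrightarrow> ev a k x < 0)"
      by (rule open_chamber)
    then have "\<beta> \<in> inversion_set w" "\<gamma> \<notin> inversion_set w" using w(3)[rule_format, OF b] w(3)[rule_format, OF c] by auto
    then show False using d w(1) by (simp add: dominated_def)
  qed
  have bb: "b \<bullet> b > 0" using nonzero_R bR by simp
  consider "c = b" | "c = - b" | "c \<noteq> b" "c \<noteq> - b" by blast
  then show "c = b \<and> l \<le> m"
  proof cases
    case 1
    have "l \<le> m"
    proof (rule ccontr)
      assume "\<not> l \<le> m"
      then have lm: "real_of_int m < real_of_int l" by simp
      define z where "z = (((real_of_int m + real_of_int l) / 2) / (b \<bullet> b)) *\<^sub>R b"
      have "b \<bullet> z = (real_of_int m + real_of_int l) / 2" using bb by (simp add: z_def)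
      then show False using no[of z] lm 1 by (simp add: ev_def)
    qed
    then show ?thesis using 1 by blast
  next
    case 2
    define z where "z = ((min (real_of_int l) (- real_of_int m) - 1) / (b \<bullet> b)) *\<^sub>R b"
    have "b \<bullet> z = min (real_of_int l) (- real_of_int m) - 1" using bb by (simp add: z_def)
    then show ?thesis using no[of z] 2 by (simp add: ev_def min_def split: if_splits)
  next
    case 3
    then obtain z where "ev b l z = -1" "ev c m z = 1" using independent_ev[OF bR cR] by metis
    then show ?thesis using no[of z] by simp
  qed
qed

lemma depth:
  assumes b: "hyp \<beta> b l"
  shows "inf_depth \<beta> = enat (nat (base b - l))"
proof -
  have bR: "b \<in> R" using b hypD by blast
  define f where "f m = (SOME y. hyp y b m)" for m
  have f: "hyp (f m) b m" if "m \<le> base b" for m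
    unfolding f_def using hyp_onto[OF bR] le_base_iff[OF bR] that by (metis someI_ex)
  have "strictly_dominated \<beta> = f ` {l<..base b}"
  proof (intro equalityI subsetI)
    fix g assume "g \<in> strictly_dominated \<beta>"
    then have g: "g \<in> pos_roots" "dominated g \<beta>" "g \<noteq> \<beta>" by (auto simp: strictly_dominated_def)
    obtain c m where c: "hyp g c m" using hyp_ex[OF g(1)] by blast
    then have cm: "c = b" "l \<le> m" using dominated_iff[OF b] g by auto
    have "m \<noteq> l" using hyp_inj[OF b] c cm g by auto
    moreover have mb: "m \<le> base b" using hypD[OF c] le_base_iff[OF bR] cm by auto
    moreover have "g = f m" using hyp_inj[OF f[OF mb]] c cm by auto
    ultimately show "g \<in> f ` {l<..base b}" using cm by auto
  next
    fix g assume "g \<in> f ` {l<..base b}"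
    then obtain m where m: "l < m" "m \<le> base b" "g = f m" by auto
    have "g \<noteq> \<beta>" using hyp_unique[OF b] f[OF m(2)] m by auto
    then show "g \<in> strictly_dominated \<beta>"
      using f[OF m(2)] m dominated_iff[OF b] hypD by (auto simp: strictly_dominated_def)
  qed
  moreover have "inj_on f {l<..base b}"
    using f hyp_unique by (intro inj_onI) (metis greaterThanAtMost_iff)
  ultimately show ?thesis by (simp add: inf_depth_def card_image)
qed

lemma small_iff:
  assumes "hyp \<beta> b l"
  shows "\<beta> \<in> small_roots n \<longleftrightarrow> base b - l \<le> int n"
  using hypD[OF assms] depth[OF assms] by (auto simp: small_roots_def)

lemma finite_small_roots: "finite (small_roots n)"
proof (rule finite_subset)
  show "small_roots n \<subseteq> (\<lambda>(b, l). SOME y. hyp y b l) ` (SIGMA b:R. {base b - int n..base b})"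
  proof
    fix y assume y: "y \<in> small_roots n"
    then have "y \<in> pos_roots" by (simp add: small_roots_def)
    then obtain b l where b: "hyp y b l" using hyp_ex by blast
    have "y = (SOME y. hyp y b l)" using hyp_inj someI[of "\<lambda>y. hyp y b l", OF b] b by blast
    moreover have "b \<in> R" "l \<le> base b" using hypD[OF b] le_base_iff by auto
    moreover have "base b - int n \<le> l" using small_iff[OF b] y by auto
    ultimately show "y \<in> (\<lambda>(b, l). SOME y. hyp y b l) ` (SIGMA b:R. {base b - int n..base b})"
      by (intro image_eqI[of _ _ "(b, l)"]) auto
  qed
qed (use finite_R in auto)


section \<open>Bipodality\<close>

text \<open>
  Two independent vectors in a plane span it; the ambient space may have infinite dimension.
\<close>

lemma span_pair_exchange:
  assumes T: "finite T" "card T \<le> 2" and uv: "u \<in> span T" "v \<in> span T" "u \<notin> span {v}" "v \<noteq> (0::'v)"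
    and y: "y \<in> span T"
  obtains l m where "y = l *\<^sub>R u + m *\<^sub>R v"
proof -
  have ind: "independent {u, v}"
    using uv by (intro independent_insertI) (auto simp: independent_empty)
  have ne: "u \<noteq> v" using uv by (metis span_base singletonI)
  have "y \<in> span {u, v}"
  proof (rule ccontr)
    assume n: "y \<notin> span {u, v}"
    then have "independent {y, u, v}" using ind by (rule independent_insertI)
    moreover have "{y, u, v} \<subseteq> span T" using uv y by simp
    ultimately have "card {y, u, v} \<le> card T" using independent_span_bound[OF T(1)] by blast
    moreover have "y \<noteq> u" "y \<noteq> v" using n span_base[of u "{u, v}"] span_base[of v "{u, v}"] by auto
    ultimately show False using T(2) ne by simp
  qed
  then obtain k where "y - k *\<^sub>R u \<in> span {v}" by (auto simp: span_insert)
  then obtain m where "y - k *\<^sub>R u = m *\<^sub>R v" by (auto simp: span_singleton)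
  then have "y = k *\<^sub>R u + m *\<^sub>R v" by (simp add: algebra_simps)
  then show ?thesis using that by blast
qed

lemma root_not_in_span:
  assumes "y \<in> pos_roots" "z \<in> pos_roots" "y \<noteq> z"
  shows "y \<notin> span {z}"
  using root_scale[OF assms(1,2)] assms(3) by (auto simp: span_singleton)

lemma plane_pair:
  assumes P: "subspace P" "dim P = 2" and uv: "u \<in> P" "v \<in> P" "u \<in> pos_roots" "v \<in> pos_roots" "u \<noteq> v"
    and y: "y \<in> P"
  obtains l m where "y = l *\<^sub>R u + m *\<^sub>R v"
proof -
  obtain T where T: "T \<subseteq> P" "independent T" "P \<subseteq> span T" "card T = dim P"
    using basis_exists by blast
  have fT: "finite T" using T P card.infinite by fastforce
  show ?thesis
  proof (rule span_pair_exchange[OF fT])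
    show "card T \<le> 2" using T P by simp
    show "u \<in> span T" "v \<in> span T" "y \<in> span T" using uv y T by auto
    show "u \<notin> span {v}" using root_not_in_span uv by blast
    show "v \<noteq> 0" using uv pos_root root_nonzero by blast
  qed (use that in blast)
qed

subsection \<open>Planes of parallel hyperplanes\<close>

lemma mirror_reflection:
  assumes x: "x \<in> roots" "a \<in> R" "\<phi> (reflection x) = affine_reflection a k"
    and g: "g \<in> roots" "b \<in> R" "\<phi> (reflection g) = affine_reflection b l"
  shows "\<phi> (reflection (mirror g x)) = affine_reflection (a - real_of_int (cartan b a) *\<^sub>R b) (k - cartan b a * l)"
proof
  fix z
  let ?a = "a - real_of_int (cartan b a) *\<^sub>R b" and ?k = "k - cartan b a * l"
  have "- mirror g x = \<rho> (reflection g) x" using reflection(2)[OF g(1)] by (simp add: mirror_def)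
  then have "mirror g x = - \<rho> (reflection g) x" by (metis minus_minus)
  then have "reflection (mirror g x) = reflection g \<otimes> reflection x \<otimes> reflection g"
    using reflection_conj[OF reflection(1)[OF g(1)] x(1)] reflection(1)[OF g(1)]
    by (simp add: reflection_neg act_roots reflection_inv x(1) g(1))
  then have "\<phi> (reflection (mirror g x)) z =
      affine_reflection b l (affine_reflection a k (affine_reflection b l z))"
    using x g reflection(1)[OF x(1)] reflection(1)[OF g(1)] by (simp add: phi_mult)
  also have "\<dots> = affine_reflection b l (affine_reflection b l (affine_reflection ?a ?k z))"
    by (simp only: refl_conj[OF g(2) x(2)])
  finally show "\<phi> (reflection (mirror g x)) z = affine_reflection ?a ?k z" by (simp only: refl_refl[OF g(2)])
qed

lemma cartan_self: "a \<in> R \<Longrightarrow> cartan a a = 2"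
  using nonzero_R[of a] by (simp add: cartan_def)

text \<open>
  Parallel hyperplanes are treated here as a family indexed by all integers, and so without regard to the
  sign of the roots.
\<close>

definition root_at :: "'e \<Rightarrow> int \<Rightarrow> 'v \<Rightarrow> bool" where
  "root_at b i y \<longleftrightarrow> y \<in> roots \<and> \<phi> (reflection y) = affine_reflection b i"

lemma root_at_ex:
  assumes "b \<in> R"
  shows "\<exists>y. root_at b i y"
proof (cases "0 < ev b i x0")
  case True
  then obtain y where "hyp y b i" using hyp_onto assms by blast
  then show ?thesis using hypD unfolding root_at_def by blast
next
  case False
  moreover have "ev b i x0 \<noteq> 0" using generic_base assms by (simp add: generic_def)
  ultimately have "0 < ev (- b) (- i) x0" by (simp add: ev_neg)
  then obtain y where "hyp y (- b) (- i)" using hyp_onto neg_R[OF assms] by blast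
  then have "root_at b i y" using hypD[of y "- b" "- i"] by (simp add: root_at_def refl_neg)
  then show ?thesis by blast
qed

lemma root_at_unique: "root_at b i y \<Longrightarrow> root_at b i z \<Longrightarrow> y = z \<or> y = - z"
  unfolding root_at_def using reflection_eq[of y z] phi_inj[of "reflection y" "reflection z"] reflection(1) by auto

text \<open>
  Reflecting the hyperplane \<open>i + 1\<close> in the hyperplane \<open>i\<close> gives the hyperplane \<open>i - 1\<close>.
\<close>

lemma root_at_mirror:
  assumes b: "b \<in> R" and yzx: "root_at b i y" "root_at b (i + 1) z" "root_at b (i - 1) x"
  shows "mirror y z = x \<or> mirror y z = - x"
proof -
  have y: "y \<in> roots" "\<phi> (reflection y) = affine_reflection b i"
    and z: "z \<in> roots" "\<phi> (reflection z) = affine_reflection b (i + 1)"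
    using yzx by (auto simp: root_at_def)
  have "\<phi> (reflection (mirror y z)) = affine_reflection (- b) (- (i - 1))"
    using mirror_reflection[OF z(1) b z(2) y(1) b y(2)]
    by (simp add: cartan_self[OF b] scaleR_2 algebra_simps)
  then have "\<phi> (reflection (mirror y z)) = affine_reflection b (i - 1)" by (simp only: refl_neg)
  then have "root_at b (i - 1) (mirror y z)" using mirror_root[OF y(1) z(1)] by (simp add: root_at_def)
  then show ?thesis using root_at_unique yzx by blast
qed

text \<open>
  By \<open>root_at_mirror\<close>, of three consecutive roots each outer one is in the span of the other two, so the
  whole parallel family spans a plane.
\<close>

lemma parallel_plane:
  assumes b: "b \<in> R" and uv: "root_at b i u" "root_at b j v" "u \<notin> span {v}" and y: "root_at b k y"
  obtains l m where "y = l *\<^sub>R u + m *\<^sub>R v"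
proof -
  obtain Y where Y: "\<And>i. root_at b i (Y i)" using root_at_ex[OF b] by metis
  let ?P = "span {Y 0, Y 1}"
  have up: "Y (i + 1) \<in> ?P" if "Y i \<in> ?P" "Y (i - 1) \<in> ?P" for i
  proof -
    have "mirror (Y i) (Y (i + 1)) \<in> ?P"
      using root_at_mirror[OF b Y[of i] Y[of "i + 1"] Y[of "i - 1"]] that(2) by (metis span_neg)
    then have "(2 * B (Y i) (Y (i + 1))) *\<^sub>R Y i - mirror (Y i) (Y (i + 1)) \<in> ?P"
      using that(1) by (intro span_diff span_scale)
    then show ?thesis by (simp add: mirror_def)
  qed
  have down: "Y (i - 1) \<in> ?P" if "Y i \<in> ?P" "Y (i + 1) \<in> ?P" for i
  proof -
    have "mirror (Y i) (Y (i + 1)) \<in> ?P"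
      unfolding mirror_def using that by (intro span_diff span_scale)
    then show ?thesis
      using root_at_mirror[OF b Y[of i] Y[of "i + 1"] Y[of "i - 1"]] by (metis minus_minus span_neg)
  qed
  have "Y i \<in> ?P \<and> Y (i + 1) \<in> ?P" for i
  proof (induction i rule: int_induct[where k = 0])
    case base
    then show ?case by (simp add: span_base)
  next
    case (step1 i)
    then show ?case using up[of "i + 1"] by simp
  next
    case (step2 i)
    then show ?case using down[of i] by simp
  qed
  then have all: "w \<in> ?P" if "root_at b i w" for w i
    using root_at_unique[OF that Y[of i]] by (metis span_neg)
  show ?thesis
  proof (rule span_pair_exchange[of "{Y 0, Y 1}" u v y])
    show "card {Y 0, Y 1} \<le> 2" by (simp add: card_insert_if)
    show "u \<in> ?P" "v \<in> ?P" "y \<in> ?P" using all uv y by blast+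
    show "v \<noteq> 0" using uv(2) root_nonzero by (simp add: root_at_def)
  qed (use uv that in auto)
qed

lemma hyp_root_at: "hyp y b i \<Longrightarrow> root_at b i y"
  using hypD[of y b i] by (simp add: root_at_def)

text \<open>
  If \<open>\<beta>\<close> had positive depth, its two neighbours \<open>e\<close> and \<open>f\<close> in the parallel family would be positive roots of
  the plane, exchanged by the reflection in \<open>\<beta>\<close> up to sign; so \<open>\<beta>\<close> would not be simple.
\<close>

lemma parallel_simple_depth:
  assumes b: "hyp \<beta> b l" and x: "hyp x a k" "a = b \<or> a = - b" "x \<noteq> \<beta>"
    and simple: "\<And>y l m. y \<in> pos_roots \<Longrightarrow> y = l *\<^sub>R \<beta> + m *\<^sub>R x \<Longrightarrow> y \<noteq> \<beta> \<Longrightarrow> - mirror \<beta> y \<in> pos_roots"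
  shows "base b = l"
proof (rule ccontr)
  assume ne: "base b \<noteq> l"
  have bR: "b \<in> R" and bb: "b \<bullet> b > 0" using hypD(2)[OF b] nonzero_R by auto
  have lt: "l < base b" using hypD(4)[OF b] le_base_iff[OF bR] ne by simp
  obtain e where e: "hyp e b (l + 1)" using hyp_onto[OF bR] le_base_iff[OF bR] lt by (metis zless_imp_add1_zle)
  obtain f where f: "hyp f b (l - 1)" using hyp_onto[OF bR, of "l - 1"] le_base_iff[OF bR, of "l - 1"] lt by auto
  have xr: "root_at b (if a = b then k else - k) x"
    using x(2) hypD[OF x(1)] refl_neg[of a k] by (auto simp: root_at_def)
  have "\<beta> \<notin> span {x}" using root_not_in_span[of \<beta> x] hypD(1)[OF b] hypD(1)[OF x(1)] x(3) by auto
  then obtain p q where "e = p *\<^sub>R \<beta> + q *\<^sub>R x"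
    using parallel_plane[OF bR hyp_root_at[OF b] xr _ hyp_root_at[OF e]] by metis
  moreover have "e \<noteq> \<beta>"
  proof
    assume "e = \<beta>"
    then have "hyp \<beta> b (l + 1)" using e by simp
    from hyp_unique[OF b this] show False by simp
  qed
  ultimately have n: "- mirror \<beta> e \<in> pos_roots" using simple[OF hypD(1)[OF e]] by blast
  define c where "c = 2 * B \<beta> e"
  have "mirror \<beta> e = f \<or> mirror \<beta> e = - f"
    using root_at_mirror[OF bR hyp_root_at hyp_root_at hyp_root_at] b e f by blast
  moreover have "mirror \<beta> e \<noteq> f" using n hypD(1)[OF f] pos_not_neg[of f] by auto
  ultimately have m: "c *\<^sub>R \<beta> - e = - f" by (simp add: mirror_def c_def)
  \<comment> \<open>points between consecutive hyperplanes, where the signs contradict \<open>e = f + c \<beta>\<close> or \<open>f = e - c \<beta>\<close>\<close>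
  define z where "z t = ((real_of_int l + t) / (b \<bullet> b)) *\<^sub>R b" for t
  have z: "ev b (l + i) (z t) = t - real_of_int i" for i t using bb by (simp add: ev_def z_def)
  show False
  proof (cases "0 \<le> c")
    case True
    have "e = 1 *\<^sub>R f + c *\<^sub>R \<beta>" using m by (simp add: algebra_simps)
    moreover have ev: "0 < ev b (l - 1) (z (1/2))" "0 < ev b l (z (1/2))" "ev b (l + 1) (z (1/2)) < 0"
      using z[of "-1" "1/2"] z[of 0 "1/2"] z[of 1 "1/2"] by simp_all
    moreover have "c = 0 \<or> 0 < c * ev b l (z (1/2))" using True ev(2) by (cases "c = 0") simp_all
    ultimately show False using sign_relation(2)[OF e f b, of 1 c "z (1/2)"] by simp
  next
    case False
    have "f = 1 *\<^sub>R e + (- c) *\<^sub>R \<beta>" using m by (simp add: algebra_simps)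
    moreover have ev: "0 < ev b (l - 1) (z (-1/2))" "ev b l (z (-1/2)) < 0" "ev b (l + 1) (z (-1/2)) < 0"
      using z[of "-1" "-1/2"] z[of 0 "-1/2"] z[of 1 "-1/2"] by simp_all
    moreover have "(- c) * ev b l (z (-1/2)) < 0"
      using False ev(2) by (intro mult_pos_neg) simp_all
    ultimately show False using sign_relation(1)[OF f e b, of 1 "- c" "z (-1/2)"] by simp
  qed
qed

subsection \<open>Planes of concurrent hyperplanes\<close>

text \<open>
  On the affine functions, the relation \<open>x = x\<^sub>1 + 2 B(g, x) g\<close> becomes \<open>F(x) = \<plusminus> F(x\<^sub>1) + n F(g)\<close> with a Cartan
  number \<open>n\<close>; comparing signs gives the positive sign and \<open>n \<ge> 1\<close>.  As all three functions are positive on the base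
  alcove and \<open>n\<close> is an integer, \<open>F(x)\<close> exceeds both \<open>F(x\<^sub>1)\<close> and \<open>F(g)\<close> there.
\<close>

lemma depth_monotone:
  assumes x: "hyp x a k" and g: "hyp g b l" "b \<noteq> a" "b \<noteq> - a" and x1: "hyp (- mirror g x) c m"
    and pos: "0 < B g x"
  shows "base b - l \<le> base a - k" "base c - m \<le> base a - k"
proof -
  note xx = hypD[OF x] and gg = hypD[OF g(1)] and yy = hypD[OF x1]
  define n where "n = cartan b a"
  define a' where "a' = a - real_of_int n *\<^sub>R b"
  define k' where "k' = k - n * l"
  have a'R: "a' \<in> R" unfolding a'_def n_def using cartan_R xx gg by blast
  have "\<phi> (reflection (- mirror g x)) = affine_reflection a' k'"
    using mirror_reflection[OF xx(5,2,3) gg(5,2,3)] reflection_neg[OF mirror_root[OF gg(5) xx(5)]]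
    by (simp add: a'_def k'_def n_def)
  then have cm: "c = a' \<and> m = k' \<or> c = - a' \<and> m = - k'"
    using refl_eq[OF a'R yy(2), of k' m] yy(3) by simp
  have ev': "ev a' k' z = ev a k z - real_of_int n * ev b l z" for z
    by (simp add: a'_def k'_def ev_def inner_diff_left algebra_simps)
  have rel: "x = 1 *\<^sub>R (- mirror g x) + (2 * B g x) *\<^sub>R g" by (simp add: mirror_def)
  have c: "c = a'" "m = k'"
  proof -
    have "\<not> (c = - a' \<and> m = - k')"
    proof
      assume cm: "c = - a' \<and> m = - k'"
      \<comment> \<open>a point with \<open>F(g)\<close> so small that the sign of \<open>F(x\<^sub>1) = n F(g) - F(x)\<close> is that of \<open>- F(x)\<close>\<close>
      define t where "t = 1 / (\<bar>real_of_int n\<bar> + 1)"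
      have t: "0 < t" "\<bar>real_of_int n\<bar> * t < 1" by (auto simp: t_def divide_simps)
      obtain z where z: "ev a k z = - 1" "ev b l z = t" using independent_ev[OF xx(2) gg(2) g(2,3)] by metis
      have "- (\<bar>real_of_int n\<bar> * t) \<le> real_of_int n * t"
        using t(1) by (metis abs_ge_minus_self abs_mult abs_of_pos minus_le_iff)
      then have "0 < ev c m z" using cm z t ev_neg[of a' k' z] ev'[of z] by simp
      then show False using sign_relation(2)[OF x x1 g(1) rel, of z] z pos t by simp
    qed
    then show "c = a'" "m = k'" using cm by auto
  qed
  have n: "1 \<le> n"
  proof (rule ccontr)
    assume "\<not> 1 \<le> n"
    then consider "n = 0" | "n \<le> - 1" by linarith
    then show False
    proof cases
      case 1
      then have "hyp (- mirror g x) a k" using x1 c by (simp add: a'_def k'_def)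
      then have "- mirror g x = x" using hyp_inj x by blast
      then have "(2 * B g x) *\<^sub>R g = 0" by (simp add: mirror_def)
      then show False using pos root_nonzero gg by simp
    next
      case 2
      obtain z where z: "ev a k z = - 1 / 2" "ev b l z = 1" using independent_ev[OF xx(2) gg(2) g(2,3)] by metis
      have "real_of_int n \<le> real_of_int (- 1)" using 2 by (simp only: of_int_le_iff)
      then have "0 < ev c m z" using c z ev'[of z] by simp
      then show False using sign_relation(2)[OF x x1 g(1) rel, of z] z pos by simp
    qed
  qed
  have n1: "1 \<le> real_of_int n" using n by simp
  have shift: "ev a (k + i) x0 = ev c m x0 + real_of_int n * ev b l x0 - real_of_int i" for i
    using ev'[of x0] c by (simp add: ev_def)
  have ge: "ev b l x0 \<le> real_of_int n * ev b l x0"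
    using mult_right_mono[OF n1, of "ev b l x0"] gg by simp
  have "0 < ev b (base b) x0" using le_base_iff[OF gg(2)] by simp
  then have "real_of_int (base b - l) < ev b l x0" by (simp add: ev_def)
  then have "0 < ev a (k + (base b - l)) x0" using shift[of "base b - l"] ge yy(4) by argo
  then show "base b - l \<le> base a - k" using le_base_iff[OF xx(2)] by simp
  have "0 < ev c (base c) x0" using le_base_iff[OF yy(2)] by simp
  then have "real_of_int (base c - m) < ev c m x0" by (simp add: ev_def)
  then have "0 < ev a (k + (base c - m)) x0" using shift[of "base c - m"] ge gg(4) by argo
  then show "base c - m \<le> base a - k" using le_base_iff[OF xx(2)] by simp
qed

text \<open>
  Otherwise, move from \<open>z\<close> in a direction in which \<open>F(u)\<close> and \<open>F(v)\<close> acquire the signs forbidden by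
  \<open>sign_relation\<close> for the sign of \<open>F(y)\<close> at \<open>z\<close>.
\<close>

lemma concurrent:
  assumes y: "hyp y c m" "y = p *\<^sub>R u + q *\<^sub>R v" and uv: "hyp u a k" "hyp v b l" "b \<noteq> a" "b \<noteq> - a"
    and z: "ev a k z = 0" "ev b l z = 0"
  shows "ev c m z = 0"
proof (rule ccontr)
  assume n: "ev c m z \<noteq> 0"
  define e :: real where "e = sgn (ev c m z)"
  obtain d where d: "a \<bullet> d = - e * p" "b \<bullet> d = - e * q"
    using independent_values[OF hypD(2)[OF uv(1)] hypD(2)[OF uv(2)] uv(3,4)] by metis
  \<comment> \<open>short enough that the sign of \<open>F(y)\<close> does not change\<close>
  define t where "t = \<bar>ev c m z\<bar> / (2 * (\<bar>c \<bullet> d\<bar> + 1))"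
  have t: "0 < t" using n by (simp add: t_def)
  define w where "w = z + t *\<^sub>R d"
  have ew: "ev a k w = - (t * e * p)" "ev b l w = - (t * e * q)" "ev c m w = ev c m z + t * (c \<bullet> d)"
    using z d by (simp_all add: w_def ev_def inner_add_right algebra_simps)
  have "t * \<bar>c \<bullet> d\<bar> \<le> \<bar>ev c m z\<bar> / 2"
  proof -
    have "t * \<bar>c \<bullet> d\<bar> = (\<bar>ev c m z\<bar> / 2) * (\<bar>c \<bullet> d\<bar> / (\<bar>c \<bullet> d\<bar> + 1))"
      by (simp add: t_def)
    also have "\<dots> \<le> (\<bar>ev c m z\<bar> / 2) * 1"
    proof (rule mult_left_mono)
      have "0 < \<bar>c \<bullet> d\<bar> + 1" using abs_ge_zero[of "c \<bullet> d"] by linarith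
      then show "\<bar>c \<bullet> d\<bar> / (\<bar>c \<bullet> d\<bar> + 1) \<le> 1" by (simp add: divide_le_eq_1_pos)
    qed simp
    finally show ?thesis by simp
  qed
  then have small: "\<bar>t * (c \<bullet> d)\<bar> < \<bar>ev c m z\<bar>" using n t by (simp add: abs_mult)
  have sq: "r = 0 \<or> 0 < t * (r * r)" for r :: real using t by (metis mult_pos_pos not_real_square_gt_zero)
  show False
  proof (cases "0 < ev c m z")
    case True
    then have "e = 1" by (simp add: e_def)
    moreover have "0 < ev c m w" using small True ew(3) by linarith
    ultimately show False
      using sign_relation(1)[OF y(1) uv(1,2) y(2), of w] sq[of p] sq[of q] ew(1,2)
      by (auto simp: algebra_simps)
  next
    case False
    then have "e = -1" using n by (simp add: e_def)
    moreover have "ev c m w < 0" using small False n ew(3) by linarith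
    ultimately show False
      using sign_relation(2)[OF y(1) uv(1,2) y(2), of w] sq[of p] sq[of q] ew(1,2)
      by (auto simp: algebra_simps)
  qed
qed

text \<open>
  In the case of concurrent hyperplanes the plane contains finitely many roots, hence two extreme ones:
  \<open>\<beta>\<close> and another simple root \<open>g\<close>.  If a root \<open>y\<close> other than these is at an acute angle with \<open>\<beta>\<close>, then
  \<open>depth_monotone\<close> applies to \<open>y\<close> and \<open>\<beta>\<close>.  Otherwise \<open>y\<close> is at an acute angle with \<open>g\<close>, and reflecting it in \<open>g\<close>
  gives a root closer to \<open>\<beta>\<close> of at most the same depth.
\<close>

theorem simple_depth_le:
  assumes P: "subspace P" "dim P = 2"
    and \<beta>: "\<beta> \<in> pos_roots" "\<beta> \<in> P" "\<And>y. y \<in> pos_roots \<inter> P \<Longrightarrow> y \<noteq> \<beta> \<Longrightarrow> - mirror \<beta> y \<in> pos_roots"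
    and x: "x \<in> pos_roots" "x \<in> P" "x \<noteq> \<beta>"
    and nonsimple: "\<exists>y\<in>pos_roots \<inter> P. y \<noteq> x \<and> - mirror x y \<notin> pos_roots"
    and b: "hyp \<beta> b l" and a: "hyp x a k"
  shows "base b - l \<le> base a - k"
proof -
  have bR: "b \<in> R" and aR: "a \<in> R" using a b hypD by auto
  show ?thesis
  proof (cases "a = b \<or> a = - b")
    case True
    have "base b = l"
    proof (rule parallel_simple_depth[OF b a True x(3)])
      fix y l m assume "y \<in> pos_roots" "y = l *\<^sub>R \<beta> + m *\<^sub>R x" "y \<noteq> \<beta>"
      then show "- mirror \<beta> y \<in> pos_roots" using \<beta> x P by (simp add: subspace_add subspace_scale)
    qed
    moreover have "k \<le> base a" using hypD(4)[OF a] le_base_iff[OF aR] by simp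
    ultimately show ?thesis by simp
  next
    case False
    define Q where "Q = pos_roots \<inter> P"
    have xQ: "x \<in> Q" and bQ: "\<beta> \<in> Q" using x \<beta> by (auto simp: Q_def)
    have nab: "b \<noteq> a" "b \<noteq> - a" using False by auto
    obtain z where z: "ev a k z = 0" "ev b l z = 0" using independent_ev[OF aR bR nab] by metis
    have Qz: "ev c m z = 0" if y: "y \<in> Q" "hyp y c m" for y c m
    proof -
      obtain p q where "y = p *\<^sub>R x + q *\<^sub>R \<beta>"
        using plane_pair[OF P x(2) \<beta>(2) x(1) \<beta>(1) x(3), of y] y by (auto simp: Q_def)
      then show ?thesis using concurrent[OF y(2) _ a b nab z] by blast
    qed
    have notpar: "c' \<noteq> c \<and> c' \<noteq> - c" if "y \<in> Q" "hyp y c m" "y' \<in> Q" "hyp y' c' m'" "y \<noteq> y'" for y c m y' c' m'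
    proof -
      have e: "ev c m z = 0" "ev c' m' z = 0" using Qz that by blast+
      have "m' = m" if "c' = c" using e that by (simp add: ev_def)
      moreover have "m' = - m" if "c' = - c" using e that by (simp add: ev_def)
      ultimately show ?thesis
        using hyp_inj[of y c m y'] that hypD(4)[of y c m] hypD(4)[of y' c' m'] ev_neg[of c m x0] by auto
    qed
    have finQ: "finite Q"
    proof (rule finite_subset)
      show "Q \<subseteq> (\<lambda>c. SOME y. hyp y c \<lfloor>c \<bullet> z\<rfloor>) ` R"
      proof
        fix y assume y: "y \<in> Q"
        then have "y \<in> pos_roots" by (simp add: Q_def)
        then obtain c m where c: "hyp y c m" using hyp_ex by blast
        have "c \<bullet> z = real_of_int m" using Qz[OF y c] by (simp add: ev_def)
        then have c': "hyp y c \<lfloor>c \<bullet> z\<rfloor>" using c by simp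
        then have "y = (SOME y. hyp y c \<lfloor>c \<bullet> z\<rfloor>)" using hyp_inj someI[of "\<lambda>y. hyp y c \<lfloor>c \<bullet> z\<rfloor>", OF c'] by blast
        then show "y \<in> (\<lambda>c. SOME y. hyp y c \<lfloor>c \<bullet> z\<rfloor>) ` R" using hypD(2)[OF c] by blast
      qed
    qed (use finite_R in simp)
    have QP: "p *\<^sub>R u + q *\<^sub>R v \<in> P" if "u \<in> Q" "v \<in> Q" for p q u v
      using that P by (simp add: Q_def subspace_add subspace_scale)
    have mirQ: "- mirror u v \<in> P" "mirror u v \<in> P" if "u \<in> Q" "v \<in> Q" for u v
      using that P by (simp_all add: Q_def mirror_def subspace_diff subspace_scale)
    \<comment> \<open>as \<open>\<beta>\<close> is simple, all other roots of the plane are on one side of it\<close>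
    have "\<forall>y\<in>Q. \<exists>p q. y = p *\<^sub>R \<beta> + q *\<^sub>R x"
      using plane_pair[OF P \<beta>(2) x(2) \<beta>(1) x(1) x(3)[symmetric]] by (metis IntD2 Q_def)
    then obtain f where "\<forall>y\<in>Q. \<exists>q. y = f y *\<^sub>R \<beta> + q *\<^sub>R x" by (metis bchoice)
    then obtain h where fh: "\<And>y. y \<in> Q \<Longrightarrow> y = f y *\<^sub>R \<beta> + h y *\<^sub>R x" by metis
    have hpos: "0 < h y" if y: "y \<in> Q" "y \<noteq> \<beta>" for y
    proof (rule ccontr)
      assume "\<not> 0 < h y"
      then consider "h y = 0" | "h y < 0" by linarith
      then show False
      proof cases
        case 1
        then have e: "y = f y *\<^sub>R \<beta>" using fh[OF y(1)] by simp
        have "y \<in> pos_roots" using y by (simp add: Q_def)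
        from root_scale[OF this \<beta>(1) e] show False using y(2) by simp
      next
        case 2
        have s: "1 *\<^sub>R y + (- h y) *\<^sub>R x = f y *\<^sub>R \<beta>"
          by (subst (1) fh[OF y(1)]) (simp add: scaleR_left_diff_distrib)
        have hx: "0 \<le> - h y" using 2 by simp
        have yp: "y \<in> pos_roots" using y by (simp add: Q_def)
        have "y + (- h y) *\<^sub>R x = f y *\<^sub>R \<beta>" using s by simp
        then have fp: "0 < f y" using pos_sum_positive[OF yp cone_scale[OF pos_cone[OF x(1)] hx] \<beta>(1)] by blast
        have m: "- mirror \<beta> y \<in> pos_roots" "- mirror \<beta> x \<in> pos_roots"
          using \<beta>(3) y xQ x(3) by (auto simp: Q_def)
        have bb: "B \<beta> \<beta> = 1" using root_unit pos_root \<beta> by blast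
        have "- mirror \<beta> y + (- h y) *\<^sub>R (- mirror \<beta> x) =
            (1 *\<^sub>R y + (- h y) *\<^sub>R x) - (2 * B \<beta> (1 *\<^sub>R y + (- h y) *\<^sub>R x)) *\<^sub>R \<beta>"
          by (simp add: mirror_def algebra_simps)
        also have "\<dots> = (- f y) *\<^sub>R \<beta>" unfolding s using bb by (simp add: scaleR_left_diff_distrib[symmetric])
        finally have "0 < - f y"
          using pos_sum_positive[OF m(1) cone_scale[OF pos_cone[OF m(2)] hx] \<beta>(1)] by blast
        then show False using fp by simp
      qed
    qed
    \<comment> \<open>the root with the least slope is the other end of the plane\<close>
    have ne: "Q - {\<beta>} \<noteq> {}" using xQ x by blast
    define g where "g = arg_min_on (\<lambda>y. f y / h y) (Q - {\<beta>})"
    have gQ: "g \<in> Q" "g \<noteq> \<beta>" using arg_min_if_finite(1)[OF _ ne] finQ by (auto simp: g_def)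
    have gmin: "f g / h g \<le> f y / h y" if "y \<in> Q" "y \<noteq> \<beta>" for y
      unfolding g_def using arg_min_least[OF _ ne, of y "\<lambda>y. f y / h y"] finQ that by simp
    have gp: "g \<in> pos_roots" using gQ by (simp add: Q_def)
    have coords: "\<exists>p q. 0 \<le> p \<and> 0 \<le> q \<and> y = p *\<^sub>R \<beta> + q *\<^sub>R g" if y: "y \<in> Q" for y
    proof (cases "y = \<beta>")
      case True
      then show ?thesis by (intro exI[of _ 1] exI[of _ 0]) simp
    next
      case False
      have hp: "0 < h y" "0 < h g" using hpos y gQ False by auto
      have "h g *\<^sub>R x = g - f g *\<^sub>R \<beta>" by (subst (2) fh[OF gQ(1)]) simp
      then have "h g *\<^sub>R x = (- f g) *\<^sub>R \<beta> + 1 *\<^sub>R g" by simp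
      then have xe: "x = (- f g / h g) *\<^sub>R \<beta> + (1 / h g) *\<^sub>R g"
        by (rule scaleR_solve2) (use hp in simp)
      have "y = f y *\<^sub>R \<beta> + h y *\<^sub>R ((- f g / h g) *\<^sub>R \<beta> + (1 / h g) *\<^sub>R g)"
        using fh[OF y] xe by simp
      then have ye: "y = (f y - h y * f g / h g) *\<^sub>R \<beta> + (h y / h g) *\<^sub>R g"
        by (simp add: scaleR_right_distrib scaleR_left_diff_distrib algebra_simps)
      have "h y * (f g / h g) \<le> h y * (f y / h y)"
        using gmin[OF y False] hp by (intro mult_left_mono) auto
      then have "0 \<le> f y - h y * f g / h g" using hp by simp
      then show ?thesis using ye hp by (metis divide_nonneg_pos less_imp_le)
    qed
    have gsimple: "- mirror g y \<in> pos_roots" if y: "y \<in> Q" "y \<noteq> g" for y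
    proof (rule ccontr)
      assume n: "- mirror g y \<notin> pos_roots"
      have yp: "y \<in> pos_roots" using y by (simp add: Q_def)
      have mp: "mirror g y \<in> pos_roots"
        using root_cases[OF mirror_root[OF pos_root[OF gp] pos_root[OF yp]]] n by blast
      then have mQ: "mirror g y \<in> Q" using mirQ gQ y by (simp add: Q_def)
      obtain p q where pq: "0 \<le> p" "0 \<le> q" "y = p *\<^sub>R \<beta> + q *\<^sub>R g" using coords[OF y(1)] by blast
      obtain p' q' where pq': "0 \<le> p'" "0 \<le> q'" "mirror g y = p' *\<^sub>R \<beta> + q' *\<^sub>R g" using coords[OF mQ] by blast
      have "y + mirror g y = (2 * B g y) *\<^sub>R g" by (simp add: mirror_def)
      then have e: "(p + p') *\<^sub>R \<beta> = (2 * B g y - q - q') *\<^sub>R g"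
        unfolding pq'(3) by (subst (asm) (1) pq(3)) (simp add: algebra_simps)
      have "p + p' = 0"
      proof (rule ccontr)
        assume "p + p' \<noteq> 0"
        then have "\<beta> = ((2 * B g y - q - q') / (p + p')) *\<^sub>R g" using scaleR_solve1[OF e] by blast
        from root_scale[OF \<beta>(1) gp this] show False using gQ(2) by simp
      qed
      then have "y = q *\<^sub>R g" using pq pq' by simp
      from root_scale[OF yp gp this] show False using y(2) by simp
    qed
    have xg: "x \<noteq> g"
    proof
      assume "x = g"
      then show False using nonsimple gsimple by (auto simp: Q_def)
    qed
    obtain p where "\<forall>y\<in>Q. \<exists>q. 0 \<le> p y \<and> 0 \<le> q \<and> y = p y *\<^sub>R \<beta> + q *\<^sub>R g" using coords by metis
    then obtain q where pq: "\<And>y. y \<in> Q \<Longrightarrow> 0 \<le> p y" "\<And>y. y \<in> Q \<Longrightarrow> 0 \<le> q y"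
      "\<And>y. y \<in> Q \<Longrightarrow> y = p y *\<^sub>R \<beta> + q y *\<^sub>R g" by metis
    have uniq: "p' = p y \<and> q' = q y" if y: "y \<in> Q" "y = p' *\<^sub>R \<beta> + q' *\<^sub>R g" for y p' q'
    proof -
      have "p' *\<^sub>R \<beta> + q' *\<^sub>R g = p y *\<^sub>R \<beta> + q y *\<^sub>R g" using pq(3)[OF y(1)] y(2) by simp
      then have e: "(p' - p y) *\<^sub>R \<beta> = (q y - q') *\<^sub>R g" by (simp add: algebra_simps)
      have "p' - p y = 0"
      proof (rule ccontr)
        assume "p' - p y \<noteq> 0"
        then have "\<beta> = ((q y - q') / (p' - p y)) *\<^sub>R g" using scaleR_solve1[OF e] by blast
        from root_scale[OF \<beta>(1) gp this] show False using gQ(2) by simp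
      qed
      moreover from this have "(q y - q') *\<^sub>R g = 0" using e by simp
      then have "q y = q'" using root_nonzero[OF pos_root[OF gp]] by simp
      ultimately show ?thesis by simp
    qed
    have ppos: "0 < p y" if y: "y \<in> Q" "y \<noteq> g" for y
    proof (rule ccontr)
      assume "\<not> 0 < p y"
      then have "p y = 0" using pq(1)[OF y(1)] by simp
      then have e: "y = q y *\<^sub>R g" using pq(3)[OF y(1)] by simp
      have "y \<in> pos_roots" using y by (simp add: Q_def)
      from root_scale[OF this gp e] show False using y(2) by simp
    qed
    \<comment> \<open>a counterexample that is closest to \<open>\<beta>\<close>\<close>
    define Bad where "Bad = {y \<in> Q. y \<noteq> \<beta> \<and> y \<noteq> g \<and> (\<exists>c m. hyp y c m \<and> \<not> base b - l \<le> base c - m)}"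
    have "Bad = {}"
    proof (rule ccontr)
      assume neB: "Bad \<noteq> {}"
      have finB: "finite Bad" using finQ by (simp add: Bad_def)
      define y where "y = arg_min_on (\<lambda>y. q y / p y) Bad"
      have yB: "y \<in> Bad" using arg_min_if_finite(1)[OF finB neB] by (simp add: y_def)
      have ymin: "q y / p y \<le> q v / p v" if "v \<in> Bad" for v
        unfolding y_def using arg_min_least[OF finB neB that] .
      obtain c m where y: "y \<in> Q" "y \<noteq> \<beta>" "y \<noteq> g" "hyp y c m" "\<not> base b - l \<le> base c - m"
        using yB by (auto simp: Bad_def)
      have yr: "y \<in> roots" using y pos_root by (simp add: Q_def)
      have "- mirror \<beta> y \<in> pos_roots" using \<beta>(3) y by (simp add: Q_def)
      then obtain c1 m1 where 1: "hyp (- mirror \<beta> y) c1 m1" using hyp_ex by blast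
      have nb: "\<not> 0 < B \<beta> y"
        using depth_monotone(1)[OF y(4) b _ _ 1] notpar[OF y(1,4) bQ b y(2)] y(5) by blast
      have "B y y = p y * B \<beta> y + q y * B g y" by (subst (1) pq(3)[OF y(1)]) (simp add: form_sym[of \<beta> y] form_sym[of g y])
      moreover have "p y * B \<beta> y \<le> 0" using nb pq(1)[OF y(1)] by (simp add: mult_nonneg_nonpos)
      ultimately have "0 < q y * B g y" using root_unit[OF yr] by linarith
      then have Bg: "0 < B g y" using pq(2)[OF y(1)] by (simp add: zero_less_mult_iff)
      obtain e j where e: "hyp g e j" using hyp_ex[OF gp] by blast
      define v where "v = - mirror g y"
      have vp: "v \<in> pos_roots" unfolding v_def using gsimple y by blast
      have vQ: "v \<in> Q" using vp mirQ(1)[OF gQ(1) y(1)] by (simp add: Q_def v_def)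
      obtain c2 m2 where 2: "hyp v c2 m2" using hyp_ex[OF vp] by blast
      have le: "base c2 - m2 \<le> base c - m"
        using depth_monotone(2)[OF y(4) e _ _ 2[unfolded v_def] Bg] notpar[OF y(1,4) gQ(1) e y(3)] by blast
      have vy: "v = p y *\<^sub>R \<beta> + (q y - 2 * B g y) *\<^sub>R g"
        unfolding v_def mirror_def by (subst (2) pq(3)[OF y(1)]) (simp add: algebra_simps)
      have v1: "v \<noteq> \<beta>"
      proof
        assume "v = \<beta>"
        then have "c2 = b" "m2 = l" using hyp_unique[OF b] 2 by auto
        then show False using le y(5) by simp
      qed
      have v2: "v \<noteq> g"
      proof
        assume "v = g"
        then have "p y = 0" using uniq[OF vQ vy] uniq[OF vQ, of 0 1] by simp
        then show False using ppos[OF y(1,3)] by simp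
      qed
      have "v \<in> Bad" using vQ v1 v2 2 le y(5) unfolding Bad_def by force
      then have "q y / p y \<le> q v / p v" by (rule ymin)
      then have "q y / p y \<le> (q y - 2 * B g y) / p y" using uniq[OF vQ vy] by simp
      then show False using ppos[OF y(1,3)] Bg by (simp add: divide_le_cancel)
    qed
    then show ?thesis using xQ x(3) xg a by (auto simp: Bad_def)
  qed
qed

theorem bipodal_small_roots: "bipodal (small_roots n)"
  unfolding bipodal_def
proof (intro conjI allI impI subsetI)
  show "y \<in> pos_roots" if "y \<in> small_roots n" for y using that by (simp add: small_roots_def)
  fix H \<beta>
  assume "maximal_dihedral H" and ne: "small_roots n \<inter> (subgroup_pos_roots H - canonical_simple_system H) \<noteq> {}"
    and \<beta>: "\<beta> \<in> canonical_simple_system H"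
  then obtain P where P: "subspace P" "dim P = 2" and H: "H = generate W (reflection ` (P \<inter> roots))"
    by (auto simp: maximal_dihedral_def)
  obtain x where x: "x \<in> small_roots n" "x \<in> subgroup_pos_roots H" "x \<notin> canonical_simple_system H"
    using ne by blast
  have xP: "x \<in> pos_roots" "x \<in> P"
    using x(2) by (auto simp: subgroup_pos_roots_def H plane_subgroup_roots[OF P(1)])
  have b: "\<beta> \<in> pos_roots" "\<beta> \<in> P" "\<And>y. y \<in> pos_roots \<inter> P \<Longrightarrow> y \<noteq> \<beta> \<Longrightarrow> - mirror \<beta> y \<in> pos_roots"
    using \<beta> unfolding H canonical_simple_iff[OF P(1)] by auto
  have ns: "\<exists>y\<in>pos_roots \<inter> P. y \<noteq> x \<and> - mirror x y \<notin> pos_roots"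
    using x(3) xP unfolding H canonical_simple_iff[OF P(1)] by blast
  have xb: "x \<noteq> \<beta>" using x(3) \<beta> by blast
  obtain a k where a: "hyp x a k" using hyp_ex[OF xP(1)] by blast
  obtain c l where c: "hyp \<beta> c l" using hyp_ex[OF b(1)] by blast
  have "base c - l \<le> base a - k"
    by (rule simple_depth_le[OF P b xP xb ns c a])
  moreover have "base a - k \<le> int n" using small_iff[OF a] x(1) by blast
  ultimately show "\<beta> \<in> small_roots n" using small_iff[OF c] by simp
qed

end

theorem theorem4p17:
  fixes W :: "('g, 'm) monoid_scheme"
    and S :: "'g set"
    and B :: "'v::real_vector \<Rightarrow> 'v \<Rightarrow> real"
    and \<alpha> :: "'g \<Rightarrow> 'v"
    and \<rho> :: "'g \<Rightarrow> 'v \<Rightarrow> 'v"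
    and R :: "'e::euclidean_space set"
    and n :: nat
  assumes "geometric_representation W S B \<alpha> \<rho>"
    and "is_affine_weyl_group W S R"
  shows "geometric_representation.bipodal W S B \<alpha> \<rho>
           (geometric_representation.small_roots W S \<alpha> \<rho> n) \<and>
         finite (geometric_representation.low_elements W S \<alpha> \<rho> n) \<and>
         coxeter_system.garside_shadow W S (geometric_representation.low_elements W S \<alpha> \<rho> n)"
proof -
  obtain C \<phi> where C: "crystallographic_root_system R" "C \<in> alcoves R"
    "\<phi> \<in> iso W (affine_weyl_group R)" "\<phi> ` S = wall_reflections R C"
    using assms(2) by (auto simp: is_affine_weyl_group_def)
  have "C \<noteq> {}" using C(2) in_components_nonempty by (auto simp: alcoves_def)
  then obtain x0 where "x0 \<in> C" by blast
  then interpret affine_representation W S B \<alpha> \<rho> R C x0 \<phi>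
    using assms(1) C by (simp add: affine_representation_def affine_arrangement_def affine_representation_axioms_def)
  show ?thesis
    using bipodal_small_roots bipodal_garside_shadow finite_low finite_small_roots by blast
qed

end
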